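(* Let $\mathcal M$ be an o-minimal structure and let $\mathcal F=\{X_t:t\in T\}$ be a definable family of definable subsets of $M^k$, where $T=Y/E$ is an $\mathcal M$-quotient with $\dim T=1$ (the family being definable in the sense that $\{(y,x)\in Y\times M^k: x\in X_{[y]}\}$ is definable). Then there exists, possibly over additional parameters, a definable $\mathcal F$-injective map $f:T\to M^m$ for some $m$.
   Context: Definable means definable with parameters. An $\mathcal M$-quotient is $Y/E$ with $Y$ a definable set and $E$ a definable equivalence relation on $Y$. A function $f:Y/E\to M^m$ is definable if $\{(y,z)\in Y\times M^m: f([y])=z\}$ is definable. For $g\in Y/E$ and a parameter set $A$ over which everything is defined, $\dim(g/A)$ is the maximum of $\dim(y/A)-\dim[y]$ as $y$ ranges over the class $g$ (with $\dim(y/A)$ the usual o-minimal dcl-dimension and $\dim[y]$ the dimension of the class as a definable set); $\dim(Y/E)=\max\{\dim(g/A):g\in Y/E\}$. A map $f$ on $T$ is an $\mathcal F$-map if $X_t=X_s$ implies $f(t)=f(s)$, and is $\mathcal F$-injective if moreover $f(t)=f(s)$ implies $X_t=X_s$. *)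

theory Defs
  imports Main
begin

unbundle cardinal_syntax

record ('f, 'r) lang =
  fun_arity :: "'f \<Rightarrow> nat"
  rel_arity :: "'r \<Rightarrow> nat"

text \<open>The universe is the whole type \<open>'a\<close>, and the order symbol is a logical symbol interpreted by
  the order of the type class. Values of \<open>Fun\<close> and \<open>Rel\<close> on lists whose length is not the arity
  are irrelevant, because only formulas satisfying \<open>wf_fm\<close> below are used.\<close>

record ('f, 'r, 'a) struct =
  Fun :: "'f \<Rightarrow> 'a list \<Rightarrow> 'a"
  Rel :: "'r \<Rightarrow> 'a list \<Rightarrow> bool"

datatype 'f tm = Var nat | App 'f "'f tm list"

datatype ('f, 'r) fm =
    Less "'f tm" "'f tm"
  | Eq "'f tm" "'f tm"
  | Atom 'r "'f tm list"
  | Neg "('f, 'r) fm"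
  | Conj "('f, 'r) fm" "('f, 'r) fm"
  | Exi "('f, 'r) fm"

text \<open>Variables are de Bruijn indices into a list \<open>e\<close> of values; \<open>wf_fm L n \<phi>\<close> says that \<open>\<phi>\<close> is an
  \<open>L\<close>-formula whose free variables are among the first \<open>n\<close> variables.\<close>

primrec wf_tm :: "('f, 'r) lang \<Rightarrow> nat \<Rightarrow> 'f tm \<Rightarrow> bool" where
  "wf_tm L n (Var i) = (i < n)"
| "wf_tm L n (App f ts) = (length ts = fun_arity L f \<and> list_all (wf_tm L n) ts)"

primrec wf_fm :: "('f, 'r) lang \<Rightarrow> nat \<Rightarrow> ('f, 'r) fm \<Rightarrow> bool" where
  "wf_fm L n (Less s t) = (wf_tm L n s \<and> wf_tm L n t)"
| "wf_fm L n (Eq s t) = (wf_tm L n s \<and> wf_tm L n t)"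
| "wf_fm L n (Atom r ts) = (length ts = rel_arity L r \<and> list_all (wf_tm L n) ts)"
| "wf_fm L n (Neg \<phi>) = wf_fm L n \<phi>"
| "wf_fm L n (Conj \<phi> \<psi>) = (wf_fm L n \<phi> \<and> wf_fm L n \<psi>)"
| "wf_fm L n (Exi \<phi>) = wf_fm L (Suc n) \<phi>"

primrec tm_val :: "('f, 'r, 'a) struct \<Rightarrow> 'a list \<Rightarrow> 'f tm \<Rightarrow> 'a" where
  "tm_val M e (Var i) = e ! i"
| "tm_val M e (App f ts) = Fun M f (map (tm_val M e) ts)"

primrec sat :: "('f, 'r, 'a::linorder) struct \<Rightarrow> 'a list \<Rightarrow> ('f, 'r) fm \<Rightarrow> bool" where
  "sat M e (Less s t) = (tm_val M e s < tm_val M e t)"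
| "sat M e (Eq s t) = (tm_val M e s = tm_val M e t)"
| "sat M e (Atom r ts) = Rel M r (map (tm_val M e) ts)"
| "sat M e (Neg \<phi>) = (\<not> sat M e \<phi>)"
| "sat M e (Conj \<phi> \<psi>) = (sat M e \<phi> \<and> sat M e \<psi>)"
| "sat M e (Exi \<phi>) = (\<exists>x. sat M (x # e) \<phi>)"

text \<open>A point of \<open>M\<^sup>n\<close> is a list of length \<open>n\<close>; \<open>def_set M n \<phi> c\<close> is \<open>\<phi>(M\<^sup>n, c)\<close>.\<close>

definition def_set ::
    "('f, 'r, 'a::linorder) struct \<Rightarrow> nat \<Rightarrow> ('f, 'r) fm \<Rightarrow> 'a list \<Rightarrow> 'a list set" where
  "def_set M n \<phi> c = {x. length x = n \<and> sat M (x @ c) \<phi>}"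

definition definable_over ::
    "('f, 'r) lang \<Rightarrow> ('f, 'r, 'a::linorder) struct \<Rightarrow> 'a set \<Rightarrow> nat \<Rightarrow> 'a list set \<Rightarrow> bool" where
  "definable_over L M A n D \<longleftrightarrow>
     (\<exists>\<phi> c. wf_fm L (n + length c) \<phi> \<and> set c \<subseteq> A \<and> D = def_set M n \<phi> c)"

abbreviation definable ::
    "('f, 'r) lang \<Rightarrow> ('f, 'r, 'a::linorder) struct \<Rightarrow> nat \<Rightarrow> 'a list set \<Rightarrow> bool" where
  "definable L M n D \<equiv> definable_over L M UNIV n D"

definition is_interval :: "'a::linorder set \<Rightarrow> bool" where
  "is_interval I \<longleftrightarrow> I = UNIV \<or> (\<exists>a. I = {a<..}) \<or> (\<exists>b. I = {..<b}) \<or> (\<exists>a b. I = {a<..<b})"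

text \<open>As usual, an o-minimal structure expands a dense linear order without endpoints.\<close>

definition o_minimal ::
    "('f, 'r) lang \<Rightarrow> ('f, 'r, 'a::unbounded_dense_linorder) struct \<Rightarrow> bool" where
  "o_minimal L M \<longleftrightarrow>
     (\<forall>S. definable L M 1 {[x] | x. x \<in> S} \<longrightarrow>
       (\<exists>\<I>. finite \<I> \<and> (\<forall>I\<in>\<I>. is_interval I \<or> (\<exists>a. I = {a})) \<and> S = \<Union>\<I>))"

definition elementary_embedding ::
    "('f, 'r) lang \<Rightarrow> ('f, 'r, 'a::linorder) struct \<Rightarrow> ('f, 'r, 'b::linorder) struct
     \<Rightarrow> ('a \<Rightarrow> 'b) \<Rightarrow> bool" where
  "elementary_embedding L M N h \<longleftrightarrow>
     (\<forall>\<phi> e. wf_fm L (length e) \<phi> \<longrightarrow> sat M e \<phi> = sat N (map h e) \<phi>)"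

text \<open>The set \<open>D(N)\<close> of \<open>N\<close>-points of a definable set \<open>D\<close> of \<open>M\<close>. All pairs \<open>\<phi>, c\<close> that define \<open>D\<close>
  contribute the same set to the union when \<open>h\<close> is an elementary embedding.\<close>

definition extension ::
    "('f, 'r) lang \<Rightarrow> ('f, 'r, 'a::linorder) struct \<Rightarrow> ('f, 'r, 'b::linorder) struct
     \<Rightarrow> ('a \<Rightarrow> 'b) \<Rightarrow> nat \<Rightarrow> 'a list set \<Rightarrow> 'b list set" where
  "extension L M N h n D =
     \<Union>{def_set N n \<phi> (map h c) | \<phi> c. wf_fm L (n + length c) \<phi> \<and> D = def_set M n \<phi> c}"

text \<open>\<open>\<kappa>\<close>-saturation: every 1-type over a set of fewer than \<open>\<kappa>\<close> parameters is realised. A partial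
  1-type is given by the family of the sets defined by its formulas.\<close>

definition saturated ::
    "('f, 'r) lang \<Rightarrow> ('f, 'r, 'a::linorder) struct \<Rightarrow> 'k rel \<Rightarrow> bool" where
  "saturated L N \<kappa> \<longleftrightarrow>
     (\<forall>B p. |B| <o \<kappa> \<and> (\<forall>D\<in>p. definable_over L N B 1 D) \<and>
        (\<forall>q\<subseteq>p. finite q \<longrightarrow> \<Inter>q \<noteq> {}) \<longrightarrow> \<Inter>p \<noteq> {})"

text \<open>A binary relation on \<open>M\<^sup>n\<close>, as a subset of \<open>M\<^sup>n\<^sup>+\<^sup>n\<close>, and back.\<close>

definition rel_set :: "('a list \<times> 'a list) set \<Rightarrow> 'a list set" where
  "rel_set E = {x @ y | x y. (x, y) \<in> E}"

definition set_rel :: "nat \<Rightarrow> 'a list set \<Rightarrow> ('a list \<times> 'a list) set" where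
  "set_rel n D = {(x, y). length x = n \<and> length y = n \<and> x @ y \<in> D}"

text \<open>\<open>Y // E\<close> is an \<open>M\<close>-quotient defined over \<open>A\<close>, with \<open>Y \<subseteq> M\<^sup>n\<close>.\<close>

definition quotient_over ::
    "('f, 'r) lang \<Rightarrow> ('f, 'r, 'a::linorder) struct \<Rightarrow> 'a set \<Rightarrow> nat
     \<Rightarrow> 'a list set \<Rightarrow> ('a list \<times> 'a list) set \<Rightarrow> bool" where
  "quotient_over L M A n Y E \<longleftrightarrow>
     definable_over L M A n Y \<and> equiv Y E \<and> definable_over L M A (n + n) (rel_set E)"

definition dcl :: "('f, 'r) lang \<Rightarrow> ('f, 'r, 'a::linorder) struct \<Rightarrow> 'a set \<Rightarrow> 'a set" where
  "dcl L M A = {b. definable_over L M A 1 {[b]}}"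

text \<open>\<open>dim(y/A)\<close>: the least size of a subtuple \<open>B\<close> of \<open>y\<close> with \<open>y \<subseteq> dcl(A B)\<close>.\<close>

definition dim_tuple ::
    "('f, 'r) lang \<Rightarrow> ('f, 'r, 'a::linorder) struct \<Rightarrow> 'a set \<Rightarrow> 'a list \<Rightarrow> nat" where
  "dim_tuple L M A y = (LEAST d. \<exists>B \<subseteq> set y. card B = d \<and> set y \<subseteq> dcl L M (A \<union> B))"

text \<open>The o-minimal dimension of a nonempty definable \<open>D \<subseteq> M\<^sup>n\<close>: the largest \<open>d\<close> such that some
  projection of \<open>D\<close> to \<open>d\<close> of the coordinates contains a nonempty open box of \<open>M\<^sup>d\<close>
  (\<open>M\<^sup>0 = {[]}\<close> being a box itself).\<close>

definition open_box :: "'a::linorder list \<Rightarrow> 'a list \<Rightarrow> 'a list set" where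
  "open_box a b = {x. length x = length a \<and> (\<forall>i < length a. a ! i < x ! i \<and> x ! i < b ! i)}"

definition dim_set :: "nat \<Rightarrow> 'a::linorder list set \<Rightarrow> nat" where
  "dim_set n D = Max {card I | I. I \<subseteq> {..<n} \<and>
     (\<exists>a b. length a = card I \<and> length b = card I \<and> open_box a b \<noteq> {} \<and>
        open_box a b \<subseteq> (\<lambda>x. nths x I) ` D)}"

text \<open>\<open>dim(g/A)\<close> for \<open>g \<in> Y // E\<close>, and \<open>dim(Y/E)\<close>. These are the intended notions when the structure is
  \<open>\<kappa>\<close>-saturated and \<open>|A| < \<kappa>\<close>, for an infinite cardinal \<open>\<kappa>\<close>, and \<open>Y \<noteq> {}\<close>.\<close>

definition dim_class ::
    "('f, 'r) lang \<Rightarrow> ('f, 'r, 'a::linorder) struct \<Rightarrow> 'a set \<Rightarrow> nat \<Rightarrow> 'a list set \<Rightarrow> int" where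
  "dim_class L M A n g = Max {int (dim_tuple L M A y) - int (dim_set n g) | y. y \<in> g}"

definition dim_quotient ::
    "('f, 'r) lang \<Rightarrow> ('f, 'r, 'a::linorder) struct \<Rightarrow> 'a set \<Rightarrow> nat
     \<Rightarrow> 'a list set \<Rightarrow> ('a list \<times> 'a list) set \<Rightarrow> int" where
  "dim_quotient L M A n Y E = Max {dim_class L M A n g | g. g \<in> Y // E}"

text \<open>\<open>dim(Y/E) = d\<close> for a quotient of an arbitrary structure \<open>M\<close>: the dimension is computed for
  \<open>Y(N)/E(N)\<close> in a sufficiently saturated elementary extension \<open>N\<close> of \<open>M\<close>, over a small set \<open>A\<close> of
  parameters over which \<open>Y(N)\<close> and \<open>E(N)\<close> are defined. In an unsaturated structure the \<open>dcl\<close>-dimension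
  of its own points does not determine dimension (every point has \<open>dim(y/M) = 0\<close>). For an
  o-minimal \<open>M\<close>, \<open>d\<close> does not depend on \<open>N\<close>, \<open>h\<close>, \<open>\<kappa>\<close>, \<open>A\<close>; if \<open>M\<close> itself is sufficiently
  saturated, one may take \<open>N = M\<close> and \<open>h = id\<close>.\<close>

definition quotient_has_dim ::
    "('f, 'r) lang \<Rightarrow> ('f, 'r, 'a::linorder) struct \<Rightarrow> ('f, 'r, 'b::linorder) struct
     \<Rightarrow> ('a \<Rightarrow> 'b) \<Rightarrow> 'k rel \<Rightarrow> 'b set \<Rightarrow> nat
     \<Rightarrow> 'a list set \<Rightarrow> ('a list \<times> 'a list) set \<Rightarrow> int \<Rightarrow> bool" where
  "quotient_has_dim L M N h \<kappa> A n Y E d \<longleftrightarrow>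
     elementary_embedding L M N h \<and> Cinfinite \<kappa> \<and> saturated L N \<kappa> \<and> |A| <o \<kappa> \<and>
     (let YN = extension L M N h n Y;
          EN = set_rel n (extension L M N h (n + n) (rel_set E))
      in quotient_over L N A n YN EN \<and> YN \<noteq> {} \<and> dim_quotient L N A n YN EN = d)"

text \<open>\<open>X\<close> is a family of subsets of \<open>M\<^sup>k\<close> indexed by the classes \<open>t \<in> Y // E\<close>; \<open>E `` {y}\<close> is \<open>[y]\<close>.\<close>

definition definable_family ::
    "('f, 'r) lang \<Rightarrow> ('f, 'r, 'a::linorder) struct \<Rightarrow> nat \<Rightarrow> 'a list set
     \<Rightarrow> ('a list \<times> 'a list) set \<Rightarrow> nat \<Rightarrow> ('a list set \<Rightarrow> 'a list set) \<Rightarrow> bool" where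
  "definable_family L M n Y E k X \<longleftrightarrow>
     (\<forall>t \<in> Y // E. X t \<subseteq> {x. length x = k}) \<and>
     definable L M (n + k) {y @ x | y x. y \<in> Y \<and> x \<in> X (E `` {y})}"

definition definable_quotient_map ::
    "('f, 'r) lang \<Rightarrow> ('f, 'r, 'a::linorder) struct \<Rightarrow> nat \<Rightarrow> 'a list set
     \<Rightarrow> ('a list \<times> 'a list) set \<Rightarrow> nat \<Rightarrow> ('a list set \<Rightarrow> 'a list) \<Rightarrow> bool" where
  "definable_quotient_map L M n Y E m f \<longleftrightarrow>
     (\<forall>t \<in> Y // E. length (f t) = m) \<and>
     definable L M (n + m) {y @ z | y z. y \<in> Y \<and> f (E `` {y}) = z}"

definition F_map :: "'t set \<Rightarrow> ('t \<Rightarrow> 'x) \<Rightarrow> ('t \<Rightarrow> 'z) \<Rightarrow> bool" where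
  "F_map T X f \<longleftrightarrow> (\<forall>t\<in>T. \<forall>s\<in>T. X t = X s \<longrightarrow> f t = f s)"

definition F_injective :: "'t set \<Rightarrow> ('t \<Rightarrow> 'x) \<Rightarrow> ('t \<Rightarrow> 'z) \<Rightarrow> bool" where
  "F_injective T X f \<longleftrightarrow> F_map T X f \<and> (\<forall>t\<in>T. \<forall>s\<in>T. f t = f s \<longrightarrow> X t = X s)"

end

(*
  Replacing E by the coarser relation R (equality of the sets X_t), one has to find finitely many
  definable R-invariant functions Y -> M that separate the R-classes.

  Fix a prefix a and let S(y) be the set of all x such that the class of y contains a tuple starting
  with a, x. Its boundary is finite. Since the quotient has dimension at most 1, only finitely many
  points p lie on the boundary of S(y) for infinitely many classes y. If the boundary of S(y) contains a
  point outside this exceptional set Q, the least such point is an invariant function with finite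
  fibres, and finite fibres are separated by finitely many bits, uniformly in p. Otherwise S(y) is a
  union of cells cut out by Q; it contains one of finitely many points x chosen in advance, and one
  continues with the prefix a, x. The chosen points x are the additional parameters. No definable
  choice is needed.

  The dimension hypothesis lives in N, so N has to be o-minimal. This requires uniform finiteness for M,
  which is proved without cell decomposition. The basis is the symmetry of two-dimensionality: if
  infinitely many fibres W_x of a definable W in M^2 are infinite, then some fibre in the other direction
  is infinite. Applied to N, the same symmetry yields the exchange property of dcl.
*)

theory Submission
  imports Defs
begin

section \<open>Definable predicates of valuations\<close>

text \<open>Without definable choice no element of a class can be named, so an invariant has to be
  read off the class as a set; the boundary points of its slices are such invariants. They also
  serve to count classes: "infinitely many classes over p" is replaced by the condition that, for
  some prefix, the boundary points of the slices of these classes form an infinite set. The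
  dimension can refute this. If it held for infinitely many p, then in \<open>N\<close> there would
  be a generic boundary point p and, generic over it, a second one b'; both lie in the definable
  closure of every element of the class, so the dimension of a generic element exceeds that of its
  class by two. If instead all these boundary sets are finite, then slices are unions of finitely
  many points and intervals, and finitely many bits suffice.

  Finiteness is not a first-order condition, but for definable subsets of an o-minimal line it means
  containing no interval. This turns the finiteness statements into formulas, which can be reused
  inside definitions and transferred to \<open>N\<close>.\<close>

primrec ren_tm :: "(nat \<Rightarrow> nat) \<Rightarrow> 'f tm \<Rightarrow> 'f tm" where
  "ren_tm \<rho> (Var i) = Var (\<rho> i)"
| "ren_tm \<rho> (App f ts) = App f (map (ren_tm \<rho>) ts)"

primrec ren_fm :: "(nat \<Rightarrow> nat) \<Rightarrow> ('f, 'r) fm \<Rightarrow> ('f, 'r) fm" where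
  "ren_fm \<rho> (Less s t) = Less (ren_tm \<rho> s) (ren_tm \<rho> t)"
| "ren_fm \<rho> (Eq s t) = Eq (ren_tm \<rho> s) (ren_tm \<rho> t)"
| "ren_fm \<rho> (Atom r ts) = Atom r (map (ren_tm \<rho>) ts)"
| "ren_fm \<rho> (Neg \<phi>) = Neg (ren_fm \<rho> \<phi>)"
| "ren_fm \<rho> (Conj \<phi> \<psi>) = Conj (ren_fm \<rho> \<phi>) (ren_fm \<rho> \<psi>)"
| "ren_fm \<rho> (Exi \<phi>) = Exi (ren_fm (case_nat 0 (\<lambda>i. Suc (\<rho> i))) \<phi>)"

lemma wf_ren_tm: "wf_tm L m t \<Longrightarrow> \<forall>i<m. \<rho> i < n \<Longrightarrow> wf_tm L n (ren_tm \<rho> t)"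
  by (induction t) (auto simp: list_all_iff)

lemma tm_val_ren:
  "wf_tm L m t \<Longrightarrow> \<forall>i<m. e ! \<rho> i = e' ! i \<Longrightarrow> tm_val M e (ren_tm \<rho> t) = tm_val M e' t"
proof (induction t)
  case (App f ts)
  then have "map (tm_val M e \<circ> ren_tm \<rho>) ts = map (tm_val M e') ts"
    by (auto simp: list_all_iff)
  then show ?case
    by (simp only: ren_tm.simps tm_val.simps map_map)
qed simp

lemma wf_ren_fm: "wf_fm L m \<phi> \<Longrightarrow> \<forall>i<m. \<rho> i < n \<Longrightarrow> wf_fm L n (ren_fm \<rho> \<phi>)"
proof (induction \<phi> arbitrary: \<rho> m n)
  case (Exi \<phi>)
  then show ?case
    by (auto intro!: Exi.IH[of "Suc m"] simp: less_Suc_eq_0_disj)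
qed (auto simp: list_all_iff wf_ren_tm)

lemma sat_ren:
  "wf_fm L m \<phi> \<Longrightarrow> \<forall>i<m. e ! \<rho> i = e' ! i \<Longrightarrow> sat M e (ren_fm \<rho> \<phi>) = sat M e' \<phi>"
proof (induction \<phi> arbitrary: \<rho> m e e')
  case (Atom r ts)
  then have "map (tm_val M e \<circ> ren_tm \<rho>) ts = map (tm_val M e') ts"
    by (auto simp: list_all_iff intro: tm_val_ren)
  then show ?case
    by (simp only: ren_fm.simps sat.simps map_map)
next
  case (Exi \<phi>)
  have "sat M (x # e) (ren_fm (case_nat 0 (\<lambda>i. Suc (\<rho> i))) \<phi>) = sat M (x # e') \<phi>" for x
    using Exi.prems by (intro Exi.IH[of "Suc m"]) (auto simp: less_Suc_eq_0_disj)
  then show ?case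
    by simp
next
  case (Less s t)
  then show ?case
    using tm_val_ren[of L m s e \<rho> e' M] tm_val_ren[of L m t e \<rho> e' M] by simp
next
  case (Eq s t)
  then show ?case
    using tm_val_ren[of L m s e \<rho> e' M] tm_val_ren[of L m t e \<rho> e' M] by simp
next
  case (Conj \<phi> \<psi>)
  then show ?case
    using Conj.IH(1)[of m e \<rho> e'] Conj.IH(2)[of m e \<rho> e'] by simp
next
  case (Neg \<phi>)
  then show ?case
    using Neg.IH[of m e \<rho> e'] by simp
qed

text \<open>A slot is filled either by a variable \<open>Inl k\<close> or by a constant \<open>Inr c\<close>; in the structure
  \<open>N\<close> the constant is read as \<open>h c\<close>.\<close>

definition slot :: "('a \<Rightarrow> 'b) \<Rightarrow> (nat \<Rightarrow> 'b) \<Rightarrow> nat + 'a \<Rightarrow> 'b" where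
  "slot h e v = (case v of Inl k \<Rightarrow> e k | Inr c \<Rightarrow> h c)"

lemma slot_simps [simp]: "slot h e (Inl k) = e k" "slot h e (Inr c) = h c"
  by (simp_all add: slot_def)

definition slots_over :: "'a set \<Rightarrow> (nat + 'a) set \<Rightarrow> bool" where
  "slots_over C V \<longleftrightarrow> (\<forall>c. Inr c \<in> V \<longrightarrow> c \<in> C)"

text \<open>\<open>P\<close> is paired with its counterpart \<open>P'\<close> in \<open>N\<close>, so that sentences can be transferred. Plain
  definability in \<open>M\<close> is the case \<open>N = M\<close>, \<open>h = id\<close>. Binders are de Bruijn: passing under a quantifier
  shifts the valuation, and a tuple is a block of variables \<open>map e [i..<j]\<close>.\<close>

definition dpr :: "('f, 'r) lang \<Rightarrow> ('f, 'r, 'a::linorder) struct \<Rightarrow> ('f, 'r, 'b::linorder) struct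
    \<Rightarrow> ('a \<Rightarrow> 'b) \<Rightarrow> 'a set \<Rightarrow> ((nat \<Rightarrow> 'a) \<Rightarrow> bool) \<Rightarrow> ((nat \<Rightarrow> 'b) \<Rightarrow> bool) \<Rightarrow> bool" where
  "dpr L M N h C P P' \<longleftrightarrow> (\<exists>\<phi> vs. wf_fm L (length vs) \<phi> \<and> slots_over C (set vs) \<and>
     P = (\<lambda>e. sat M (map (slot id e) vs) \<phi>) \<and> P' = (\<lambda>e. sat N (map (slot h e) vs) \<phi>))"

definition tmr :: "('a \<Rightarrow> 'b) \<Rightarrow> 'a set \<Rightarrow> ((nat \<Rightarrow> 'a) \<Rightarrow> 'a) \<Rightarrow> ((nat \<Rightarrow> 'b) \<Rightarrow> 'b) \<Rightarrow> bool" where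
  "tmr h C \<sigma> \<sigma>' \<longleftrightarrow>
     (\<exists>v. slots_over C {v} \<and> \<sigma> = (\<lambda>e. slot id e v) \<and> \<sigma>' = (\<lambda>e. slot h e v))"

definition tupr :: "('a \<Rightarrow> 'b) \<Rightarrow> 'a set \<Rightarrow> nat \<Rightarrow> ((nat \<Rightarrow> 'a) \<Rightarrow> 'a list)
    \<Rightarrow> ((nat \<Rightarrow> 'b) \<Rightarrow> 'b list) \<Rightarrow> bool" where
  "tupr h C n \<tau> \<tau>' \<longleftrightarrow> (\<exists>vs. length vs = n \<and> slots_over C (set vs) \<and>
     \<tau> = (\<lambda>e. map (slot id e) vs) \<and> \<tau>' = (\<lambda>e. map (slot h e) vs))"

named_theorems dpi

lemma tmr_var [dpi]: "tmr h C (\<lambda>e. e k) (\<lambda>e. e k)"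
  unfolding tmr_def by (rule exI[of _ "Inl k"]) (simp add: slots_over_def)

lemma tmr_const [dpi]: "c \<in> C \<Longrightarrow> c' = h c \<Longrightarrow> tmr h C (\<lambda>e. c) (\<lambda>e. c')"
  unfolding tmr_def by (rule exI[of _ "Inr c"]) (simp add: slots_over_def)

lemma tupr_Nil [dpi]: "n = 0 \<Longrightarrow> tupr h C n (\<lambda>e. []) (\<lambda>e. [])"
  unfolding tupr_def by (simp add: slots_over_def)

lemma tupr_map [dpi]:
  "length js = n \<Longrightarrow> tupr h C n (\<lambda>e. map (\<lambda>i. e (f i)) js) (\<lambda>e. map (\<lambda>i. e (f i)) js)"
  unfolding tupr_def
  by (rule exI[of _ "map (\<lambda>i. Inl (f i)) js"]) (auto simp: slots_over_def comp_def)

lemma tupr_append [dpi]: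
  "tupr h C m \<tau> \<tau>' \<Longrightarrow> tupr h C m' \<upsilon> \<upsilon>' \<Longrightarrow> n = m + m' \<Longrightarrow>
   tupr h C n (\<lambda>e. \<tau> e @ \<upsilon> e) (\<lambda>e. \<tau>' e @ \<upsilon>' e)"
  unfolding tupr_def
  by (elim exE conjE, rule_tac x = "vs @ vsa" in exI) (auto simp: slots_over_def)

lemma tupr_Cons [dpi]:
  "tmr h C \<sigma> \<sigma>' \<Longrightarrow> tupr h C m \<tau> \<tau>' \<Longrightarrow> n = Suc m \<Longrightarrow>
   tupr h C n (\<lambda>e. \<sigma> e # \<tau> e) (\<lambda>e. \<sigma>' e # \<tau>' e)"
  unfolding tupr_def tmr_def
  by (elim exE conjE, rule_tac x = "v # vs" in exI) (auto simp: slots_over_def)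

lemma tupr_const [dpi]:
  assumes "set c \<subseteq> C" and "length c = n" and "c' = map h c"
  shows "tupr h C n (\<lambda>e. c) (\<lambda>e. c')"
  unfolding tupr_def using assms
  by (intro exI[of _ "map Inr c"]) (auto simp: slots_over_def comp_def)

section \<open>Closure of definable predicates under connectives, quantifiers and
  substitution\<close>

lemma dpr_not [dpi]: "dpr L M N h C P P' \<Longrightarrow> dpr L M N h C (\<lambda>e. \<not> P e) (\<lambda>e. \<not> P' e)"
  unfolding dpr_def by (elim exE, rule_tac x = "Neg \<phi>" in exI) auto

lemma dpr_conj [dpi]:
  assumes "dpr L M N h C P P'" and "dpr L M N h C Q Q'"
  shows "dpr L M N h C (\<lambda>e. P e \<and> Q e) (\<lambda>e. P' e \<and> Q' e)"
proof -
  from assms obtain \<phi> vs \<psi> ws where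
    1: "wf_fm L (length vs) \<phi>" "slots_over C (set vs)"
      "P = (\<lambda>e. sat M (map (slot id e) vs) \<phi>)" "P' = (\<lambda>e. sat N (map (slot h e) vs) \<phi>)" and
    2: "wf_fm L (length ws) \<psi>" "slots_over C (set ws)"
      "Q = (\<lambda>e. sat M (map (slot id e) ws) \<psi>)" "Q' = (\<lambda>e. sat N (map (slot h e) ws) \<psi>)"
    unfolding dpr_def by blast
  have *: "sat K (map f vs @ ys) (ren_fm (\<lambda>i. i) \<phi>) = sat K (map f vs) \<phi>" for K f ys
    using 1(1) by (intro sat_ren) (auto simp: nth_append)
  have **: "sat K (ys @ map f ws) (ren_fm (\<lambda>i. length ys + i) \<psi>) = sat K (map f ws) \<psi>" for K f ys
    using 2(1) by (intro sat_ren) (auto simp: nth_append)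
  let ?\<chi> = "Conj (ren_fm (\<lambda>i. i) \<phi>) (ren_fm (\<lambda>i. length vs + i) \<psi>)"
  have ***: "sat K (map f (vs @ ws)) ?\<chi> \<longleftrightarrow> sat K (map f vs) \<phi> \<and> sat K (map f ws) \<psi>" for K f
    using *[of K f] **[of K "map f vs" f] by simp
  have "wf_fm L (length (vs @ ws)) ?\<chi>"
    using wf_ren_fm[OF 1(1), of "\<lambda>i. i" "length (vs @ ws)"]
      wf_ren_fm[OF 2(1), of "\<lambda>i. length vs + i" "length (vs @ ws)"] by simp
  moreover have "slots_over C (set (vs @ ws))"
    using 1(2) 2(2) by (auto simp: slots_over_def)
  ultimately show ?thesis
    unfolding dpr_def 1(3,4) 2(3,4)
    by (intro exI[of _ ?\<chi>] exI[of _ "vs @ ws"]) (simp only: *** simp_thms)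
qed

lemma dpr_disj [dpi]:
  assumes "dpr L M N h C P P'" and "dpr L M N h C Q Q'"
  shows "dpr L M N h C (\<lambda>e. P e \<or> Q e) (\<lambda>e. P' e \<or> Q' e)"
  using dpr_not[OF dpr_conj[OF dpr_not[OF assms(1)] dpr_not[OF assms(2)]]] by simp

lemma dpr_imp [dpi]:
  assumes "dpr L M N h C P P'" and "dpr L M N h C Q Q'"
  shows "dpr L M N h C (\<lambda>e. P e \<longrightarrow> Q e) (\<lambda>e. P' e \<longrightarrow> Q' e)"
  using dpr_not[OF dpr_conj[OF assms(1) dpr_not[OF assms(2)]]] by simp

lemma dpr_iff [dpi]:
  assumes "dpr L M N h C P P'" and "dpr L M N h C Q Q'"
  shows "dpr L M N h C (\<lambda>e. P e = Q e) (\<lambda>e. P' e = Q' e)"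
  using dpr_conj[OF dpr_imp[OF assms] dpr_imp[OF assms(2,1)]] by (simp add: iff_conv_conj_imp)

lemma dpr_less [dpi]:
  assumes "tmr h C \<sigma> \<sigma>'" and "tmr h C \<tau> \<tau>'"
  shows "dpr L M N h C (\<lambda>e. \<sigma> e < \<tau> e) (\<lambda>e. \<sigma>' e < \<tau>' e)"
proof -
  from assms obtain v w where "slots_over C {v}" "\<sigma> = (\<lambda>e. slot id e v)" "\<sigma>' = (\<lambda>e. slot h e v)"
    "slots_over C {w}" "\<tau> = (\<lambda>e. slot id e w)" "\<tau>' = (\<lambda>e. slot h e w)"
    unfolding tmr_def by blast
  then show ?thesis
    unfolding dpr_def
    by (intro exI[of _ "Less (Var 0) (Var 1)"] exI[of _ "[v, w]"]) (auto simp: slots_over_def)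
qed

lemma dpr_eq [dpi]:
  assumes "tmr h C \<sigma> \<sigma>'" and "tmr h C \<tau> \<tau>'"
  shows "dpr L M N h C (\<lambda>e. \<sigma> e = \<tau> e) (\<lambda>e. \<sigma>' e = \<tau>' e)"
proof -
  from assms obtain v w where "slots_over C {v}" "\<sigma> = (\<lambda>e. slot id e v)" "\<sigma>' = (\<lambda>e. slot h e v)"
    "slots_over C {w}" "\<tau> = (\<lambda>e. slot id e w)" "\<tau>' = (\<lambda>e. slot h e w)"
    unfolding tmr_def by blast
  then show ?thesis
    unfolding dpr_def
    by (intro exI[of _ "Eq (Var 0) (Var 1)"] exI[of _ "[v, w]"]) (auto simp: slots_over_def)
qed

lemma dpr_le [dpi]:
  assumes "tmr h C \<sigma> \<sigma>'" and "tmr h C \<tau> \<tau>'"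
  shows "dpr L M N h C (\<lambda>e. \<sigma> e \<le> \<tau> e) (\<lambda>e. \<sigma>' e \<le> \<tau>' e)"
  using dpr_not[OF dpr_less[OF assms(2,1)]] by (simp add: not_less)

lemma dpr_const [dpi]: "dpr L M N h C (\<lambda>e. B) (\<lambda>e. B)"
proof -
  have *: "dpr L M N h C (\<lambda>e. e 0 = e 0) (\<lambda>e. e 0 = e 0)"
    by (intro dpi)
  then have "dpr L M N h C (\<lambda>e. \<not> e 0 = e 0) (\<lambda>e. \<not> e 0 = e 0)"
    by (rule dpr_not)
  with * show ?thesis
    by (cases B) simp_all
qed

lemma dpr_subst:
  assumes "dpr L M N h C P P'" and "\<forall>k. slots_over C {v k}"
  shows "dpr L M N h C (\<lambda>e. P (\<lambda>i. slot id e (v i))) (\<lambda>e. P' (\<lambda>i. slot h e (v i)))"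
proof -
  from assms(1) obtain \<phi> vs where
    1: "wf_fm L (length vs) \<phi>" "slots_over C (set vs)"
      "P = (\<lambda>e. sat M (map (slot id e) vs) \<phi>)" "P' = (\<lambda>e. sat N (map (slot h e) vs) \<phi>)"
    unfolding dpr_def by blast
  let ?ws = "map (\<lambda>u. case u of Inl k \<Rightarrow> v k | Inr c \<Rightarrow> Inr c) vs"
  have *: "map (slot g e) ?ws = map (slot g (\<lambda>i. slot g e (v i))) vs" for g e
    by (auto split: sum.splits)
  have "slots_over C (set ?ws)"
    using 1(2) assms(2) by (auto simp: slots_over_def split: sum.splits)
  then show ?thesis
    unfolding dpr_def using 1 by (intro exI[of _ \<phi>] exI[of _ ?ws]) (simp only: *, simp)
qed

lemma dpr_ren:
  assumes "dpr L M N h C P P'"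
  shows "dpr L M N h C (\<lambda>e. P (\<lambda>i. e (\<rho> i))) (\<lambda>e. P' (\<lambda>i. e (\<rho> i)))"
  using dpr_subst[OF assms, of "\<lambda>i. Inl (\<rho> i)"] by (simp add: slots_over_def)

lemma dpr_mono:
  assumes "dpr L M N h C P P'" and "C \<subseteq> C'"
  shows "dpr L M N h C' P P'"
  using assms unfolding dpr_def slots_over_def by blast

text \<open>The bound variable may fill several slots. All of these are redirected to the one new
  variable of the formula, and the remaining slots move up by one.\<close>

lemma dpr_ex [dpi]:
  assumes "dpr L M N h C (\<lambda>e. R (e 0) (\<lambda>i. e (Suc i))) (\<lambda>e. R' (e 0) (\<lambda>i. e (Suc i)))"
  shows "dpr L M N h C (\<lambda>e. \<exists>x. R x e) (\<lambda>e. \<exists>x. R' x e)"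
proof -
  from assms obtain \<phi> vs where
    1: "wf_fm L (length vs) \<phi>" "slots_over C (set vs)"
      "(\<lambda>e. R (e 0) (\<lambda>i. e (Suc i))) = (\<lambda>e. sat M (map (slot id e) vs) \<phi>)"
      "(\<lambda>e. R' (e 0) (\<lambda>i. e (Suc i))) = (\<lambda>e. sat N (map (slot h e) vs) \<phi>)"
    unfolding dpr_def by blast
  \<comment> \<open>The slot \<open>Inl 0\<close> of the bound variable becomes a junk slot
    \<open>Inl 0\<close>, which is harmless because \<open>?\<rho>\<close> no longer reads
    it.\<close>
  let ?s = "\<lambda>v. case v of Inl k \<Rightarrow> Inl (k - 1) | Inr c \<Rightarrow> Inr c"
  let ?\<rho> = "\<lambda>i. if vs ! i = Inl 0 then 0 else Suc i"
  have *: "sat K (x # map (slot g e) (map ?s vs)) (ren_fm ?\<rho> \<phi>)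
      = sat K (map (slot g (case_nat x e)) vs) \<phi>" for K g x e
    using 1(1) by (intro sat_ren) (auto simp: slot_def split: sum.splits nat.splits)
  have R: "R x e = sat M (map (slot id (case_nat x e)) vs) \<phi>" for x e
    using fun_cong[OF 1(3), of "case_nat x e"] by simp
  have R': "R' x e = sat N (map (slot h (case_nat x e)) vs) \<phi>" for x e
    using fun_cong[OF 1(4), of "case_nat x e"] by simp
  have "wf_fm L (length (map ?s vs)) (Exi (ren_fm ?\<rho> \<phi>))"
    using wf_ren_fm[OF 1(1), of ?\<rho> "Suc (length vs)"] by simp
  moreover have "slots_over C (set (map ?s vs))"
    using 1(2) by (auto simp: slots_over_def split: sum.splits)
  ultimately show ?thesis
    unfolding dpr_def R R' by (intro exI[of _ "Exi (ren_fm ?\<rho> \<phi>)"] exI[of _ "map ?s vs"])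
      (simp only: * sat.simps simp_thms)
qed

lemma dpr_all [dpi]:
  assumes "dpr L M N h C (\<lambda>e. R (e 0) (\<lambda>i. e (Suc i))) (\<lambda>e. R' (e 0) (\<lambda>i. e (Suc i)))"
  shows "dpr L M N h C (\<lambda>e. \<forall>x. R x e) (\<lambda>e. \<forall>x. R' x e)"
  using dpr_not[OF dpr_ex[OF dpr_not[OF assms]]] by simp

lemma dpr_exl [dpi]:
  assumes "dpr L M N h C (\<lambda>e. R (map e [0..<m]) (\<lambda>i. e (m + i))) (\<lambda>e. R' (map e [0..<m]) (\<lambda>i. e (m + i)))"
  shows "dpr L M N h C (\<lambda>e. \<exists>x. length x = m \<and> R x e) (\<lambda>e. \<exists>x. length x = m \<and> R' x e)"
  using assms
proof (induction m arbitrary: R R')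
  case 0
  then show ?case
    by simp
next
  case (Suc m)
  \<comment> \<open>The head of the tuple is quantified outside its tail, hence it is variable
    \<open>m\<close>, behind the block of the tail; \<open>?\<rho>\<close> restores the order of the
    tuple.\<close>
  let ?\<rho> = "\<lambda>i. if i = 0 then m else if i \<le> m then i - 1 else i"
  have 1: "map (\<lambda>i. e (?\<rho> i)) [0..<Suc m] = e m # map e [0..<m]" for e :: "nat \<Rightarrow> 'z"
    by (simp only: upt_rec[of 0] map_Suc_upt[symmetric]) (auto simp: comp_def)
  have 2: "(\<lambda>i. e (?\<rho> (Suc m + i))) = (\<lambda>i. e (m + Suc i))" for e :: "nat \<Rightarrow> 'z"
    by auto
  have "dpr L M N h C (\<lambda>e. R (e m # map e [0..<m]) (\<lambda>i. e (m + Suc i)))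
      (\<lambda>e. R' (e m # map e [0..<m]) (\<lambda>i. e (m + Suc i)))"
    using dpr_ren[OF Suc.prems, of ?\<rho>] unfolding 1 2 .
  then have "dpr L M N h C (\<lambda>e. \<exists>a. \<exists>y. length y = m \<and> R (a # y) e)
      (\<lambda>e. \<exists>a. \<exists>y. length y = m \<and> R' (a # y) e)"
    using Suc.IH[of "\<lambda>y e. R (e 0 # y) (\<lambda>i. e (Suc i))" "\<lambda>y e. R' (e 0 # y) (\<lambda>i. e (Suc i))"]
    by (intro dpr_ex) simp
  moreover have ex: "(\<exists>x. length x = Suc m \<and> Q x) \<longleftrightarrow> (\<exists>a y. length y = m \<and> Q (a # y))"
    for Q :: "'z list \<Rightarrow> bool"
    by (auto simp: length_Suc_conv)
  ultimately show ?case
    by (simp only: ex)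
qed

lemma dpr_alll [dpi]:
  assumes "dpr L M N h C (\<lambda>e. R (map e [0..<m]) (\<lambda>i. e (m + i))) (\<lambda>e. R' (map e [0..<m]) (\<lambda>i. e (m + i)))"
  shows "dpr L M N h C (\<lambda>e. \<forall>x. length x = m \<longrightarrow> R x e) (\<lambda>e. \<forall>x. length x = m \<longrightarrow> R' x e)"
proof -
  have "(\<forall>x. length x = m \<longrightarrow> Q x) \<longleftrightarrow> \<not> (\<exists>x. length x = m \<and> \<not> Q x)" for Q :: "'z list \<Rightarrow> bool"
    by blast
  then show ?thesis
    using dpr_not[OF dpr_exl[where R = "\<lambda>x e. \<not> R x e" and R' = "\<lambda>x e. \<not> R' x e", OF dpr_not[OF assms]]]
    by simp
qed

lemma dpr_ball_less [dpi]:
  "(\<And>i. i < m \<Longrightarrow> dpr L M N h C (P i) (P' i)) \<Longrightarrow>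
   dpr L M N h C (\<lambda>e. \<forall>i<m::nat. P i e) (\<lambda>e. \<forall>i<m. P' i e)"
proof (induction m)
  case 0
  then show ?case
    using dpr_const[of L M N h C True] by simp
next
  case (Suc m)
  have "dpr L M N h C (\<lambda>e. (\<forall>i<m. P i e) \<and> P m e) (\<lambda>e. (\<forall>i<m. P' i e) \<and> P' m e)"
    using Suc by (intro dpr_conj) auto
  then show ?case
    by (simp add: All_less_Suc conj_commute)
qed

lemma dpr_def_set:
  assumes "wf_fm L (n + length c) \<phi>" and "set c \<subseteq> C" and "tupr h C n \<tau> \<tau>'"
  shows "dpr L M N h C (\<lambda>e. \<tau> e \<in> def_set M n \<phi> c) (\<lambda>e. \<tau>' e \<in> def_set N n \<phi> (map h c))"
proof -
  from assms(3) obtain vs where vs: "length vs = n" "slots_over C (set vs)"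
    "\<tau> = (\<lambda>e. map (slot id e) vs)" "\<tau>' = (\<lambda>e. map (slot h e) vs)"
    unfolding tupr_def by blast
  with assms(1,2) show ?thesis
    unfolding dpr_def def_set_def
    by (intro exI[of _ \<phi>] exI[of _ "vs @ map Inr c"]) (auto simp: slots_over_def comp_def)
qed

text \<open>The slots may mention variables beyond the block of length \<open>n\<close>, although
  the predicate does not depend on them. They need some value: a coordinate of the point if
  \<open>C\<close> is empty, and otherwise an element of \<open>C\<close>. Hence the side
  condition.\<close>

lemma dpr_definable:
  assumes "dpr L M N h C (\<lambda>e. S (map e [0..<n])) (\<lambda>e. S' (map e [0..<n]))" and "n > 0 \<or> C \<noteq> {}"
  shows "\<exists>\<phi> c. wf_fm L (n + length c) \<phi> \<and> set c \<subseteq> C \<and>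
    {x. length x = n \<and> S x} = def_set M n \<phi> c \<and> {x. length x = n \<and> S' x} = def_set N n \<phi> (map h c)"
proof -
  from assms(1) obtain \<phi> vs where
    1: "wf_fm L (length vs) \<phi>" "slots_over C (set vs)"
      "(\<lambda>e. S (map e [0..<n])) = (\<lambda>e. sat M (map (slot id e) vs) \<phi>)"
      "(\<lambda>e. S' (map e [0..<n])) = (\<lambda>e. sat N (map (slot h e) vs) \<phi>)"
    unfolding dpr_def by blast
  have ext: "map (\<lambda>i. if i < n then x ! i else d) [0..<n] = x" if "length x = n" for x :: "'z list" and d
    using that by (auto intro: nth_equalityI)
  have S: "S x = sat M (map (slot id (\<lambda>i. if i < n then x ! i else d)) vs) \<phi>" if "length x = n" for x d
    using fun_cong[OF 1(3), of "\<lambda>i. if i < n then x ! i else d"] ext[OF that] by simp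
  have S': "S' x = sat N (map (slot h (\<lambda>i. if i < n then x ! i else d)) vs) \<phi>" if "length x = n" for x d
    using fun_cong[OF 1(4), of "\<lambda>i. if i < n then x ! i else d"] ext[OF that] by simp
  show ?thesis
  proof (cases "C = {}")
    case True
    let ?\<rho> = "\<lambda>i. case vs ! i of Inl j \<Rightarrow> if j < n then j else 0 | Inr _ \<Rightarrow> 0"
    have nr: "vs ! i \<noteq> Inr c" if "i < length vs" for i c
      using that 1(2) True nth_mem[OF that] unfolding slots_over_def by (metis empty_iff)
    have *: "sat K (x @ []) (ren_fm ?\<rho> \<phi>) = sat K (map (slot g (\<lambda>i. if i < n then x ! i else x ! 0)) vs) \<phi>"
      if "length x = n" for K g x
      using 1(1) nr by (intro sat_ren) (auto simp: slot_def split: sum.splits)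
    have "wf_fm L n (ren_fm ?\<rho> \<phi>)"
      using 1(1) assms(2) True by (intro wf_ren_fm) (auto split: sum.splits)
    moreover have "S x = sat M (x @ []) (ren_fm ?\<rho> \<phi>)" if "length x = n" for x
      unfolding *[OF that, of M id] by (rule S[OF that])
    moreover have "S' x = sat N (x @ []) (ren_fm ?\<rho> \<phi>)" if "length x = n" for x
      unfolding *[OF that, of N h] by (rule S'[OF that])
    ultimately show ?thesis
      by (intro exI[of _ "ren_fm ?\<rho> \<phi>"] exI[of _ "[]"]) (auto simp: def_set_def)
  next
    case False
    then obtain c0 where c0: "c0 \<in> C"
      by blast
    let ?c = "map (\<lambda>v. case v of Inl j \<Rightarrow> c0 | Inr c \<Rightarrow> c) vs"
    \<comment> \<open>Slot \<open>i\<close> has its own parameter at position \<open>n + i\<close>;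
      for a variable out of range this parameter is the dummy \<open>c0\<close>.\<close>
    let ?\<rho> = "\<lambda>i. case vs ! i of Inl j \<Rightarrow> if j < n then j else n + i | Inr _ \<Rightarrow> n + i"
    have *: "sat K (x @ map g ?c) (ren_fm ?\<rho> \<phi>)
        = sat K (map (slot g (\<lambda>i. if i < n then x ! i else g c0)) vs) \<phi>"
      if "length x = n" for K g x
      using 1(1) that by (intro sat_ren) (auto simp: slot_def nth_append split: sum.splits)
    have "wf_fm L (n + length ?c) (ren_fm ?\<rho> \<phi>)"
      using 1(1) by (intro wf_ren_fm) (auto split: sum.splits)
    moreover have "set ?c \<subseteq> C"
      using 1(2) c0 by (auto simp: slots_over_def split: sum.splits)
    moreover have "S x = sat M (x @ ?c) (ren_fm ?\<rho> \<phi>)" if "length x = n" for x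
      using *[OF that, of M id] S[OF that, of "id c0"] by simp
    moreover have "S' x = sat N (x @ map h ?c) (ren_fm ?\<rho> \<phi>)" if "length x = n" for x
      unfolding *[OF that, of N h] by (rule S'[OF that])
    ultimately show ?thesis
      by (intro exI[of _ "ren_fm ?\<rho> \<phi>"] exI[of _ ?c]) (simp add: def_set_def del: map_map cong: conj_cong)
  qed
qed

lemma elementary_dpr:
  assumes "elementary_embedding L M N h" and "dpr L M N h C P P'"
  shows "P e = P' (\<lambda>i. h (e i))"
proof -
  from assms(2) obtain \<phi> vs where
    1: "wf_fm L (length vs) \<phi>"
      "P = (\<lambda>e. sat M (map (slot id e) vs) \<phi>)" "P' = (\<lambda>e. sat N (map (slot h e) vs) \<phi>)"
    unfolding dpr_def by blast
  have "map h (map (slot id e) vs) = map (slot h (\<lambda>i. h (e i))) vs"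
    by (auto simp: slot_def split: sum.splits)
  then show ?thesis
    using assms(1) 1 unfolding elementary_embedding_def
    by (metis length_map)
qed

text \<open>The form in which elementarity is mostly used: \<open>dpi\<close> parses a closed
  statement about \<open>M\<close> together with its twin about \<open>N\<close>.\<close>

lemma elementary_sentence:
  fixes N :: "('f, 'r, 'b::linorder) struct"
  assumes "elementary_embedding L M N h" and "dpr L M N h C (\<lambda>_. B) (\<lambda>_. B')"
  shows "B = B'"
  using elementary_dpr[OF assms] .

text \<open>Definable relations between scalars (\<open>s\<close>) and tuples (\<open>l\<close>). The quantification over terms closes them
  under substitution, which makes them usable as introduction rules for \<open>dpr\<close>.\<close>

definition rs where
  "rs L M N h C F F' \<longleftrightarrow> (\<forall>\<sigma> \<sigma>'. tmr h C \<sigma> \<sigma>' \<longrightarrow> dpr L M N h C (\<lambda>e. F (\<sigma> e)) (\<lambda>e. F' (\<sigma>' e)))"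

definition rss where
  "rss L M N h C F F' \<longleftrightarrow> (\<forall>\<sigma> \<sigma>' \<tau> \<tau>'. tmr h C \<sigma> \<sigma>' \<longrightarrow> tmr h C \<tau> \<tau>' \<longrightarrow>
     dpr L M N h C (\<lambda>e. F (\<sigma> e) (\<tau> e)) (\<lambda>e. F' (\<sigma>' e) (\<tau>' e)))"

definition rl where
  "rl L M N h C q F F' \<longleftrightarrow> (\<forall>\<tau> \<tau>'. tupr h C q \<tau> \<tau>' \<longrightarrow> dpr L M N h C (\<lambda>e. F (\<tau> e)) (\<lambda>e. F' (\<tau>' e)))"

definition rll where
  "rll L M N h C q l F F' \<longleftrightarrow> (\<forall>\<tau> \<tau>' \<upsilon> \<upsilon>'. tupr h C q \<tau> \<tau>' \<longrightarrow> tupr h C l \<upsilon> \<upsilon>' \<longrightarrow>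
     dpr L M N h C (\<lambda>e. F (\<tau> e) (\<upsilon> e)) (\<lambda>e. F' (\<tau>' e) (\<upsilon>' e)))"

definition rsl where
  "rsl L M N h C q F F' \<longleftrightarrow> (\<forall>\<sigma> \<sigma>' \<tau> \<tau>'. tmr h C \<sigma> \<sigma>' \<longrightarrow> tupr h C q \<tau> \<tau>' \<longrightarrow>
     dpr L M N h C (\<lambda>e. F (\<sigma> e) (\<tau> e)) (\<lambda>e. F' (\<sigma>' e) (\<tau>' e)))"

definition rsll where
  "rsll L M N h C q l F F' \<longleftrightarrow> (\<forall>\<sigma> \<sigma>' \<tau> \<tau>' \<upsilon> \<upsilon>'. tmr h C \<sigma> \<sigma>' \<longrightarrow> tupr h C q \<tau> \<tau>' \<longrightarrow> tupr h C l \<upsilon> \<upsilon>' \<longrightarrow>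
     dpr L M N h C (\<lambda>e. F (\<sigma> e) (\<tau> e) (\<upsilon> e)) (\<lambda>e. F' (\<sigma>' e) (\<tau>' e) (\<upsilon>' e)))"

lemma rsD: "rs L M N h C F F' \<Longrightarrow> tmr h C \<sigma> \<sigma>' \<Longrightarrow> dpr L M N h C (\<lambda>e. F (\<sigma> e)) (\<lambda>e. F' (\<sigma>' e))"
  by (simp add: rs_def)

lemma rssD: "rss L M N h C F F' \<Longrightarrow> tmr h C \<sigma> \<sigma>' \<Longrightarrow> tmr h C \<tau> \<tau>' \<Longrightarrow>
     dpr L M N h C (\<lambda>e. F (\<sigma> e) (\<tau> e)) (\<lambda>e. F' (\<sigma>' e) (\<tau>' e))"
  by (simp add: rss_def)

lemma rlD: "rl L M N h C q F F' \<Longrightarrow> tupr h C q \<tau> \<tau>' \<Longrightarrow> dpr L M N h C (\<lambda>e. F (\<tau> e)) (\<lambda>e. F' (\<tau>' e))"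
  by (simp add: rl_def)

lemma rllD: "rll L M N h C q l F F' \<Longrightarrow> tupr h C q \<tau> \<tau>' \<Longrightarrow> tupr h C l \<upsilon> \<upsilon>' \<Longrightarrow>
     dpr L M N h C (\<lambda>e. F (\<tau> e) (\<upsilon> e)) (\<lambda>e. F' (\<tau>' e) (\<upsilon>' e))"
  by (simp add: rll_def)

lemma rslD: "rsl L M N h C q F F' \<Longrightarrow> tmr h C \<sigma> \<sigma>' \<Longrightarrow> tupr h C q \<tau> \<tau>' \<Longrightarrow>
     dpr L M N h C (\<lambda>e. F (\<sigma> e) (\<tau> e)) (\<lambda>e. F' (\<sigma>' e) (\<tau>' e))"
  by (simp add: rsl_def)

lemma rsllD: "rsll L M N h C q l F F' \<Longrightarrow> tmr h C \<sigma> \<sigma>' \<Longrightarrow> tupr h C q \<tau> \<tau>' \<Longrightarrow> tupr h C l \<upsilon> \<upsilon>' \<Longrightarrow>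
     dpr L M N h C (\<lambda>e. F (\<sigma> e) (\<tau> e) (\<upsilon> e)) (\<lambda>e. F' (\<sigma>' e) (\<tau>' e) (\<upsilon>' e))"
  by (simp add: rsll_def)

text \<open>The default \<open>e 0\<close> beyond the list makes the substitution of finitely many
  variables a total one.\<close>

lemma dpr_subst_list:
  assumes "dpr L M N h C P P'" and "slots_over C (set us)"
  shows "dpr L M N h C (\<lambda>e. P (\<lambda>k. if k < length us then slot id e (us ! k) else e 0))
     (\<lambda>e. P' (\<lambda>k. if k < length us then slot h e (us ! k) else e 0))"
proof -
  have *: "\<forall>k. slots_over C {if k < length us then us ! k else Inl 0}"
    using assms(2) unfolding slots_over_def by (metis Inl_Inr_False empty_iff insert_iff nth_mem)
  have **: "slot g e (if k < length us then us ! k else Inl 0) = (if k < length us then slot g e (us ! k) else e 0)"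
    for g e k
    by simp
  show ?thesis
    using dpr_subst[OF assms(1) *] unfolding ** .
qed

lemma rsI:
  assumes "dpr L M N h C (\<lambda>e. F (e 0)) (\<lambda>e. F' (e 0))"
  shows "rs L M N h C F F'"
  unfolding rs_def tmr_def
proof (intro allI impI, elim exE conjE)
  fix \<sigma> \<sigma>' v
  assume "slots_over C {v}" "\<sigma> = (\<lambda>e. slot id e v)" "\<sigma>' = (\<lambda>e. slot h e v)"
  then show "dpr L M N h C (\<lambda>e. F (\<sigma> e)) (\<lambda>e. F' (\<sigma>' e))"
    using dpr_subst_list[OF assms, of "[v]"] by simp
qed

lemma rssI:
  assumes "dpr L M N h C (\<lambda>e. F (e 0) (e (Suc 0))) (\<lambda>e. F' (e 0) (e (Suc 0)))"
  shows "rss L M N h C F F'"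
  unfolding rss_def tmr_def
proof (intro allI impI, elim exE conjE)
  fix \<sigma> \<sigma>' v \<tau> \<tau>' w
  assume "slots_over C {v}" "\<sigma> = (\<lambda>e. slot id e v)" "\<sigma>' = (\<lambda>e. slot h e v)"
    "slots_over C {w}" "\<tau> = (\<lambda>e. slot id e w)" "\<tau>' = (\<lambda>e. slot h e w)"
  then show "dpr L M N h C (\<lambda>e. F (\<sigma> e) (\<tau> e)) (\<lambda>e. F' (\<sigma>' e) (\<tau>' e))"
    using dpr_subst_list[OF assms, of "[v, w]"] by (simp add: slots_over_def)
qed

lemma rlI:
  assumes "dpr L M N h C (\<lambda>e. F (map e [0..<q])) (\<lambda>e. F' (map e [0..<q]))"
  shows "rl L M N h C q F F'"
  unfolding rl_def tupr_def
proof (intro allI impI, elim exE conjE)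
  fix \<tau> \<tau>' vs
  assume *: "length vs = q" "slots_over C (set vs)" "\<tau> = (\<lambda>e. map (slot id e) vs)" "\<tau>' = (\<lambda>e. map (slot h e) vs)"
  have 1: "map (\<lambda>k. if k < q then slot g e (vs ! k) else e 0) [0..<q] = map (slot g e) vs" for g e
    using *(1) by (auto intro: nth_equalityI)
  show "dpr L M N h C (\<lambda>e. F (\<tau> e)) (\<lambda>e. F' (\<tau>' e))"
    using dpr_subst_list[OF assms *(2)] unfolding *(1,3,4) 1 .
qed

lemma rslI:
  assumes "dpr L M N h C (\<lambda>e. F (e 0) (map (\<lambda>i. e (Suc i)) [0..<q])) (\<lambda>e. F' (e 0) (map (\<lambda>i. e (Suc i)) [0..<q]))"
  shows "rsl L M N h C q F F'"
  unfolding rsl_def tmr_def tupr_def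
proof (intro allI impI, elim exE conjE)
  fix \<sigma> \<sigma>' v \<tau> \<tau>' vs
  assume *: "length vs = q" "slots_over C (set vs)" "\<tau> = (\<lambda>e. map (slot id e) vs)" "\<tau>' = (\<lambda>e. map (slot h e) vs)"
    "slots_over C {v}" "\<sigma> = (\<lambda>e. slot id e v)" "\<sigma>' = (\<lambda>e. slot h e v)"
  have 1: "map (\<lambda>k. if k < q then slot g e (vs ! k) else e 0) [0..<q] = map (slot g e) vs" for g e
    using *(1) by (auto intro: nth_equalityI)
  have "slots_over C (set (v # vs))"
    using * by (auto simp: slots_over_def)
  from dpr_subst_list[OF assms this] show "dpr L M N h C (\<lambda>e. F (\<sigma> e) (\<tau> e)) (\<lambda>e. F' (\<sigma>' e) (\<tau>' e))"
    unfolding list.size add_Suc_right add_0_right Suc_less_eq nth_Cons_Suc *(1) 1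
    using * by simp
qed

lemma rllI:
  assumes "dpr L M N h C (\<lambda>e. F (map e [0..<q]) (map (\<lambda>i. e (q + i)) [0..<l]))
     (\<lambda>e. F' (map e [0..<q]) (map (\<lambda>i. e (q + i)) [0..<l]))"
  shows "rll L M N h C q l F F'"
  unfolding rll_def tupr_def
proof (intro allI impI, elim exE conjE)
  fix \<tau> \<tau>' vs \<upsilon> \<upsilon>' ws
  assume *: "length vs = q" "slots_over C (set vs)" "\<tau> = (\<lambda>e. map (slot id e) vs)" "\<tau>' = (\<lambda>e. map (slot h e) vs)"
    "length ws = l" "slots_over C (set ws)" "\<upsilon> = (\<lambda>e. map (slot id e) ws)" "\<upsilon>' = (\<lambda>e. map (slot h e) ws)"
  have 1: "map (\<lambda>k. if k < q + l then slot g e ((vs @ ws) ! k) else e 0) [0..<q] = map (slot g e) vs" for g e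
    using *(1) by (auto intro!: nth_equalityI simp: nth_append)
  have 2: "map (\<lambda>i. if q + i < q + l then slot g e ((vs @ ws) ! (q + i)) else e 0) [0..<l] = map (slot g e) ws" for g e
    using *(1,5) by (auto intro!: nth_equalityI simp: nth_append)
  have "slots_over C (set (vs @ ws))"
    using * by (auto simp: slots_over_def)
  from dpr_subst_list[OF assms this] show "dpr L M N h C (\<lambda>e. F (\<tau> e) (\<upsilon> e)) (\<lambda>e. F' (\<tau>' e) (\<upsilon>' e))"
    unfolding length_append *(1,5) 1 2 using * by simp
qed

lemma rsllI:
  assumes "dpr L M N h C (\<lambda>e. F (e 0) (map (\<lambda>i. e (Suc i)) [0..<q]) (map (\<lambda>i. e (Suc (q + i))) [0..<l]))
     (\<lambda>e. F' (e 0) (map (\<lambda>i. e (Suc i)) [0..<q]) (map (\<lambda>i. e (Suc (q + i))) [0..<l]))"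
  shows "rsll L M N h C q l F F'"
  unfolding rsll_def tmr_def tupr_def
proof (intro allI impI, elim exE conjE)
  fix \<sigma> \<sigma>' v \<tau> \<tau>' vs \<upsilon> \<upsilon>' ws
  assume *: "length vs = q" "slots_over C (set vs)" "\<tau> = (\<lambda>e. map (slot id e) vs)" "\<tau>' = (\<lambda>e. map (slot h e) vs)"
    "length ws = l" "slots_over C (set ws)" "\<upsilon> = (\<lambda>e. map (slot id e) ws)" "\<upsilon>' = (\<lambda>e. map (slot h e) ws)"
    "slots_over C {v}" "\<sigma> = (\<lambda>e. slot id e v)" "\<sigma>' = (\<lambda>e. slot h e v)"
  have 1: "map (\<lambda>k. if k < q + l then slot g e ((vs @ ws) ! k) else e 0) [0..<q] = map (slot g e) vs" for g e
    using *(1) by (auto intro!: nth_equalityI simp: nth_append)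
  have 2: "map (\<lambda>i. if q + i < q + l then slot g e ((vs @ ws) ! (q + i)) else e 0) [0..<l] = map (slot g e) ws" for g e
    using *(1,5) by (auto intro!: nth_equalityI simp: nth_append)
  have "slots_over C (set (v # vs @ ws))"
    using * by (auto simp: slots_over_def)
  from dpr_subst_list[OF assms this]
  show "dpr L M N h C (\<lambda>e. F (\<sigma> e) (\<tau> e) (\<upsilon> e)) (\<lambda>e. F' (\<sigma>' e) (\<tau>' e) (\<upsilon>' e))"
    unfolding length_append list.size add_Suc_right add_0_right Suc_less_eq nth_Cons_Suc *(1,5) 1 2
    using * by simp
qed

section \<open>Intervals, neighbourhoods, boundaries and cells on the line\<close>

definition contains_interval :: "('a::linorder \<Rightarrow> bool) \<Rightarrow> bool" where
  "contains_interval S \<longleftrightarrow> (\<exists>u v. u < v \<and> (\<forall>x. u < x \<and> x < v \<longrightarrow> S x))"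

text \<open>The neighbourhood contains \<open>b\<close> itself, so \<open>nearby b Q\<close>
  includes \<open>Q b\<close>.\<close>

definition nearby :: "'a::linorder \<Rightarrow> ('a \<Rightarrow> bool) \<Rightarrow> bool" where
  "nearby b Q \<longleftrightarrow> (\<exists>u v. u < b \<and> b < v \<and> (\<forall>x. u < x \<and> x < v \<longrightarrow> Q x))"

definition bd :: "('a::linorder \<Rightarrow> bool) \<Rightarrow> 'a \<Rightarrow> bool" where
  "bd S b \<longleftrightarrow> \<not> nearby b (\<lambda>x. S x = S b)"

text \<open>The two points have the same order type over \<open>P\<close>, that is, they lie in the
  same cell of the partition of the line by \<open>P\<close>.\<close>

definition cut_eq :: "'a::linorder set \<Rightarrow> 'a \<Rightarrow> 'a \<Rightarrow> bool" where
  "cut_eq P x y \<longleftrightarrow> (\<forall>p\<in>P. (x < p \<longleftrightarrow> y < p) \<and> (p < x \<longleftrightarrow> p < y))"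

text \<open>O-minimality without mentioning intervals: a union of cells. Only finitely many points
  have to be named, and these can be quantified over in a sentence.\<close>

definition tames :: "'a::linorder set \<Rightarrow> ('a \<Rightarrow> bool) \<Rightarrow> bool" where
  "tames P S \<longleftrightarrow> finite P \<and> (\<forall>x y. cut_eq P x y \<longrightarrow> S x = S y)"

lemma cut_eq_mid:
  assumes "cut_eq P x y" and "x \<le> p \<and> p \<le> y \<or> y \<le> p \<and> p \<le> x"
  shows "cut_eq P x p"
  unfolding cut_eq_def
proof
  fix q
  assume "q \<in> P"
  then have "(x < q) = (y < q) \<and> (q < x) = (q < y)"
    using assms(1) by (auto simp: cut_eq_def)
  then show "(x < q) = (p < q) \<and> (q < x) = (q < p)"
    using assms(2) by auto
qed

lemma cut_eq_sym: "cut_eq P x y \<Longrightarrow> cut_eq P y x"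
  by (simp add: cut_eq_def)

lemma nearby_mono: "nearby b Q \<Longrightarrow> (\<And>x. Q x \<Longrightarrow> Q' x) \<Longrightarrow> nearby b Q'"
  unfolding nearby_def by blast

lemma nearby_conj:
  assumes "nearby b Q" and "nearby b Q'"
  shows "nearby b (\<lambda>x. Q x \<and> Q' x)"
proof -
  from assms obtain u v u' v' where
    "u < b" "b < v" "\<forall>x. u < x \<and> x < v \<longrightarrow> Q x" "u' < b" "b < v'" "\<forall>x. u' < x \<and> x < v' \<longrightarrow> Q' x"
    unfolding nearby_def by blast
  then show ?thesis
    unfolding nearby_def by (intro exI[of _ "max u u'"] exI[of _ "min v v'"]) simp
qed

lemma dpr_contains_interval [dpi]:
  assumes "dpr L M N h C (\<lambda>e. R (e 0) (\<lambda>i. e (Suc i))) (\<lambda>e. R' (e 0) (\<lambda>i. e (Suc i)))"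
  shows "dpr L M N h C (\<lambda>e. contains_interval (\<lambda>x. R x e)) (\<lambda>e. contains_interval (\<lambda>x. R' x e))"
  unfolding contains_interval_def
  using dpr_ren[OF assms, of "case_nat 0 (\<lambda>i. Suc (Suc (Suc i)))"]
  by (intro dpi) simp

text \<open>The order of \<open>N\<close> is merely known to be linear as a type class, so density
  and the absence of endpoints are assumptions, to be transferred from \<open>M\<close>.\<close>

locale omin =
  fixes L :: "('f, 'r) lang" and M :: "('f, 'r, 'a::linorder) struct"
  assumes dense_order: "\<And>x y :: 'a. x < y \<Longrightarrow> \<exists>z. x < z \<and> z < y"
    and no_bot: "\<And>x :: 'a. \<exists>y. y < x"
    and no_top: "\<And>x :: 'a. \<exists>y. x < y"
    and tame: "\<And>S. dpr L M M id UNIV (\<lambda>e. S (e 0)) (\<lambda>e. S (e 0)) \<Longrightarrow> \<exists>P. tames P S"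
begin

abbreviation "dp C P \<equiv> dpr L M M id C P P"
abbreviation "ds S \<equiv> dp UNIV (\<lambda>e. S (e 0))"
abbreviation "dss S \<equiv> rss L M M id UNIV S S"
abbreviation "dsl q S \<equiv> rsl L M M id UNIV q S S"
abbreviation "dsll q l S \<equiv> rsll L M M id UNIV q l S S"
abbreviation "dl q S \<equiv> rl L M M id UNIV q S S"
abbreviation "dll q l S \<equiv> rll L M M id UNIV q l S S"

section \<open>Definable subsets of the line\<close>

lemma gap_above: "finite P \<Longrightarrow> \<exists>v>p. \<forall>q\<in>P. p < q \<longrightarrow> v \<le> (q::'a)"
proof -
  assume "finite P"
  then have f: "finite {q\<in>P. p < q}"
    by simp
  show ?thesis
  proof (cases "{q\<in>P. p < q} = {}")
    case True
    then show ?thesis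
      using no_top[of p] by fastforce
  next
    case False
    then have "Min {q\<in>P. p < q} \<in> {q\<in>P. p < q}"
      using f by (intro Min_in)
    then show ?thesis
      using f by (intro exI[of _ "Min {q\<in>P. p < q}"]) auto
  qed
qed

lemma gap_below: "finite P \<Longrightarrow> \<exists>v<p. \<forall>q\<in>P. q < p \<longrightarrow> q \<le> (v::'a)"
proof -
  assume "finite P"
  then have f: "finite {q\<in>P. q < p}"
    by simp
  show ?thesis
  proof (cases "{q\<in>P. q < p} = {}")
    case True
    then show ?thesis
      using no_bot[of p] by fastforce
  next
    case False
    then have "Max {q\<in>P. q < p} \<in> {q\<in>P. q < p}"
      using f by (intro Max_in)
    then show ?thesis
      using f by (intro exI[of _ "Max {q\<in>P. q < p}"]) auto
  qed
qed

lemma infinite_interval: "(u::'a) < v \<Longrightarrow> infinite {x. u < x \<and> x < v}"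
proof
  assume uv: "u < v" and f: "finite {x. u < x \<and> x < v}"
  then have "{x. u < x \<and> x < v} \<noteq> {}"
    using dense_order by blast
  then have "Max {x. u < x \<and> x < v} \<in> {x. u < x \<and> x < v}"
    using f by (rule Max_in[rotated])
  then obtain z where "Max {x. u < x \<and> x < v} < z" "u < z" "z < v"
    using dense_order by (metis (mono_tags, lifting) mem_Collect_eq order_less_trans)
  then show False
    using Max_ge[OF f, of z] by (simp add: not_less[symmetric])
qed

lemma contains_interval_infinite: "contains_interval S \<Longrightarrow> infinite {x::'a. S x}"
  unfolding contains_interval_def using infinite_interval by (metis (mono_tags, lifting) Collect_mono infinite_super)

lemma tames_nearby:
  assumes "finite P" and "x \<notin> P"
  shows "nearby (x::'a) (\<lambda>y. cut_eq P x y)"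
proof -
  obtain u where u: "u < x" "\<forall>q\<in>P. q < x \<longrightarrow> q \<le> u"
    using gap_below[OF assms(1)] by blast
  obtain v where v: "x < v" "\<forall>q\<in>P. x < q \<longrightarrow> v \<le> q"
    using gap_above[OF assms(1)] by blast
  have "cut_eq P x y" if "u < y" "y < v" for y
    unfolding cut_eq_def
  proof
    fix q
    assume "q \<in> P"
    then have "q < x \<and> q \<le> u \<or> x < q \<and> v \<le> q"
      using u v assms(2) by (metis linorder_neqE)
    then show "(x < q) = (y < q) \<and> (q < x) = (q < y)"
      using that u(1) v(1) by auto
  qed
  then show ?thesis
    unfolding nearby_def using u(1) v(1) by blast
qed

lemma nearby_contains_interval: "nearby (x::'a) Q \<Longrightarrow> contains_interval Q"
  unfolding contains_interval_def nearby_def using order_less_trans by blast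

lemma infinite_contains_interval:
  assumes "tames P S" and "infinite {x::'a. S x}"
  shows "contains_interval S"
proof -
  have "finite P"
    using assms(1) by (simp add: tames_def)
  then obtain x where "S x" "x \<notin> P"
    using assms(2) by (metis (mono_tags, lifting) finite_subset mem_Collect_eq subsetI)
  have "nearby x S"
    using tames_nearby[OF \<open>finite P\<close> \<open>x \<notin> P\<close>] by (rule nearby_mono) (use assms(1) \<open>S x\<close> in \<open>auto simp: tames_def\<close>)
  then show ?thesis
    by (rule nearby_contains_interval)
qed

text \<open>This is what makes "infinitely many" expressible by a formula.\<close>

lemma infinite_iff: "ds S \<Longrightarrow> infinite {x. S x} \<longleftrightarrow> contains_interval S"
  using tame infinite_contains_interval contains_interval_infinite by blast

lemma right_germ:
  assumes "tames P S"
  shows "\<exists>v>p. (\<forall>x::'a. p < x \<and> x < v \<longrightarrow> S x) \<or> (\<forall>x. p < x \<and> x < v \<longrightarrow> \<not> S x)"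
proof -
  obtain v where v: "p < v" "\<forall>q\<in>P. p < q \<longrightarrow> v \<le> q"
    using gap_above assms unfolding tames_def by blast
  have "cut_eq P x y" if "p < x" "x < v" "p < y" "y < v" for x y
    unfolding cut_eq_def
  proof
    fix q
    assume "q \<in> P"
    then have "q \<le> p \<or> v \<le> q"
      using v(2) by (metis not_less)
    then show "(x < q) = (y < q) \<and> (q < x) = (q < y)"
      using that by auto
  qed
  then show ?thesis
    using assms v(1) unfolding tames_def by blast
qed

lemma bot_germ:
  assumes "tames P S"
  shows "\<exists>v. (\<forall>x::'a. x < v \<longrightarrow> S x) \<or> (\<forall>x. x < v \<longrightarrow> \<not> S x)"
proof -
  have "\<exists>v. \<forall>q\<in>P. v \<le> q"
    using assms Min_le[of P] unfolding tames_def by blast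
  then obtain v where v: "\<forall>q\<in>P. v \<le> q" ..
  have "cut_eq P x y" if "x < v" "y < v" for x y
    unfolding cut_eq_def
  proof
    fix q
    assume "q \<in> P"
    then have "v \<le> q"
      using v by blast
    then show "(x < q) = (y < q) \<and> (q < x) = (q < y)"
      using that by auto
  qed
  then show ?thesis
    using assms unfolding tames_def by blast
qed

lemma bd_tames:
  assumes "tames P S" and "bd S (b::'a)"
  shows "b \<in> P"
proof (rule ccontr)
  assume "b \<notin> P"
  then have "nearby b (\<lambda>y. cut_eq P b y)"
    using assms(1) by (intro tames_nearby) (simp_all add: tames_def)
  then have "nearby b (\<lambda>y. S y = S b)"
    by (rule nearby_mono) (use assms(1) in \<open>auto simp: tames_def\<close>)
  with assms(2) show False
    by (simp add: bd_def)
qed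

lemma finite_bd: "tames P S \<Longrightarrow> finite {b::'a. bd S b}"
  using bd_tames by (metis (mono_tags, lifting) mem_Collect_eq rev_finite_subset subsetI tames_def)

text \<open>On each side of \<open>p\<close> the cell next to it contains points so close to
  \<open>p\<close> that \<open>S\<close> has the same value there as at \<open>p\<close>. Hence both
  neighbouring cells can be merged with \<open>p\<close>.\<close>

lemma tames_remove:
  assumes "tames P S" and "\<not> bd S (p::'a)"
  shows "tames (P - {p}) S"
proof -
  from assms(2) obtain u v where uv: "u < p" "p < v" "\<forall>x. u < x \<and> x < v \<longrightarrow> S x = S p"
    unfolding bd_def nearby_def by blast
  have S: "S x = S y" if "cut_eq P x y" for x y
    using assms(1) that by (simp add: tames_def)
  have *: "S w = S p" if w: "cut_eq (P - {p}) w p" for w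
  proof (cases w p rule: linorder_cases)
    case less
    then obtain z where z: "max u w < z" "z < p"
      using dense_order[of "max u w" p] uv(1) by auto
    have "cut_eq P w z"
      unfolding cut_eq_def
    proof
      fix q
      assume "q \<in> P"
      then have "q = p \<or> ((w < q) = (p < q) \<and> (q < w) = (q < p))"
        using w by (auto simp: cut_eq_def)
      then show "(w < q) = (z < q) \<and> (q < w) = (q < z)"
        using z less by auto
    qed
    then show ?thesis
      using S uv z by (metis max_less_iff_conj order_less_trans)
  next
    case greater
    then obtain z where z: "p < z" "z < min v w"
      using dense_order[of p "min v w"] uv(2) by auto
    have "cut_eq P w z"
      unfolding cut_eq_def
    proof
      fix q
      assume "q \<in> P"
      then have "q = p \<or> ((w < q) = (p < q) \<and> (q < w) = (q < p))"
        using w by (auto simp: cut_eq_def)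
      then show "(w < q) = (z < q) \<and> (q < w) = (q < z)"
        using z greater by auto
    qed
    then show ?thesis
      using S uv z by (metis min_less_iff_conj order_less_trans)
  qed simp
  have "S x = S y" if xy: "cut_eq (P - {p}) x y" for x y
  proof (cases "(x < p \<longleftrightarrow> y < p) \<and> (p < x \<longleftrightarrow> p < y)")
    case True
    then have "cut_eq P x y"
      using xy by (auto simp: cut_eq_def)
    then show ?thesis
      by (rule S)
  next
    case False
    then have "x \<le> p \<and> p \<le> y \<or> y \<le> p \<and> p \<le> x"
      by (metis linorder_le_less_linear order_less_imp_le)
    then have "cut_eq (P - {p}) x p" "cut_eq (P - {p}) y p"
      using cut_eq_mid[OF xy] cut_eq_mid[OF cut_eq_sym[OF xy]] by blast+
    then show ?thesis
      using * by simp
  qed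
  then show ?thesis
    using assms(1) by (simp add: tames_def)
qed

text \<open>A taming set of least size consists of boundary points only, since any other point could
  be removed.\<close>

lemma tames_by_bd:
  assumes "tames P S"
  shows "tames {b::'a. bd S b} S"
proof -
  define n where "n = (LEAST n. \<exists>P. tames P S \<and> card P = n)"
  have "\<exists>n P. tames P S \<and> card P = n"
    using assms by blast
  then have "\<exists>P. tames P S \<and> card P = n"
    unfolding n_def by (rule LeastI_ex)
  then obtain P where P: "tames P S" "card P = n"
    by blast
  have "bd S p" if "p \<in> P" for p
  proof (rule ccontr)
    assume "\<not> bd S p"
    then have "tames (P - {p}) S"
      using P(1) by (rule tames_remove[rotated])
    then have "n \<le> card (P - {p})"
      unfolding n_def by (intro Least_le) blast
    moreover have "card (P - {p}) < card P"
      using P(1) that by (intro card_Diff1_less) (simp_all add: tames_def)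
    ultimately show False
      using P(2) by simp
  qed
  then have "{b. bd S b} = P"
    using bd_tames[OF P(1)] by blast
  then show ?thesis
    using P(1) by simp
qed

lemma constant_between:
  assumes "tames P S" and "x \<le> y" and "\<And>b. bd S b \<Longrightarrow> \<not> (x \<le> b \<and> b \<le> (y::'a))"
  shows "S x = S y"
proof -
  have "cut_eq {b. bd S b} x y"
    unfolding cut_eq_def
  proof
    fix q
    assume "q \<in> {b. bd S b}"
    then have "q < x \<or> y < q"
      using assms(3) by (auto simp: not_le)
    then show "(x < q) = (y < q) \<and> (q < x) = (q < y)"
      using assms(2) by auto
  qed
  then show ?thesis
    using tames_by_bd[OF assms(1)] by (simp add: tames_def)
qed

text \<open>The supremum is the least point of \<open>P\<close> that is an upper bound: were there a
  smaller bound \<open>v\<close>, a point between \<open>v\<close> and that point would share a cell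
  with an element of \<open>S\<close>.\<close>

lemma sup_exists:
  assumes "tames P S" and "S x0" and "\<forall>x. S x \<longrightarrow> x \<le> (u::'a)"
  shows "\<exists>s. (\<forall>x. S x \<longrightarrow> x \<le> s) \<and> (\<forall>u<s. \<exists>x. S x \<and> u < x)"
proof -
  have fP: "finite P" and S: "\<And>x y. cut_eq P x y \<Longrightarrow> S x = S y"
    using assms(1) by (auto simp: tames_def)
  have max: "\<exists>x. S x \<and> (\<forall>p\<in>Q. p < x)" if "finite Q" "\<forall>p\<in>Q. \<exists>x. S x \<and> p < x" for Q
    using that
  proof (induction Q)
    case empty
    then show ?case
      using assms(2) by blast
  next
    case (insert q Q)
    then show ?case
      by (metis (no_types, lifting) insert_iff linorder_less_linear order_less_trans)
  qed
  let ?U = "{p\<in>P. \<forall>x. S x \<longrightarrow> x \<le> p}"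
  \<comment> \<open>If no point of \<open>P\<close> bounded \<open>S\<close>, some element of
    \<open>S\<close> would lie beyond all of \<open>P\<close>, and the whole ray above it would be
    in \<open>S\<close>.\<close>
  have "?U \<noteq> {}"
  proof
    assume U: "?U = {}"
    have "\<forall>p\<in>P. \<exists>x. S x \<and> p < x"
    proof
      fix p
      assume "p \<in> P"
      then have "p \<notin> ?U"
        using U by blast
      with \<open>p \<in> P\<close> show "\<exists>x. S x \<and> p < x"
        by (auto simp: not_le)
    qed
    then obtain x where x: "S x" "\<forall>p\<in>P. p < x"
      using max[OF fP] by blast
    obtain y where y: "u < y"
      using no_top by blast
    then have "x < y"
      using x assms(3) by (meson order_le_less_trans)
    then have "cut_eq P x y"
      using x(2) unfolding cut_eq_def by (meson less_asym order_less_trans)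
    then have "S y"
      using S x(1) by blast
    then show False
      using assms(3) y by (meson leD)
  qed
  moreover have fU: "finite ?U"
    using fP by simp
  ultimately have m: "Min ?U \<in> ?U"
    by (intro Min_in)
  have "\<exists>x. S x \<and> v < x" if v_less: "v < Min ?U" for v
  proof (rule ccontr)
    assume v: "\<not> (\<exists>x. S x \<and> v < x)"
    let ?Q = "{p\<in>P. p < Min ?U}"
    have "\<exists>x. S x \<and> p < x" if p: "p \<in> ?Q" for p
    proof (rule ccontr)
      assume "\<not> (\<exists>x. S x \<and> p < x)"
      then have "p \<in> ?U"
        using p by (auto simp: not_less)
      then show False
        using Min_le[OF fU, of p] p by simp
    qed
    then obtain x where x: "S x" "\<forall>p\<in>?Q. p < x"
      using max[of ?Q] fP by auto
    have "x \<le> v"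
      using v x(1) by (auto simp: not_less)
    obtain z where z: "v < z" "z < Min ?U"
      using dense_order[OF v_less] by blast
    have "cut_eq P x z"
      unfolding cut_eq_def
    proof
      fix q
      assume "q \<in> P"
      then have "q < x \<or> Min ?U \<le> q"
        using x(2) by (metis (mono_tags, lifting) mem_Collect_eq not_less)
      then show "(x < q) = (z < q) \<and> (q < x) = (q < z)"
        using z \<open>x \<le> v\<close> by auto
    qed
    then have "S z"
      using S x(1) by blast
    then show False
      using v z(1) by blast
  qed
  then show ?thesis
    using m by (intro exI[of _ "Min ?U"]) auto
qed

section \<open>Exchanging coordinates\<close>

text \<open>Each \<open>U x\<close> is an initial part of the common domain \<open>Q\<close>, which
  is upward closed without a least point. In the applications \<open>Q\<close> is a ray to the right
  of a point, or the whole line.\<close>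

lemma no_shrinking_rays:
  assumes U: "dss U" and Q: "\<And>z. Q z \<Longrightarrow> \<exists>z'<z. Q (z'::'a)" "\<And>z z'. Q z \<Longrightarrow> z < z' \<Longrightarrow> Q z'"
    and UQ: "\<And>x z. U x z \<Longrightarrow> Q z" and down: "\<And>x z z'. U x z \<Longrightarrow> Q z' \<Longrightarrow> z' < z \<Longrightarrow> U x z'"
    and fin: "\<And>z. finite {x. U x z}"
  shows "finite {x. \<exists>z. U x z}"
proof (rule ccontr)
  assume inf: "infinite {x. \<exists>z. U x z}"
  note U' = rssD[OF U]
  from inf obtain x0 z0 where "U x0 z0"
    using not_finite_existsD by blast
  then have z0: "Q z0"
    by (rule UQ)
  \<comment> \<open>Dropping the finitely many \<open>x\<close> with \<open>U x z0\<close> leaves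
    sets bounded by \<open>z0\<close>, which have suprema.\<close>
  define I where "I = {x. (\<exists>z. U x z) \<and> \<not> U x z0}"
  have "I = {x. \<exists>z. U x z} - {x. U x z0}"
    unfolding I_def by blast
  then have infI: "infinite I"
    using inf fin[of z0] by simp
  define is_sup where "is_sup x b \<longleftrightarrow> (\<forall>z. U x z \<longrightarrow> z \<le> b) \<and> (\<forall>u. u < b \<longrightarrow> (\<exists>z. U x z \<and> u < z))" for x b
  have "\<exists>b. is_sup x b" if x: "x \<in> I" for x
  proof -
    have "ds (U x)"
      by (intro dpi U') simp_all
    then obtain P where P: "tames P (U x)"
      using tame by blast
    obtain z where z: "U x z"
      using x by (auto simp: I_def)
    have "\<forall>z. U x z \<longrightarrow> z \<le> z0"
      using that down[of x _ z0] z0 by (auto simp: I_def not_less[symmetric])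
    then show ?thesis
      using sup_exists[OF P z] unfolding is_sup_def by blast
  qed
  then obtain b where b: "is_sup x (b x)" if "x \<in> I" for x
    by metis
  have Qb: "Q (b x)" if x: "x \<in> I" for x
  proof -
    obtain z where z: "U x z"
      using x by (auto simp: I_def)
    then have "z = b x \<or> z < b x"
      using b[OF x] unfolding is_sup_def by (auto simp: order_le_less)
    then show ?thesis
      using UQ[OF z] Q(2) by blast
  qed
  have below: "U x w" if xw: "x \<in> I" "Q w" "w < b x" for x w
  proof -
    obtain z where "U x z" "w < z"
      using b[OF xw(1)] xw(3) unfolding is_sup_def by blast
    then show ?thesis
      using down xw(2) by blast
  qed
  have sup_unique: "c = b x" if "x \<in> I" "is_sup x c" for x c
    using b[OF that(1)] that(2) unfolding is_sup_def by (metis leD linorder_neqE)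
  have V: "{c. \<exists>x. x \<in> I \<and> is_sup x c} = b ` I"
    using b sup_unique by blast
  \<comment> \<open>Either infinitely many of the sets have the same supremum and share a point
    below it, or the suprema fill an interval and infinitely many of the sets pass through a point
    of it.\<close>
  show False
  proof (cases "finite (b ` I)")
    case True
    then obtain x0 where x0: "x0 \<in> I" "infinite {x\<in>I. b x = b x0}"
      using infI pigeonhole_infinite[of I b] by auto
    obtain w where "w < b x0" "Q w"
      using Q(1)[OF Qb[OF x0(1)]] by blast
    then have "{x\<in>I. b x = b x0} \<subseteq> {x. U x w}"
      using below by auto
    then show False
      using x0(2) fin finite_subset by blast
  next
    case False
    have "ds (\<lambda>c. \<exists>x. x \<in> I \<and> is_sup x c)"
      unfolding I_def is_sup_def mem_Collect_eq by (intro dpi U') simp_all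
    then have "contains_interval (\<lambda>c. \<exists>x. x \<in> I \<and> is_sup x c)"
      using infinite_iff[of "\<lambda>c. \<exists>x. x \<in> I \<and> is_sup x c"] False unfolding V[symmetric] by blast
    then obtain u v where uv: "u < v" "{c. u < c \<and> c < v} \<subseteq> b ` I"
      unfolding contains_interval_def V[symmetric] by blast
    obtain w where w: "u < w" "w < v"
      using dense_order[OF uv(1)] by blast
    then have "Q w"
      using uv(2) Qb by blast
    have "{c. w < c \<and> c < v} \<subseteq> b ` {x. U x w}"
    proof
      fix c
      assume c: "c \<in> {c. w < c \<and> c < v}"
      then have "c \<in> b ` I"
        using uv(2) w(1) by auto
      then obtain x where "x \<in> I" "c = b x"
        by blast
      then show "c \<in> b ` {x. U x w}"
        using below[of x w] \<open>Q w\<close> c by auto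
    qed
    then show False
      using infinite_interval[OF w(2)] fin finite_subset by blast
  qed
qed

text \<open>Now the left end \<open>y\<close> of the set \<open>V y\<close> varies. The
  contradiction comes from an interval of left ends whose sets are not contained in any earlier
  one.\<close>

lemma no_overlapping_rays:
  assumes V: "dss V" and gt: "\<And>y z. V y z \<Longrightarrow> y < (z::'a)"
    and down: "\<And>y z z'. V y z \<Longrightarrow> y < z' \<Longrightarrow> z' < z \<Longrightarrow> V y z'"
    and fin: "\<And>z. finite {y. V y z}"
  shows "finite {y. \<exists>z. V y z}"
proof (rule ccontr)
  assume "infinite {y. \<exists>z. V y z}"
  note V' = rssD[OF V]
  have "ds (\<lambda>y. \<exists>z. V y z)"
    by (intro dpi V')
  then have "contains_interval (\<lambda>y. \<exists>z. V y z)"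
    using infinite_iff[of "\<lambda>y. \<exists>z. V y z"] \<open>infinite {y. \<exists>z. V y z}\<close> by blast
  then obtain j j' where j: "j < j'" and J: "\<And>y. j < y \<Longrightarrow> y < j' \<Longrightarrow> \<exists>z. V y z"
    unfolding contains_interval_def by blast
  \<comment> \<open>\<open>V y\<close> is contained in no \<open>V y'\<close> with an earlier
    \<open>y'\<close> of the interval.\<close>
  define B where "B y \<longleftrightarrow> j < y \<and> y < j' \<and> (\<forall>y'. j < y' \<and> y' < y \<longrightarrow> (\<exists>z. V y z \<and> \<not> V y' z))" for y
  \<comment> \<open>Only finitely many \<open>y'\<close> have \<open>V y'\<close> containing a given
    point of \<open>V y\<close>. The earliest one with \<open>V y\<close> inside \<open>V y'\<close>
    satisfies \<open>B\<close>; so \<open>B\<close> accumulates at \<open>j\<close> and is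
    infinite.\<close>
  have key: "\<exists>y'. B y' \<and> y' < y" if y: "j < y" "y < j'" "\<not> B y" for y
  proof -
    define C where "C = {y'. j < y' \<and> y' < y \<and> (\<forall>z. V y z \<longrightarrow> V y' z)}"
    obtain z where z: "V y z"
      using J y by blast
    have "C \<subseteq> {y'. V y' z}"
      using z by (auto simp: C_def)
    then have fC: "finite C"
      using fin finite_subset by blast
    have "C \<noteq> {}"
      using y by (auto simp: B_def C_def)
    then have m: "Min C \<in> C"
      using fC by (rule Min_in[rotated])
    have "\<exists>z. V (Min C) z \<and> \<not> V y' z" if "j < y'" "y' < Min C" for y'
    proof (rule ccontr)
      assume "\<not> ?thesis"
      then have "y' \<in> C"
        using m that by (auto simp: C_def)
      then show False
        using Min_le[OF fC, of y'] that(2) by simp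
    qed
    then have "B (Min C)"
      using m y by (auto simp: B_def C_def)
    then show ?thesis
      using m by (auto simp: C_def)
  qed
  have dsB: "ds B"
    unfolding B_def by (intro dpi V') simp_all
  show False
  proof (cases "finite {y. B y}")
    case True
    then obtain v where v: "j < v" "\<forall>q\<in>{y. B y}. j < q \<longrightarrow> v \<le> q"
      using gap_above by blast
    obtain y where y: "j < y" "y < min v j'"
      using dense_order[of j "min v j'"] v(1) j by auto
    have "\<not> B y"
      using y v(2) by auto
    then obtain y' where "B y'" "y' < y"
      using key y by auto
    then show False
      using v(2) y(2) by (auto simp: B_def)
  next
    case False
    then have "contains_interval B"
      using infinite_iff[OF dsB] by blast
    then obtain i i' where i: "i < i'" and BI: "\<And>y. i < y \<Longrightarrow> y < i' \<Longrightarrow> B y"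
      unfolding contains_interval_def by blast
    obtain y0 where y0: "i < y0" "y0 < i'"
      using dense_order[OF i] by blast
    then have "B y0"
      using BI by blast
    then obtain z where z: "V y0 z"
      using J unfolding B_def by blast
    obtain z1 where z1: "y0 < z1" "z1 < min z i'"
      using dense_order[of y0 "min z i'"] gt[OF z] y0(2) by auto
    then have Vz1: "V y0 z1"
      using down[OF z] by simp
    \<comment> \<open>As \<open>V y\<close> is not contained in \<open>V y0\<close>, it reaches
      beyond \<open>z1\<close>. Thus \<open>z1\<close> lies in \<open>V y\<close> for a whole
      interval of \<open>y\<close>.\<close>
    have "V y z1" if y: "y0 < y" "y < z1" for y
    proof -
      have "B y"
        using BI y y0 z1(2) by auto
      then obtain z2 where z2: "V y z2" "\<not> V y0 z2"
        using \<open>B y0\<close> y(1) unfolding B_def by blast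
      have "y0 < z2"
        using gt[OF z2(1)] y(1) by simp
      then have "z1 < z2"
        using down[OF Vz1, of z2] Vz1 z2(2) by (metis linorder_neqE)
      then show ?thesis
        using down[OF z2(1)] y(2) by blast
    qed
    then have "{y. y0 < y \<and> y < z1} \<subseteq> {y. V y z1}"
      by blast
    then show False
      using infinite_interval[OF z1(1)] fin finite_subset by blast
  qed
qed

text \<open>Suppose that every \<open>z\<close> lies in finitely many fibres. Then the components of
  the fibres have only finitely many left endpoints, by \<open>no_overlapping_rays\<close>, and at
  each of these, as well as at minus infinity, only finitely many fibres can begin, by
  \<open>no_shrinking_rays\<close>.\<close>

lemma exchange_coordinates:
  assumes W: "dss W" and inf: "infinite {x. infinite {z. W x z}}"
  shows "\<exists>z. infinite {x. W x (z::'a)}"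
proof (rule ccontr)
  assume "\<not> ?thesis"
  then have fin: "finite {x. W x z}" for z
    by blast
  note W' = rssD[OF W]
  define I where "I x \<longleftrightarrow> contains_interval (W x)" for x
  have "ds (W x)" for x
    by (intro dpi W') simp_all
  then have infI: "infinite {x. I x}"
    using inf infinite_iff unfolding I_def by simp
  text \<open>\<open>V y z\<close>: the point \<open>z\<close> lies in a component with left endpoint \<open>y\<close> of some fibre.\<close>
  define comp where "comp x y z \<longleftrightarrow> y < z \<and> (\<forall>t. y < t \<and> t \<le> z \<longrightarrow> W x t) \<and>
      (\<forall>y'. y' < y \<longrightarrow> (\<exists>t. y' < t \<and> t \<le> z \<and> \<not> W x t))" for x y z
  define V where "V y z \<longleftrightarrow> (\<exists>x. comp x y z)" for y z
  have comp_W: "W x z" if "comp x y z" for x y z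
    using that unfolding comp_def by blast
  have comp_unique: "y = y'" if "comp x y z" "comp x y' z" for x y y' z
    using that unfolding comp_def by (metis linorder_neqE)
  have "finite {y. V y z}" for z
  proof -
    \<comment> \<open>The point \<open>z\<close> lies in finitely many fibres, and in at most one
      component of each.\<close>
    have "{y. V y z} \<subseteq> (\<lambda>x. THE y. comp x y z) ` {x. W x z}"
    proof
      fix y
      assume "y \<in> {y. V y z}"
      then obtain x where x: "comp x y z"
        by (auto simp: V_def)
      then have "(THE y. comp x y z) = y"
        using comp_unique by blast
      then show "y \<in> (\<lambda>x. THE y. comp x y z) ` {x. W x z}"
        using comp_W[OF x] by blast
    qed
    then show ?thesis
      using fin finite_subset by blast
  qed
  moreover have "V y z'" if Vyz: "V y z" "y < z'" "z' < z" for y z z'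
  proof -
    obtain x where x: "comp x y z"
      using Vyz by (auto simp: V_def)
    have "comp x y z'"
      unfolding comp_def
    proof (intro conjI allI impI)
      show "y < z'"
        by fact
      show "W x t" if "y < t \<and> t \<le> z'" for t
        using x that \<open>z' < z\<close> unfolding comp_def by auto
      fix y'
      assume "y' < y"
      then obtain t where t: "y' < t" "t \<le> z" "\<not> W x t"
        using x unfolding comp_def by blast
      then have "t \<le> y"
        using x unfolding comp_def by (metis not_less)
      then show "\<exists>t. y' < t \<and> t \<le> z' \<and> \<not> W x t"
        using t \<open>y < z'\<close> by (intro exI[of _ t]) auto
    qed
    then show ?thesis
      by (auto simp: V_def)
  qed
  moreover have "y < z" if "V y z" for y z
    using that by (auto simp: V_def comp_def)
  moreover have "dss V"
    unfolding V_def comp_def by (intro rssI dpi W')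
  ultimately have finV: "finite {y. \<exists>z. V y z}"
    by (intro no_overlapping_rays)
  define ray where "ray p x z \<longleftrightarrow> p < z \<and> (\<forall>t. p < t \<and> t \<le> z \<longrightarrow> W x t)" for p x z
  define botray where "botray x z \<longleftrightarrow> (\<forall>t. t \<le> z \<longrightarrow> W x t)" for x z
  have 1: "finite {x. \<exists>z. ray p x z}" for p
  proof (rule no_shrinking_rays[where Q = "\<lambda>z. p < z"])
    show "dss (ray p)"
      unfolding ray_def by (intro rssI dpi W') simp_all
    show "\<exists>z'<z. p < z'" if "p < z" for z
      using dense_order[OF that] by blast
    show "finite {x. ray p x z}" for z
      by (rule finite_subset[OF _ fin[of z]]) (auto simp: ray_def)
  qed (auto simp: ray_def)
  have 2: "finite {x. \<exists>z. botray x z}"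
  proof (rule no_shrinking_rays[where Q = "\<lambda>z. True"])
    show "dss botray"
      unfolding botray_def by (intro rssI dpi W')
    show "finite {x. botray x z}" for z
      by (rule finite_subset[OF _ fin[of z]]) (auto simp: botray_def)
    show "\<exists>z'<z. True" for z :: 'a
      using no_bot by blast
  qed (auto simp: botray_def)
  have "I x \<Longrightarrow> (\<exists>p. (\<exists>z. V p z) \<and> (\<exists>z. ray p x z)) \<or> (\<exists>z. botray x z)" for x
  proof -
    assume "I x"
    then obtain u v where uv: "u < v" "\<And>z. u < z \<Longrightarrow> z < v \<Longrightarrow> W x z"
      unfolding I_def contains_interval_def by blast
    obtain z where z: "u < z" "z < v"
      using dense_order[OF uv(1)] by blast
    \<comment> \<open>The left endpoint of the component of \<open>z\<close> is the supremum of the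
      points below \<open>z\<close> outside the fibre, if there are any.\<close>
    define T where "T t \<longleftrightarrow> t \<le> z \<and> \<not> W x t" for t
    have Tu: "t \<le> u" if "T t" for t
      using that uv(2) z unfolding T_def by (meson le_less_trans not_less)
    show ?thesis
    proof (cases "\<exists>t. T t")
      case False
      then show ?thesis
        unfolding T_def botray_def by blast
    next
      case True
      then obtain t0 where t0: "T t0"
        by blast
      have "ds T"
        unfolding T_def by (intro dpi W') simp_all
      then obtain P where P: "tames P T"
        using tame by blast
      obtain y where y: "\<forall>t. T t \<longrightarrow> t \<le> y" "\<forall>u<y. \<exists>t. T t \<and> u < t"
        using sup_exists[OF P t0, of u] Tu by blast
      have "y \<le> u"
        using y(2) Tu by (meson leD leI)
      then have "y < z"
        using z(1) by simp
      moreover have "\<forall>t. y < t \<and> t \<le> z \<longrightarrow> W x t"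
        using y(1) unfolding T_def by (meson leD)
      moreover have "\<forall>y'. y' < y \<longrightarrow> (\<exists>t. y' < t \<and> t \<le> z \<and> \<not> W x t)"
        using y(2) unfolding T_def by blast
      ultimately have "comp x y z" "ray y x z"
        unfolding comp_def ray_def by blast+
      then show ?thesis
        unfolding V_def by blast
    qed
  qed
  then have "{x. I x} \<subseteq> (\<Union>p\<in>{p. \<exists>z. V p z}. {x. \<exists>z. ray p x z}) \<union> {x. \<exists>z. botray x z}"
    by blast
  moreover have "finite ((\<Union>p\<in>{p. \<exists>z. V p z}. {x. \<exists>z. ray p x z}) \<union> {x. \<exists>z. botray x z})"
    using finV 1 2 by simp
  ultimately show False
    using infI finite_subset by blast
qed

text \<open>Full-dimensional subsets of \<open>M\<^sup>l\<close>, defined by iterated fibres so as to avoid boxes.\<close>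

primrec big :: "nat \<Rightarrow> ('a list \<Rightarrow> bool) \<Rightarrow> bool" where
  "big 0 S = S []"
| "big (Suc l) S = contains_interval (\<lambda>x. big l (\<lambda>w. S (x # w)))"

lemma dp_big [dpi]:
  assumes "dp UNIV (\<lambda>e. S (map e [0..<l]) (\<lambda>i. e (l + i)))"
  shows "dp UNIV (\<lambda>e. big l (\<lambda>w. S w e))"
  using assms
proof (induction l arbitrary: S)
  case 0
  then show ?case
    by simp
next
  case (Suc l)
  let ?\<rho> = "\<lambda>i. if i = 0 then l else if i \<le> l then i - 1 else i"
  have 1: "map (\<lambda>i. e (?\<rho> i)) [0..<Suc l] = e l # map e [0..<l]" for e :: "nat \<Rightarrow> 'a"
    by (simp only: upt_rec[of 0] map_Suc_upt[symmetric]) (auto simp: comp_def)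
  have 2: "(\<lambda>i. e (?\<rho> (Suc l + i))) = (\<lambda>i. e (l + Suc i))" for e :: "nat \<Rightarrow> 'a"
    by auto
  have "dp UNIV (\<lambda>e. S (e l # map e [0..<l]) (\<lambda>i. e (l + Suc i)))"
    using dpr_ren[OF Suc.prems, of ?\<rho>] unfolding 1 2 .
  then have "dp UNIV (\<lambda>e. big l (\<lambda>w. S (e 0 # w) (\<lambda>i. e (Suc i))))"
    by (intro Suc.IH[of "\<lambda>w e. S (e 0 # w) (\<lambda>i. e (Suc i))", unfolded add_0_right add_Suc_right[symmetric]])
  then show ?case
    unfolding big.simps by (intro dpi)
qed

lemma contains_interval_mono: "contains_interval S \<Longrightarrow> (\<And>x. S x \<Longrightarrow> T x) \<Longrightarrow> contains_interval T"
  unfolding contains_interval_def by blast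

lemma big_mono: "big l S \<Longrightarrow> (\<And>w. length w = l \<Longrightarrow> S w \<Longrightarrow> T w) \<Longrightarrow> big l T"
proof (induction l arbitrary: S T)
  case (Suc l)
  have "big l (\<lambda>w. T (x # w))" if "big l (\<lambda>w. S (x # w))" for x
    using that by (rule Suc.IH) (simp add: Suc.prems(2))
  then show ?case
    using Suc.prems(1) by (auto elim: contains_interval_mono)
qed simp

lemma contains_interval_ex: "contains_interval S \<Longrightarrow> \<exists>x::'a. S x"
  unfolding contains_interval_def using dense_order by blast

lemma big_ex: "big l S \<Longrightarrow> \<exists>w. length w = l \<and> S w"
proof (induction l arbitrary: S)
  case (Suc l)
  then obtain x where "big l (\<lambda>w. S (x # w))"
    using contains_interval_ex by fastforce
  then obtain w where "length w = l" "S (x # w)"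
    using Suc.IH by blast
  then show ?case
    by (intro exI[of _ "x # w"]) simp
qed simp

text \<open>The coordinates of \<open>w\<close> are fixed one at a time, each by
  \<open>exchange_coordinates\<close>.\<close>

lemma exchange_big:
  assumes "dsl l W" and "infinite {t. big l (W t)}"
  shows "\<exists>w. length w = l \<and> infinite {t. W t w}"
  using assms
proof (induction l arbitrary: W)
  case 0
  then show ?case
    by auto
next
  case (Suc l)
  note W' = rslD[OF Suc.prems(1)]
  define V where "V t x \<longleftrightarrow> big l (\<lambda>w. W t (x # w))" for t x
  have V: "dss V"
    unfolding V_def by (intro rssI dpi W') simp_all
  note V' = rssD[OF V]
  have "ds (V t)" for t
    by (intro dpi V') simp_all
  then have "infinite {t. infinite {x. V t x}}"
    using Suc.prems(2) infinite_iff unfolding V_def by simp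
  then obtain x where "infinite {t. V t x}"
    using exchange_coordinates[OF V] by blast
  then have "infinite {t. big l (\<lambda>w. W t (x # w))}"
    unfolding V_def .
  moreover have "dsl l (\<lambda>t w. W t (x # w))"
    by (intro rslI dpi W') simp_all
  ultimately obtain w where "length w = l" "infinite {t. W t (x # w)}"
    using Suc.IH by blast
  then show ?case
    by (intro exI[of _ "x # w"]) simp
qed

text \<open>Otherwise a single \<open>w\<close> would have infinitely many such \<open>t\<close>,
  all on the boundary of one definable subset of the line.\<close>

lemma finite_big_boundary:
  assumes "dsl l K"
  shows "finite {t. big l (\<lambda>w. K t w \<and> \<not> nearby t (\<lambda>t. K t w))}"
proof (rule ccontr)
  assume inf: "infinite {t. big l (\<lambda>w. K t w \<and> \<not> nearby t (\<lambda>t. K t w))}"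
  note K' = rslD[OF assms]
  have "dsl l (\<lambda>t w. K t w \<and> \<not> nearby t (\<lambda>t. K t w))"
    unfolding nearby_def by (intro rslI dpi K') simp_all
  then obtain w where w: "length w = l" "infinite {t. K t w \<and> \<not> nearby t (\<lambda>t. K t w)}"
    using exchange_big[OF _ inf] by blast
  have "{t. K t w \<and> \<not> nearby t (\<lambda>t. K t w)} \<subseteq> {t. bd (\<lambda>t. K t w) t}"
    unfolding bd_def by auto
  moreover have "ds (\<lambda>t. K t w)"
    using w(1) by (intro dpi K' tupr_const) simp_all
  then have "finite {t. bd (\<lambda>t. K t w) t}"
    using tame[of "\<lambda>t. K t w"] finite_bd by blast
  ultimately show False
    using w(2) finite_subset by blast
qed

end

section \<open>Uniform finiteness\<close>

text \<open>The half-open arc from \<open>u\<close> to \<open>v\<close> on the line closed up at infinity.\<close>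

definition arc :: "'a::linorder \<Rightarrow> 'a \<Rightarrow> 'a \<Rightarrow> bool" where
  "arc u v z \<longleftrightarrow> (u < v \<and> u \<le> z \<and> z < v) \<or> (\<not> u < v \<and> (u \<le> z \<or> z < v))"

definition none_in_arc :: "('a::linorder \<Rightarrow> bool) \<Rightarrow> 'a \<Rightarrow> 'a \<Rightarrow> bool" where
  "none_in_arc F u v \<longleftrightarrow> (\<forall>z. arc u v z \<longrightarrow> \<not> F z)"

definition one_in_arc :: "('a::linorder \<Rightarrow> bool) \<Rightarrow> 'a \<Rightarrow> 'a \<Rightarrow> bool" where
  "one_in_arc F u v \<longleftrightarrow> (\<exists>z. arc u v z \<and> F z \<and> (\<forall>z'. arc u v z' \<and> F z' \<longrightarrow> z' = z))"

text \<open>Counts zero and one suffice, because a finite fibre can be cut into arcs with one point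
  each. The arcs through infinity detect points that escape from every bounded interval as
  \<open>t\<close> varies.\<close>

definition bad :: "('a::linorder \<Rightarrow> 'a \<Rightarrow> bool) \<Rightarrow> 'a \<Rightarrow> bool" where
  "bad A t \<longleftrightarrow> (\<exists>u v. u \<noteq> v \<and> \<not> A t u \<and> \<not> A t v \<and>
     (none_in_arc (A t) u v \<and> \<not> nearby t (\<lambda>t. none_in_arc (A t) u v) \<or>
      one_in_arc (A t) u v \<and> \<not> nearby t (\<lambda>t. one_in_arc (A t) u v)))"

text \<open>The element number \<open>i\<close> of \<open>S\<close> in increasing order, counted
  from 0. The recursion makes it a formula for every fixed \<open>i\<close>.\<close>

primrec rk :: "nat \<Rightarrow> ('a::linorder \<Rightarrow> bool) \<Rightarrow> 'a \<Rightarrow> bool" where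
  "rk 0 S p = (S p \<and> (\<forall>q. q < p \<longrightarrow> \<not> S q))"
| "rk (Suc i) S p = (S p \<and> (\<exists>q. rk i S q \<and> q < p \<and> (\<forall>r. q < r \<and> r < p \<longrightarrow> \<not> S r)))"

lemma rk_iff:
  assumes "finite {q. S q}"
  shows "rk i S p \<longleftrightarrow> S p \<and> card {q. S q \<and> q < p} = i"
proof (induction i arbitrary: p)
  case 0
  have "finite {q. S q \<and> q < p}"
    using assms by simp
  then show ?case
    by auto
next
  case (Suc i)
  have fin: "finite {q. S q \<and> q < p}" for p
    using assms by simp
  show ?case
  proof
    assume "rk (Suc i) S p"
    then obtain q where q: "S p" "S q" "card {r. S r \<and> r < q} = i" "q < p"
      "\<forall>r. q < r \<and> r < p \<longrightarrow> \<not> S r"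
      using Suc by auto
    have "{r. S r \<and> r < p} = insert q {r. S r \<and> r < q}"
      using q by (auto intro: order_less_trans) (metis linorder_neqE)
    then show "S p \<and> card {q. S q \<and> q < p} = Suc i"
      using q fin[of q] by simp
  next
    assume p: "S p \<and> card {q. S q \<and> q < p} = Suc i"
    then have "{q. S q \<and> q < p} \<noteq> {}"
      by (metis card.empty nat.distinct(1))
    then have m: "Max {q. S q \<and> q < p} \<in> {q. S q \<and> q < p}" (is "?m \<in> _")
      by (intro Max_in fin)
    have "{r. S r \<and> r < ?m} = {q. S q \<and> q < p} - {?m}"
      using m Max_ge[OF fin[of p]] by (auto simp: order_le_less)
    then have "card {r. S r \<and> r < ?m} = i"
      using m p by (metis (no_types, lifting) card_Diff_singleton diff_Suc_1)
    then have "rk i S ?m"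
      using Suc.IH[of ?m] m by blast
    moreover have "\<forall>r. ?m < r \<and> r < p \<longrightarrow> \<not> S r"
      using Max_ge[OF fin[of p]] by (auto simp: not_less[symmetric])
    ultimately show "rk (Suc i) S p"
      unfolding rk.simps using m p by blast
  qed
qed

lemma rk_less_card:
  assumes "finite {q. S q}" and "S p"
  shows "\<exists>i<card {q. S q}. rk i S p"
proof -
  have "{q. S q \<and> q < p} \<subset> {q. S q}"
    using assms(2) by auto
  then have "card {q. S q \<and> q < p} < card {q. S q}"
    using assms(1) by (rule psubset_card_mono[rotated])
  then show ?thesis
    using rk_iff[OF assms(1)] assms(2) by blast
qed

lemma rk_unique: "rk i S p \<Longrightarrow> rk i S p' \<Longrightarrow> p = p'"
proof (induction i arbitrary: p p')
  case 0
  then show ?case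
    by (auto intro: linorder_neqE)
next
  case (Suc i)
  then obtain q where "q < p" "q < p'" "S p" "S p'"
    "\<forall>r. q < r \<and> r < p \<longrightarrow> \<not> S r" "\<forall>r. q < r \<and> r < p' \<longrightarrow> \<not> S r"
    by auto
  then show ?case
    by (metis linorder_neqE)
qed

lemma card_eq_Suc_iff_rk:
  assumes "finite {q. S q}"
  shows "card {q. S q} = Suc k \<longleftrightarrow> (\<exists>p. rk k S p \<and> (\<forall>q. p < q \<longrightarrow> \<not> S q))"
proof
  assume c: "card {q. S q} = Suc k"
  then have "{q. S q} \<noteq> {}"
    by (metis card.empty nat.distinct(1))
  then have m: "Max {q. S q} \<in> {q. S q}" (is "?m \<in> _")
    using assms by (intro Max_in)
  have "{q. S q \<and> q < ?m} = {q. S q} - {?m}"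
    using m Max_ge[OF assms] by (auto simp: order_le_less)
  then have "card {q. S q \<and> q < ?m} = k"
    using m c assms by simp
  then show "\<exists>p. rk k S p \<and> (\<forall>q. p < q \<longrightarrow> \<not> S q)"
    using m Max_ge[OF assms] rk_iff[OF assms] by (intro exI[of _ ?m]) (auto simp: not_less[symmetric])
next
  assume "\<exists>p. rk k S p \<and> (\<forall>q. p < q \<longrightarrow> \<not> S q)"
  then obtain p where p: "S p" "card {q. S q \<and> q < p} = k" "\<forall>q. p < q \<longrightarrow> \<not> S q"
    using rk_iff[OF assms] by blast
  have "{q. S q} = insert p {q. S q \<and> q < p}"
    using p by auto (metis linorder_neqE)
  then show "card {q. S q} = Suc k"
    using p(2) assms by (metis (mono_tags, lifting) card_insert_disjoint finite_insert less_irrefl mem_Collect_eq)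
qed

context omin
begin

text \<open>The points \<open>t\<close> where the fibre \<open>A t\<close> fails to vary in an orderly way are finite in number because a
  failure on the arc from \<open>u\<close> to \<open>v\<close> persists when both end points move outwards a little, so that it
  occurs on a two-dimensional set of arcs.\<close>

lemma arc_enlarge:
  assumes "finite {z::'a. F z}" and "\<not> F u" and "\<not> F v" and "u \<noteq> v"
  shows "\<exists>u0<u. \<exists>v0>v. \<forall>u' v'. u0 < u' \<and> u' < u \<and> v < v' \<and> v' < v0 \<longrightarrow>
    u' \<noteq> v' \<and> \<not> F u' \<and> \<not> F v' \<and> none_in_arc F u' u \<and> none_in_arc F v v' \<and>
    (\<forall>z. arc u' v' z \<longleftrightarrow> arc u v z \<or> arc u' u z \<or> arc v v' z)"
proof -
  \<comment> \<open>For an arc through infinity, \<open>w\<close> keeps the two ends apart: neither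
    may cross it when the arc grows, so the arc cannot close up.\<close>
  obtain w where w: "v < u \<longrightarrow> v < w \<and> w < u"
    using dense_order by blast
  have fP: "finite (insert w {z. F z})"
    using assms(1) by simp
  obtain u0 where u0: "u0 < u" "\<forall>q\<in>insert w {z. F z}. q < u \<longrightarrow> q \<le> u0"
    using gap_below[OF fP] by blast
  obtain v0 where v0: "v < v0" "\<forall>q\<in>insert w {z. F z}. v < q \<longrightarrow> v0 \<le> q"
    using gap_above[OF fP] by blast
  have "u' \<noteq> v' \<and> \<not> F u' \<and> \<not> F v' \<and> none_in_arc F u' u \<and> none_in_arc F v v' \<and>
    (\<forall>z. arc u' v' z \<longleftrightarrow> arc u v z \<or> arc u' u z \<or> arc v v' z)"
    if *: "u0 < u'" "u' < u" "v < v'" "v' < v0" for u' v'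
  proof (intro conjI)
    have "u < v \<or> v < w \<and> w < u \<and> v0 \<le> w \<and> w \<le> u0"
      using w u0 v0 assms(4) by auto
    then have **: "u < v \<or> v' < u'"
      using * by auto
    then show "u' \<noteq> v'"
      using * by auto
    have Fu: "\<not> (F z \<and> u0 < z \<and> z < u)" for z
      using u0(2) by (auto simp: not_less[symmetric])
    have Fv: "\<not> (F z \<and> v < z \<and> z < v0)" for z
      using v0(2) by (auto simp: not_less[symmetric])
    show "\<not> F u'" "\<not> F v'"
      using Fu Fv * by blast+
    show "none_in_arc F u' u"
      unfolding none_in_arc_def arc_def using Fu * by auto
    show "none_in_arc F v v'"
      unfolding none_in_arc_def arc_def
    proof (intro allI impI)
      fix z
      assume "v < v' \<and> v \<le> z \<and> z < v' \<or> \<not> v < v' \<and> (v \<le> z \<or> z < v')"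
      then have "v = z \<or> v < z \<and> z < v0"
        using * by auto
      then show "\<not> F z"
        using Fv assms(3) by blast
    qed
    show "\<forall>z. arc u' v' z \<longleftrightarrow> arc u v z \<or> arc u' u z \<or> arc v v' z"
      unfolding arc_def using * ** by auto
  qed
  then show ?thesis
    using u0(1) v0(1) by blast
qed

lemma finite_big_boundary2:
  assumes "dp UNIV (\<lambda>e. K (e 0) (e (Suc 0)) (e (Suc (Suc 0))))"
  shows "finite {t. contains_interval (\<lambda>u. contains_interval (\<lambda>v. K t u v \<and> \<not> nearby t (\<lambda>t. K t u v)))}"
proof -
  have "dsl (Suc (Suc 0)) (\<lambda>t w. K t (w ! 0) (w ! Suc 0))"
    using assms by (intro rslI) (simp del: upt_Suc)
  from finite_big_boundary[OF this] show ?thesis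
    by simp
qed

lemma finite_bad:
  assumes A: "dss A" and fin: "\<And>t. finite {z. A t z}"
  shows "finite {t. bad A t}"
proof -
  note A' = rssD[OF A]
  let ?F = "\<lambda>K. {t. contains_interval (\<lambda>u. contains_interval (\<lambda>v. K t u v \<and> \<not> nearby t (\<lambda>t. K t u v)))}"
  let ?F0 = "?F (\<lambda>t. none_in_arc (A t))" and ?F1 = "?F (\<lambda>t. one_in_arc (A t))"
  have "finite ?F0"
    unfolding none_in_arc_def arc_def by (rule finite_big_boundary2) (intro dpi A')
  have "finite ?F1"
    unfolding one_in_arc_def arc_def by (rule finite_big_boundary2) (intro dpi A')
  have none: "nearby t (\<lambda>t. none_in_arc (A t) u v)"
    if t: "t \<notin> ?F0" and uv: "\<not> A t u" "\<not> A t v" "u \<noteq> v" "none_in_arc (A t) u v" for t u v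
  proof (rule ccontr)
    assume not: "\<not> nearby t (\<lambda>t. none_in_arc (A t) u v)"
    obtain u0 v0 where 0: "u0 < u" "v < v0" and E: "\<And>u' v'. u0 < u' \<and> u' < u \<and> v < v' \<and> v' < v0 \<Longrightarrow>
        none_in_arc (A t) u' u \<and> none_in_arc (A t) v v' \<and> (\<forall>z. arc u' v' z \<longleftrightarrow> arc u v z \<or> arc u' u z \<or> arc v v' z)"
      using arc_enlarge[OF fin uv(1-3)] by blast
    have "none_in_arc (A t) u' v' \<and> \<not> nearby t (\<lambda>t. none_in_arc (A t) u' v')"
      if "u0 < u'" "u' < u" "v < v'" "v' < v0" for u' v'
    proof
      have *: "arc u' v' z \<longleftrightarrow> arc u v z \<or> arc u' u z \<or> arc v v' z" for z
        using E that by blast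
      show "none_in_arc (A t) u' v'"
        using E[of u' v'] that uv(4) unfolding none_in_arc_def * by blast
      have "none_in_arc (A t) u' v' \<Longrightarrow> none_in_arc (A t) u v" for t
        unfolding none_in_arc_def * by blast
      then show "\<not> nearby t (\<lambda>t. none_in_arc (A t) u' v')"
        using not nearby_mono[of t "\<lambda>t. none_in_arc (A t) u' v'" "\<lambda>t. none_in_arc (A t) u v"] by blast
    qed
    then have "t \<in> ?F0"
      unfolding contains_interval_def[of "\<lambda>u. contains_interval _"] mem_Collect_eq
      using 0 unfolding contains_interval_def by blast
    then show False
      using t by blast
  qed
  have one: "nearby t (\<lambda>t. one_in_arc (A t) u v)"
    if t: "t \<notin> ?F0" "t \<notin> ?F1" and uv: "\<not> A t u" "\<not> A t v" "u \<noteq> v" "one_in_arc (A t) u v" for t u v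
  proof (rule ccontr)
    assume not: "\<not> nearby t (\<lambda>t. one_in_arc (A t) u v)"
    obtain u0 v0 where 0: "u0 < u" "v < v0" and E: "\<And>u' v'. u0 < u' \<and> u' < u \<and> v < v' \<and> v' < v0 \<Longrightarrow>
        \<not> A t u' \<and> \<not> A t v' \<and> none_in_arc (A t) u' u \<and> none_in_arc (A t) v v' \<and>
        (\<forall>z. arc u' v' z \<longleftrightarrow> arc u v z \<or> arc u' u z \<or> arc v v' z)"
      using arc_enlarge[OF fin uv(1-3)] by blast
    have "one_in_arc (A t) u' v' \<and> \<not> nearby t (\<lambda>t. one_in_arc (A t) u' v')"
      if u'v': "u0 < u'" "u' < u" "v < v'" "v' < v0" for u' v'
    proof
      have *: "arc u' v' z \<longleftrightarrow> arc u v z \<or> arc u' u z \<or> arc v v' z" for z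
        using E u'v' by blast
      show "one_in_arc (A t) u' v'"
      proof -
        have n: "\<not> A t z" if "arc u' u z \<or> arc v v' z" for z
          using E[of u' v'] u'v' that unfolding none_in_arc_def by blast
        obtain z where "arc u v z" "A t z" "\<And>z'. arc u v z' \<Longrightarrow> A t z' \<Longrightarrow> z' = z"
          using uv(4) unfolding one_in_arc_def by blast
        then show ?thesis
          unfolding one_in_arc_def * using n by (intro exI[of _ z]) blast
      qed
      show "\<not> nearby t (\<lambda>t. one_in_arc (A t) u' v')"
      proof
        assume "nearby t (\<lambda>t. one_in_arc (A t) u' v')"
        \<comment> \<open>The two arcs added at the ends stay empty near \<open>t\<close>. Hence
          stability of the count on the large arc would give stability on the small one.\<close>
        moreover have "nearby t (\<lambda>t. none_in_arc (A t) u' u)"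
          using E[of u' v'] u'v' t(1) uv by (intro none) auto
        moreover have "nearby t (\<lambda>t. none_in_arc (A t) v v')"
          using E[of u' v'] u'v' t(1) uv by (intro none) auto
        ultimately have "nearby t (\<lambda>t. one_in_arc (A t) u' v' \<and> none_in_arc (A t) u' u \<and> none_in_arc (A t) v v')"
          by (intro nearby_conj)
        then have "nearby t (\<lambda>t. one_in_arc (A t) u v)"
          by (rule nearby_mono) (unfold one_in_arc_def none_in_arc_def *, blast)
        with not show False
          by blast
      qed
    qed
    then have "t \<in> ?F1"
      unfolding contains_interval_def[of "\<lambda>u. contains_interval _"] mem_Collect_eq
      using 0 unfolding contains_interval_def by blast
    then show False
      using t by blast
  qed
  have "{t. bad A t} \<subseteq> ?F0 \<union> ?F1"
  proof
    fix t
    assume "t \<in> {t. bad A t}"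
    then show "t \<in> ?F0 \<union> ?F1"
      using none[of t] one[of t] unfolding bad_def mem_Collect_eq Un_iff by blast
  qed
  then show ?thesis
    using \<open>finite ?F0\<close> \<open>finite ?F1\<close> finite_subset by blast
qed

text \<open>The fibre is enclosed between \<open>u\<close> and \<open>v\<close>. By induction on the
  number of points, it is cut just below its last point into a smaller arc and an arc with exactly
  one point, and the latter is stable since \<open>t\<close> is not bad.\<close>

lemma card_locally_constant:
  assumes fin: "\<And>t. finite {z::'a. A t z}" and good: "\<not> bad A t"
  shows "nearby t (\<lambda>t'. card {z. A t' z} = card {z. A t z})"
proof -
  have none: "nearby t (\<lambda>t. none_in_arc (A t) u v)"
    if "u \<noteq> v" "\<not> A t u" "\<not> A t v" "none_in_arc (A t) u v" for u v
    using good that unfolding bad_def by blast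
  have one: "nearby t (\<lambda>t. one_in_arc (A t) u v)"
    if "u \<noteq> v" "\<not> A t u" "\<not> A t v" "one_in_arc (A t) u v" for u v
    using good that unfolding bad_def by blast
  have "\<exists>u. \<forall>z\<in>{z. A t z}. u < z"
  proof -
    obtain y where y: "y < Min {z. A t z}"
      using no_bot by blast
    then show ?thesis
      using Min_le[OF fin[of t]] by (intro exI[of _ y]) (auto intro: order_less_le_trans)
  qed
  then obtain u where u: "\<forall>z. A t z \<longrightarrow> u < z"
    by blast
  have "\<exists>v. u < v \<and> (\<forall>z\<in>{z. A t z}. z < v)"
  proof -
    obtain y where y: "Max (insert u {z. A t z}) < y"
      using no_top by blast
    have "z < y" if "z \<in> insert u {z. A t z}" for z
      using Max_ge[of "insert u {z. A t z}" z] fin[of t] that y by (meson finite_insert order_le_less_trans)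
    then show ?thesis
      by blast
  qed
  then obtain v where v: "u < v" "\<forall>z. A t z \<longrightarrow> z < v"
    by blast
  have nu: "\<not> A t u" and nv: "\<not> A t v"
    using u v by blast+
  have fin': "finite {z. A t z \<and> u \<le> z \<and> z < v}" for t v
    using fin[of t] by simp
  have main: "nearby t (\<lambda>t'. card {z. A t' z \<and> u \<le> z \<and> z < v} = k)"
    if "u < v" "\<not> A t v" "card {z. A t z \<and> u \<le> z \<and> z < v} = k" for v k
    using that
  proof (induction k arbitrary: v)
    case 0
    then have "none_in_arc (A t) u v"
      using fin'[of t v] unfolding none_in_arc_def arc_def by auto
    then have "nearby t (\<lambda>t. none_in_arc (A t) u v)"
      using 0 nu by (intro none) auto
    then show ?case
    proof (rule nearby_mono)
      fix t'
      assume "none_in_arc (A t') u v"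
      then have "{z. A t' z \<and> u \<le> z \<and> z < v} = {}"
        using 0(1) by (auto simp: none_in_arc_def arc_def)
      then show "card {z. A t' z \<and> u \<le> z \<and> z < v} = 0"
        by (simp only: card.empty)
    qed
  next
    case (Suc k)
    let ?S = "{z. A t z \<and> u \<le> z \<and> z < v}"
    have "?S \<noteq> {}"
      using Suc.prems(3) by (metis card.empty nat.distinct(1))
    then have m: "Max ?S \<in> ?S"
      using fin' by (intro Max_in)
    obtain v1 where v1: "v1 < Max ?S" "\<forall>q\<in>insert u {z. A t z}. q < Max ?S \<longrightarrow> q \<le> v1"
      using gap_below[of "insert u {z. A t z}" "Max ?S"] fin by auto
    \<comment> \<open>The cut \<open>s\<close> separates the last point from all the others and is
      itself not in the fibre.\<close>
    obtain s where s: "v1 < s" "s < Max ?S"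
      using dense_order[OF v1(1)] by blast
    have us: "u < s"
      using v1(2) s u m by (metis (mono_tags, lifting) insertCI le_less_trans mem_Collect_eq)
    have ns: "\<not> A t z" if "v1 < z" "z < Max ?S" for z
      using v1(2) that by (auto simp: not_less[symmetric])
    have above: "z = Max ?S" if "A t z" "s \<le> z" "z < v" for z
    proof -
      have "z \<in> ?S"
        using that us by auto
      then have "z \<le> Max ?S"
        using fin' by (intro Max_ge)
      moreover have "\<not> z < Max ?S"
        using ns[of z] that s(1) by (meson order_less_le_trans)
      ultimately show ?thesis
        by simp
    qed
    have "{z. A t z \<and> u \<le> z \<and> z < s} = ?S - {Max ?S}"
    proof (intro set_eqI iffI)
      fix z
      assume "z \<in> {z. A t z \<and> u \<le> z \<and> z < s}"
      then show "z \<in> ?S - {Max ?S}"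
        using s m by auto
    next
      fix z
      assume z: "z \<in> ?S - {Max ?S}"
      then show "z \<in> {z. A t z \<and> u \<le> z \<and> z < s}"
        using above[of z] by (auto simp: not_less[symmetric])
    qed
    then have "card {z. A t z \<and> u \<le> z \<and> z < s} = k"
      using m Suc.prems(3) fin'[of t v] by simp
    then have 1: "nearby t (\<lambda>t'. card {z. A t' z \<and> u \<le> z \<and> z < s} = k)"
      using us ns[OF s] by (intro Suc.IH)
    have sv: "s < v"
      using s m by auto
    have "one_in_arc (A t) s v"
      unfolding one_in_arc_def arc_def using m s sv above by (intro exI[of _ "Max ?S"]) auto
    then have "nearby t (\<lambda>t. one_in_arc (A t) s v)"
      using ns[OF s] sv Suc.prems by (intro one) auto
    with 1 have "nearby t (\<lambda>t'. card {z. A t' z \<and> u \<le> z \<and> z < s} = k \<and> one_in_arc (A t') s v)"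
      by (rule nearby_conj)
    then show ?case
    proof (rule nearby_mono)
      fix t'
      assume t': "card {z. A t' z \<and> u \<le> z \<and> z < s} = k \<and> one_in_arc (A t') s v"
      then obtain z where z: "s \<le> z" "z < v" "A t' z" "\<forall>z'. s \<le> z' \<and> z' < v \<and> A t' z' \<longrightarrow> z' = z"
        using sv unfolding one_in_arc_def arc_def by auto
      have "{z. A t' z \<and> u \<le> z \<and> z < v} = insert z {z. A t' z \<and> u \<le> z \<and> z < s}"
      proof (intro set_eqI iffI)
        fix y
        assume "y \<in> {z. A t' z \<and> u \<le> z \<and> z < v}"
        then show "y \<in> insert z {z. A t' z \<and> u \<le> z \<and> z < s}"
          using z(4) by (cases "y < s") auto
      next
        fix y
        assume "y \<in> insert z {z. A t' z \<and> u \<le> z \<and> z < s}"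
        then show "y \<in> {z. A t' z \<and> u \<le> z \<and> z < v}"
          using z(1-3) us sv by auto
      qed
      then show "card {z. A t' z \<and> u \<le> z \<and> z < v} = Suc k"
        using t' z(1) fin[of t'] by (simp add: leD)
    qed
  qed
  have "{z. A t z} = {z. A t z \<and> u \<le> z \<and> z < v}"
    using u v by auto
  then have "nearby t (\<lambda>t'. card {z. A t' z \<and> u \<le> z \<and> z < v} = card {z. A t z})"
    using main[OF v(1) nv] by simp
  \<comment> \<open>The arc from \<open>v\<close> through infinity to \<open>u\<close> is empty, and
    remains so near \<open>t\<close>; no point of a nearby fibre lies outside the enclosure.\<close>
  moreover have "none_in_arc (A t) v u"
    using u v unfolding none_in_arc_def arc_def by (auto simp: not_less[symmetric])
  then have "nearby t (\<lambda>t. none_in_arc (A t) v u)"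
    using v nu nv by (intro none) auto
  ultimately have "nearby t (\<lambda>t'. card {z. A t' z \<and> u \<le> z \<and> z < v} = card {z. A t z} \<and> none_in_arc (A t') v u)"
    by (rule nearby_conj)
  then show ?thesis
  proof (rule nearby_mono)
    fix t'
    assume t': "card {z. A t' z \<and> u \<le> z \<and> z < v} = card {z. A t z} \<and> none_in_arc (A t') v u"
    then have "{z. A t' z} = {z. A t' z \<and> u \<le> z \<and> z < v}"
      using v(1) unfolding none_in_arc_def arc_def by (auto simp: not_less[symmetric])
    then show "card {z. A t' z} = card {z. A t z}"
      using t' by simp
  qed
qed

lemma dp_rk [dpi]:
  assumes "dp C (\<lambda>e. S (e 0) (\<lambda>i. e (Suc i)))"
  shows "dp C (\<lambda>e. rk i (\<lambda>x. S x e) (e k))"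
  using assms
proof (induction i arbitrary: S k)
  case 0
  note 1 = dpr_ren[OF 0, of "case_nat k (\<lambda>i. i)"]
  note 2 = dpr_ren[OF 0, of "case_nat 0 (\<lambda>i. Suc i)"]
  show ?case
    unfolding rk.simps using 1 2 by (intro dpi) simp_all
next
  case (Suc i)
  note 1 = dpr_ren[OF Suc.prems, of "case_nat k (\<lambda>i. i)"]
  note 2 = dpr_ren[OF Suc.prems, of "case_nat 0 (\<lambda>i. Suc (Suc i))"]
  note 3 = Suc.IH[of "\<lambda>x e. S x (\<lambda>i. e (Suc i))" 0]
  show ?case
    unfolding rk.simps using 1 2 by (intro dpi 3) simp_all
qed

text \<open>There are \<open>Suc k\<close> elements if and only if element number \<open>k\<close>
  is the last one.\<close>

lemma dp_card:
  assumes "dp C (\<lambda>e. S (e 0) (\<lambda>i. e (Suc i)))" and fin: "\<And>e. finite {x. S x e}"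
  shows "dp C (\<lambda>e. card {x. S x e} = m)"
proof (cases m)
  case 0
  have *: "card {x. S x e} = m \<longleftrightarrow> (\<forall>x. \<not> S x e)" for e
    using fin[of e] 0 by auto
  show ?thesis
    unfolding * using assms(1) by (intro dpi)
next
  case (Suc k)
  have *: "card {x. S x e} = m \<longleftrightarrow> (\<exists>p. rk k (\<lambda>x. S x e) p \<and> (\<forall>q. p < q \<longrightarrow> \<not> S q e))" for e
    using card_eq_Suc_iff_rk[OF fin[of e]] Suc by simp
  note 1 = dpr_ren[OF assms(1), of "case_nat 0 (\<lambda>i. Suc (Suc i))"]
  show ?thesis
    unfolding * using 1 by (intro dpi) simp_all
qed

section \<open>Bounding finite fibres by induction on the number of parameters\<close>

definition uniformly_finite :: "nat \<Rightarrow> bool" where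
  "uniformly_finite n \<longleftrightarrow> (\<forall>P. dsl n P \<longrightarrow> (\<forall>s. length s = n \<longrightarrow> finite {z. P z s}) \<longrightarrow>
     (\<exists>r. \<forall>s. length s = n \<longrightarrow> card {z. P z s} \<le> r))"

text \<open>Piece 0 lies to the left of \<open>B\<close>, and piece \<open>Suc i\<close> follows
  point number \<open>i\<close> of \<open>B\<close> up to the next one, if any. Points of
  \<open>B\<close> belong to no piece.\<close>

primrec piece :: "nat \<Rightarrow> ('a \<Rightarrow> bool) \<Rightarrow> 'a \<Rightarrow> bool" where
  "piece 0 B t = (\<forall>q. q \<le> t \<longrightarrow> \<not> B q)"
| "piece (Suc i) B t = (\<exists>p. rk i B p \<and> p < t \<and> (\<forall>q. p < q \<and> q \<le> t \<longrightarrow> \<not> B q))"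

lemma piece_avoids:
  assumes "piece i B t" and "piece i B t'" and "t \<le> q" and "q \<le> t'"
  shows "\<not> B q"
proof (cases i)
  case 0
  then show ?thesis
    using assms by simp
next
  case (Suc j)
  then obtain p p' where "rk j B p" "p < t" "rk j B p'" "p' < t'" "\<forall>q. p' < q \<and> q \<le> t' \<longrightarrow> \<not> B q"
    using assms by auto
  then show ?thesis
    using rk_unique[of j B p p'] assms by auto
qed

lemma piece_left_open: "piece i B t \<Longrightarrow> \<exists>u<t. \<forall>t'. u < t' \<and> t' < t \<longrightarrow> piece i B t'"
proof (cases i)
  case 0
  assume "piece i B t"
  then show ?thesis
    using no_bot[of t] 0 by auto
next
  case (Suc j)
  assume "piece i B t"
  then obtain p where "rk j B p" "p < t" "\<forall>q. p < q \<and> q \<le> t \<longrightarrow> \<not> B q"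
    using Suc by auto
  then show ?thesis
    using Suc by (intro exI[of _ p]) auto
qed

lemma piece_cover:
  assumes "finite {q. B q}" and "\<not> B t" and "card {q. B q} \<le> n"
  shows "\<exists>i\<le>n. piece i B t"
proof (cases "{q. B q \<and> q < t} = {}")
  case True
  then have "piece 0 B t"
    using assms(2) by (auto simp: order_le_less)
  then show ?thesis
    by blast
next
  case False
  have f: "finite {q. B q \<and> q < t}"
    using assms(1) by simp
  from False have m: "Max {q. B q \<and> q < t} \<in> {q. B q \<and> q < t}" (is "?m \<in> _")
    using f by (intro Max_in)
  then obtain i where i: "i < card {q. B q}" "rk i B ?m"
    using rk_less_card[OF assms(1), of ?m] by blast
  have "\<not> B q" if "?m < q" "q \<le> t" for q
    using that Max_ge[OF f, of q] assms(2) by (auto simp: order_le_less)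
  then have "piece (Suc i) B t"
    unfolding piece.simps using i(2) m by blast
  then show ?thesis
    using i(1) assms(3) by (intro exI[of _ "Suc i"]) simp
qed

lemma dp_piece [dpi]:
  assumes "dp C (\<lambda>e. S (e 0) (\<lambda>i. e (Suc i)))"
  shows "dp C (\<lambda>e. piece i (\<lambda>x. S x e) (e k))"
proof -
  note 1 = dpr_ren[OF assms, of "case_nat 0 (\<lambda>i. Suc i)"]
    dpr_ren[OF assms, of "case_nat 0 (\<lambda>i. Suc (Suc i))"]
  show ?thesis
  proof (cases i)
    case 0
    show ?thesis
      unfolding 0 piece.simps using 1 by (intro dpi) simp_all
  next
    case (Suc j)
    show ?thesis
      unfolding Suc piece.simps using 1 by (intro dpi) simp_all
  qed
qed

text \<open>The function \<open>c\<close> may be computed with any \<open>w\<close> in the full-dimensional set \<open>W x\<close>. In the induction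
  step, \<open>c\<close> is locally constant in the first coordinate \<open>t\<close> of \<open>x\<close> off a finite set \<open>B\<close>, since being bad
  for all \<open>w\<close> is a condition that only finitely many \<open>t\<close> can satisfy. On each piece between points of \<open>B\<close> the
  coordinate \<open>t\<close> is moved from \<open>x\<close> to \<open>w\<close>, which avoids choosing a point of the piece definably.\<close>

lemma fibre_card_bounded:
  assumes uniformly_finite: "\<And>m. m \<le> n \<Longrightarrow> uniformly_finite m"
  shows "j + l = Suc n \<Longrightarrow> dsll j l A \<Longrightarrow> dll j l W \<Longrightarrow>
    (\<And>x w. length x = j \<Longrightarrow> length w = l \<Longrightarrow> finite {z. A z x w}) \<Longrightarrow>
    (\<And>x w. length x = j \<Longrightarrow> length w = l \<Longrightarrow> W x w \<Longrightarrow> card {z. A z x w} = c x) \<Longrightarrow>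
    \<exists>r. \<forall>x. length x = j \<and> big l (W x) \<longrightarrow> c x \<le> r"
proof (induction j arbitrary: l A W c)
  case 0
  then show ?case
    by (intro exI[of _ "c []"]) simp
next
  case (Suc j)
  note fin = Suc.prems(4) and card = Suc.prems(5)
  note A' = rsllD[OF Suc.prems(2)] and W' = rllD[OF Suc.prems(3)]
  define X where "X t x \<longleftrightarrow> big l (W (t # x))" for t x
  have "dsl j X"
    unfolding X_def by (intro rslI dpi W') simp_all
  note X' = rslD[OF this]
  define B where "B t x \<longleftrightarrow> bd (\<lambda>t. X t x) t \<or> (X t x \<and> (\<forall>w. length w = l \<longrightarrow> W (t # x) w \<longrightarrow>
      bad (\<lambda>t z. A z (t # x) w) t \<or> \<not> nearby t (\<lambda>t. W (t # x) w)))" for t x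
  have dB: "dsl j B"
    unfolding B_def bd_def bad_def none_in_arc_def one_in_arc_def arc_def nearby_def
    by (intro rslI dpi A' W' X') simp_all
  note B' = rslD[OF dB]
  have finB: "finite {t. B t x}" if x: "length x = j" for x
  proof -
    have "ds (\<lambda>t. X t x)"
      using x by (intro dpi X') simp_all
    then have 1: "finite {t. bd (\<lambda>t. X t x) t}"
      using tame[of "\<lambda>t. X t x"] finite_bd by blast
    \<comment> \<open>A failure for every \<open>w\<close> in the full-dimensional set
      \<open>W (t # x)\<close> is weakened to a failure for a full-dimensional set of
      \<open>w\<close>, to which \<open>exchange_big\<close> applies.\<close>
    define Z where "Z t w \<longleftrightarrow> bad (\<lambda>t z. A z (t # x) w) t \<or> (W (t # x) w \<and> \<not> nearby t (\<lambda>t. W (t # x) w))" for t w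
    have dZ: "dsl l Z"
      unfolding Z_def bad_def none_in_arc_def one_in_arc_def arc_def nearby_def
      using x by (intro rslI dpi A' W') simp_all
    have 2: "finite {t. big l (Z t)}"
    proof (rule ccontr)
      assume "infinite {t. big l (Z t)}"
      then obtain w where w: "length w = l" "infinite {t. Z t w}"
        using exchange_big[OF dZ] by blast
      have "dss (\<lambda>t z. A z (t # x) w)"
        using x w(1) by (intro rssI dpi A') simp_all
      then have 3: "finite {t. bad (\<lambda>t z. A z (t # x) w) t}"
        using fin x w(1) by (intro finite_bad) simp_all
      have "ds (\<lambda>t. W (t # x) w)"
        using x w(1) by (intro dpi W') simp_all
      then have 4: "finite {t. bd (\<lambda>t. W (t # x) w) t}"
        using tame[of "\<lambda>t. W (t # x) w"] finite_bd by blast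
      have "{t. Z t w} \<subseteq> {t. bad (\<lambda>t z. A z (t # x) w) t} \<union> {t. bd (\<lambda>t. W (t # x) w) t}"
        unfolding Z_def bd_def by auto
      then show False
        using w(2) 3 4 finite_subset by blast
    qed
    have "{t. B t x} \<subseteq> {t. bd (\<lambda>t. X t x) t} \<union> {t. big l (Z t)}"
    proof
      fix t
      assume "t \<in> {t. B t x}"
      moreover have "big l (Z t)" if "X t x" "\<forall>w. length w = l \<longrightarrow> W (t # x) w \<longrightarrow>
          bad (\<lambda>t z. A z (t # x) w) t \<or> \<not> nearby t (\<lambda>t. W (t # x) w)"
        using that(1) unfolding X_def by (rule big_mono) (use that(2) in \<open>auto simp: Z_def\<close>)
      ultimately show "t \<in> {t. bd (\<lambda>t. X t x) t} \<union> {t. big l (Z t)}"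
        unfolding B_def by blast
    qed
    then show ?thesis
      using 1 2 finite_subset by blast
  qed
  have c_eq: "\<exists>w. length w = l \<and> W (t # x) w \<and> c (t # x) = card {z. A z (t # x) w}"
    if "length x = j" "X t x" for t x
    using big_ex[of l "W (t # x)"] card that unfolding X_def by force
  have locally: "nearby t (\<lambda>t'. X t' x \<and> c (t' # x) = c (t # x))"
    if x: "length x = j" and t: "X t x" "\<not> B t x" for t x
  proof -
    have 1: "nearby t (\<lambda>t'. X t' x = X t x)"
      using t(2) by (simp add: B_def bd_def)
    obtain w where w: "length w = l" "W (t # x) w" "\<not> bad (\<lambda>t z. A z (t # x) w) t" "nearby t (\<lambda>t. W (t # x) w)"
      using t unfolding B_def by blast
    have "nearby t (\<lambda>t'. card {z. A z (t' # x) w} = card {z. A z (t # x) w})"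
      using fin x w(1,3) by (intro card_locally_constant[of "\<lambda>t z. A z (t # x) w"]) simp_all
    then have "nearby t (\<lambda>t'. (card {z. A z (t' # x) w} = card {z. A z (t # x) w} \<and> W (t' # x) w) \<and> X t' x = X t x)"
      using 1 w(4) by (intro nearby_conj)
    then show ?thesis
      by (rule nearby_mono) (use t(1) x w(1,2) card in auto)
  qed
  \<comment> \<open>The exceptional points form a finite fibre with only \<open>j\<close>
    parameters, and \<open>j\<close> is at most \<open>n\<close>, so their number is
    bounded.\<close>
  obtain N0 where N0: "\<And>x. length x = j \<Longrightarrow> card {t. B t x} \<le> N0"
    using uniformly_finite[of j] Suc.prems(1) finB dB unfolding uniformly_finite_def by fastforce
  define J where "J i t x \<longleftrightarrow> piece i (\<lambda>t. B t x) t" for i t x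
  have dJ: "dsl j (J i)" for i
    unfolding J_def by (intro rslI dpi B') simp_all
  note J' = rslD[OF dJ]
  have const: "X t' x \<and> c (t' # x) = c (t # x)"
    if x: "length x = j" and J: "J i t x" "J i t' x" and X: "X t x" for x i t t'
  proof -
    define S where "S \<tau> \<longleftrightarrow> X \<tau> x \<and> c (\<tau> # x) = c (t # x)" for \<tau>
    \<comment> \<open>The function \<open>c\<close> is arbitrary, but on \<open>X\<close> its value
      is computed from any admissible \<open>w\<close>; this makes \<open>S\<close>
      definable.\<close>
    have S_eq: "S = (\<lambda>\<tau>. X \<tau> x \<and> (\<exists>w. length w = l \<and> W (\<tau> # x) w \<and> card {z. A z (\<tau> # x) w} = c (t # x)))"
    proof
      fix \<tau>
      show "S \<tau> = (X \<tau> x \<and> (\<exists>w. length w = l \<and> W (\<tau> # x) w \<and> card {z. A z (\<tau> # x) w} = c (t # x)))"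
        unfolding S_def using c_eq[OF x, of \<tau>] card[of "\<tau> # x"] x by (metis length_Cons)
    qed
    have "ds S"
      unfolding S_eq
      by (intro dpi X' W' dp_card A') (simp_all add: x fin)
    then obtain P where P: "tames P S"
      using tame by blast
    have bdB: "B q x" if "bd S q" for q
    proof (rule ccontr)
      assume q: "\<not> B q x"
      have "nearby q (\<lambda>q'. S q' = S q)"
      proof (cases "X q x")
        case True
        show ?thesis
          using locally[OF x True q] by (rule nearby_mono) (simp add: S_def True)
      next
        case False
        have "nearby q (\<lambda>q'. X q' x = X q x)"
          using q by (simp add: B_def bd_def)
        then show ?thesis
          by (rule nearby_mono) (simp add: S_def False)
      qed
      with that show False
        by (simp add: bd_def)
    qed
    have "S t' = S t"
    proof (cases "t \<le> t'")
      case True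
      have "S t = S t'"
        using P True by (rule constant_between) (use bdB piece_avoids[OF J[unfolded J_def]] in blast)
      then show ?thesis
        by simp
    next
      case False
      show ?thesis
        using P by (rule constant_between) (use False bdB piece_avoids[OF J(2,1)[unfolded J_def]] in auto)
    qed
    then show ?thesis
      using X by (simp add: S_def)
  qed
  have "\<exists>r. \<forall>x t. length x = j \<and> J i t x \<and> X t x \<longrightarrow> c (t # x) \<le> r" for i
  proof -
    \<comment> \<open>By \<open>const\<close> the value is the same at all points of the piece, so
      an undefinable choice is good enough here.\<close>
    define c' where "c' x = c ((SOME t. J i t x \<and> X t x) # x)" for x
    have c': "c (t # x) = c' x" if "length x = j" "J i t x" "X t x" for t x
    proof -
      have "J i (SOME t. J i t x \<and> X t x) x \<and> X (SOME t. J i t x \<and> X t x) x"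
        using that(2,3) by (intro someI[of "\<lambda>t. J i t x \<and> X t x"]) blast
      then show ?thesis
        using const[OF that(1) _ that(2)] unfolding c'_def by metis
    qed
    define A2 where "A2 z x w = A z (hd w # x) (tl w)" for z x w
    define W2 where "W2 x w \<longleftrightarrow> J i (hd w) x \<and> X (hd w) x \<and> W (hd w # x) (tl w)" for x w
    have dA2: "dsll j (Suc l) A2"
      unfolding A2_def
      by (intro rsllI) (simp add: upt_conv_Cons del: upt_Suc, intro dpi A', simp_all)
    have dW2: "dll j (Suc l) W2"
      unfolding W2_def
      by (intro rllI) (simp add: upt_conv_Cons del: upt_Suc, intro dpi J' X' W', simp_all)
    have "j + Suc l = Suc n"
      using Suc.prems(1) by simp
    moreover have "finite {z. A2 z x w}" if "length x = j" "length w = Suc l" for x w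
      unfolding A2_def using that by (intro fin) simp_all
    moreover have "card {z. A2 z x w} = c' x" if "length x = j" "length w = Suc l" "W2 x w" for x w
      using that card[of "hd w # x" "tl w"] c'[of x "hd w"] unfolding A2_def W2_def by simp
    ultimately obtain r where r: "\<And>x. length x = j \<Longrightarrow> big (Suc l) (W2 x) \<Longrightarrow> c' x \<le> r"
      using Suc.IH[OF _ dA2 dW2, of c'] by blast
    have "c (t # x) \<le> r" if x: "length x = j" and t: "J i t x" "X t x" for x t
    proof -
      \<comment> \<open>After \<open>t\<close> has been moved to \<open>w\<close>, the admissible
        tuples must still be full-dimensional. An interval of the piece to the left of
        \<open>t\<close> provides this.\<close>
      obtain u where u: "u < t" "\<forall>t'. u < t' \<and> t' < t \<longrightarrow> J i t' x"
        using piece_left_open t(1) unfolding J_def by blast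
      have "big l (\<lambda>w. W2 x (t' # w))" if "u < t'" "t' < t" for t'
      proof -
        have "J i t' x" "X t' x"
          using u(2) const[OF x t(1) _ t(2)] that by blast+
        then show ?thesis
          unfolding W2_def by (simp add: X_def)
      qed
      then have "big (Suc l) (W2 x)"
        using u(1) by (auto simp: contains_interval_def)
      then show ?thesis
        using r x c' t by simp
    qed
    then show ?thesis
      by blast
  qed
  then obtain R where R: "\<And>i x t. length x = j \<Longrightarrow> J i t x \<Longrightarrow> X t x \<Longrightarrow> c (t # x) \<le> R i"
    by metis
  \<comment> \<open>At exceptional \<open>t\<close> the induction on \<open>n\<close> applies:
    joining the fibres over the finitely many such \<open>t\<close> removes this coordinate and
    leaves \<open>j + l = n\<close> parameters.\<close>
  define P where "P z s \<longleftrightarrow> (\<exists>t. B t (take j s) \<and> A z (t # take j s) (drop j s))" for z s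
  have n: "n = j + l"
    using Suc.prems(1) by simp
  have "dsl n P"
    unfolding P_def
    by (intro rslI) (simp add: take_map drop_map n del: upt_Suc, intro dpi B' A', simp_all)
  moreover have "finite {z. P z s}" if "length s = n" for s
  proof -
    have "{z. P z s} = (\<Union>t\<in>{t. B t (take j s)}. {z. A z (t # take j s) (drop j s)})"
      unfolding P_def by blast
    then show ?thesis
      using finB[of "take j s"] fin that n by simp
  qed
  moreover have "uniformly_finite n"
    using uniformly_finite by simp
  ultimately obtain r where r: "\<And>s. length s = n \<Longrightarrow> card {z. P z s} \<le> r" and
    finP: "\<And>s. length s = n \<Longrightarrow> finite {z. P z s}"
    unfolding uniformly_finite_def by blast
  have "c y \<le> r + (\<Sum>i\<le>N0. R i)" if y: "length y = Suc j" "big l (W y)" for y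
  proof -
    obtain t x where tx: "y = t # x" "length x = j"
      using y(1) by (auto simp: length_Suc_conv)
    have X: "X t x"
      using y(2) by (simp add: X_def tx)
    show ?thesis
    proof (cases "B t x")
      case True
      obtain w where w: "length w = l" "c (t # x) = card {z. A z (t # x) w}"
        using c_eq[OF tx(2) X] by blast
      have "{z. A z (t # x) w} \<subseteq> {z. P z (x @ w)}"
        unfolding P_def using True tx(2) by auto
      then have "c (t # x) \<le> card {z. P z (x @ w)}"
        unfolding w(2) using tx(2) w(1) n by (intro card_mono finP) simp_all
      also have "\<dots> \<le> r"
        using tx(2) w(1) n by (intro r) simp
      finally show ?thesis
        by (simp add: tx)
    next
      case False
      obtain i where i: "i \<le> N0" "J i t x"
        using piece_cover[OF finB[OF tx(2)] False N0[OF tx(2)]] unfolding J_def by blast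
      have "c (t # x) \<le> R i"
        using R[OF tx(2) i(2) X] .
      also have "R i \<le> (\<Sum>i\<le>N0. R i)"
        using i(1) by (intro member_le_sum) simp_all
      finally show ?thesis
        by (simp add: tx)
    qed
  qed
  then show ?case
    by blast
qed

text \<open>All parameters start in the block \<open>x\<close>, with an empty block
  \<open>w\<close>, for which being \<open>big\<close> is no restriction.\<close>

lemma uniform_finiteness: "uniformly_finite n"
proof (induction n rule: less_induct)
  case (less n)
  show ?case
  proof (cases n)
    case 0
    then show ?thesis
      by (auto simp: uniformly_finite_def)
  next
    case (Suc m)
    show ?thesis
      unfolding uniformly_finite_def
    proof (intro allI impI)
      fix P
      assume P: "dsl n P" "\<forall>s. length s = n \<longrightarrow> finite {z. P z s}"
      note P' = rslD[OF P(1)]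
      have 1: "dsll n 0 (\<lambda>z x w. P z x)"
        by (intro rsllI P' dpi) simp_all
      have 2: "dll n 0 (\<lambda>x w. True)"
        by (intro rllI dpi)
      show "\<exists>r. \<forall>s. length s = n \<longrightarrow> card {z. P z s} \<le> r"
        using fibre_card_bounded[of m n 0, OF _ _ 1 2, of "\<lambda>x. card {z. P z x}"] less P(2) Suc by auto
    qed
  qed
qed

end

section \<open>Passing to an elementary extension\<close>

lemma tmr_nth [dpi]:
  "tupr h C r \<tau> \<tau>' \<Longrightarrow> i < r \<Longrightarrow> tmr h C (\<lambda>e. \<tau> e ! i) (\<lambda>e. \<tau>' e ! i)"
  unfolding tupr_def tmr_def
  by (elim exE conjE, rule_tac x = "vs ! i" in exI) (auto simp: slots_over_def)

lemma dpr_def_set_id: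
  assumes "wf_fm L (n + length c) \<phi>" and "set c \<subseteq> C" and "tupr id C n \<tau> \<tau>"
  shows "dpr L M M id C (\<lambda>e. \<tau> e \<in> def_set M n \<phi> c) (\<lambda>e. \<tau> e \<in> def_set M n \<phi> c)"
  using dpr_def_set[OF assms, of M M] by simp

lemma dpr_bd:
  assumes "dpr L M N h C (\<lambda>e. S (e 0) (\<lambda>i. e (Suc i))) (\<lambda>e. S' (e 0) (\<lambda>i. e (Suc i)))"
  shows "dpr L M N h C (\<lambda>e. bd (\<lambda>x. S x e) (e k)) (\<lambda>e. bd (\<lambda>x. S' x e) (e k))"
proof -
  note 1 = dpr_ren[OF assms, of "case_nat 0 (\<lambda>i. Suc (Suc (Suc i)))"]
  note 2 = dpr_ren[OF assms, of "case_nat (Suc (Suc (Suc k))) (\<lambda>i. Suc (Suc (Suc i)))"]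
  show ?thesis
    unfolding bd_def nearby_def using 1 2 by (intro dpi) simp_all
qed

text \<open>By uniform finiteness the sets defined by one formula have at most \<open>r\<close>
  boundary points in \<open>M\<close>. That \<open>r\<close> points always tame such a set is a
  sentence, and it passes to \<open>N\<close>.\<close>

theorem omin_elementary:
  fixes M :: "('f, 'r, 'a::linorder) struct" and N :: "('f, 'r, 'b::linorder) struct"
  assumes "omin L M" and el: "elementary_embedding L M N h"
  shows "omin L N"
proof -
  interpret M: omin L M
    by fact
  show ?thesis
  proof
    have "dpr L M N h {} (\<lambda>_. \<forall>x y::'a. x < y \<longrightarrow> (\<exists>z. x < z \<and> z < y)) (\<lambda>_. \<forall>x y::'b. x < y \<longrightarrow> (\<exists>z. x < z \<and> z < y))"
      by (intro dpi)
    from elementary_sentence[OF el this] show "\<exists>z. x < z \<and> z < y" if "x < y" for x y :: 'b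
      using M.dense_order that by blast
    have "dpr L M N h {} (\<lambda>_. \<forall>x::'a. \<exists>y. y < x) (\<lambda>_. \<forall>x::'b. \<exists>y. y < x)"
      by (intro dpi)
    from elementary_sentence[OF el this] show "\<exists>y. y < x" for x :: 'b
      using M.no_bot by blast
    have "dpr L M N h {} (\<lambda>_. \<forall>x::'a. \<exists>y. x < y) (\<lambda>_. \<forall>x::'b. \<exists>y. x < y)"
      by (intro dpi)
    from elementary_sentence[OF el this] show "\<exists>y. x < y" for x :: 'b
      using M.no_top by blast
  next
    fix S :: "'b \<Rightarrow> bool"
    assume "dpr L N N id UNIV (\<lambda>e. S (e 0)) (\<lambda>e. S (e 0))"
    then have "dpr L N N id UNIV (\<lambda>e. S (hd (map e [0..<1]))) (\<lambda>e. S (hd (map e [0..<1])))"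
      by simp
    from dpr_definable[OF this] obtain \<phi> c where
      c: "wf_fm L (Suc (length c)) \<phi>" "{x. length x = 1 \<and> S (hd x)} = def_set N 1 \<phi> c"
      by auto
    define m where "m = length c"
    \<comment> \<open>The parameters \<open>c\<close> lie in \<open>N\<close> and make no sense in
      \<open>M\<close>; replacing them by variables \<open>s\<close> gives a family over
      \<open>M\<close> without parameters.\<close>
    define F where "F x s \<longleftrightarrow> x # s \<in> def_set M (Suc m) \<phi> []" for x s
    define F' where "F' x s \<longleftrightarrow> x # s \<in> def_set N (Suc m) \<phi> (map h [])" for x s
    have S: "S x = F' x c" for x
    proof -
      have "S x \<longleftrightarrow> [x] \<in> {x. length x = 1 \<and> S (hd x)}"
        by simp
      also have "\<dots> \<longleftrightarrow> F' x c"
        unfolding c(2) F'_def def_set_def m_def by simp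
      finally show ?thesis .
    qed
    have FF': "rsl L M N h C m F F'" for C
      unfolding F_def F'_def using c(1) m_def by (intro rslI dpr_def_set dpi) simp_all
    have FF: "M.dsl m F"
      unfolding F_def using c(1) m_def by (intro rslI dpr_def_set_id dpi) simp_all
    note F1 = rslD[OF FF] and F2 = rslD[OF FF']
    have "M.dsl m (\<lambda>x s. bd (\<lambda>x. F x s) x)"
      by (intro rslI dpr_bd F1 dpi) simp_all
    moreover have tame: "\<exists>P. tames P (\<lambda>x. F x s)" if "length s = m" for s
      by (rule M.tame) (use that in \<open>intro F1 dpi; simp\<close>)
    then have fin: "finite {x. bd (\<lambda>x. F x s) x}" if "length s = m" for s
      using that M.finite_bd by blast
    ultimately obtain r where r: "\<And>s. length s = m \<Longrightarrow> card {x. bd (\<lambda>x. F x s) x} \<le> r"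
      using M.uniform_finiteness[of m] unfolding M.uniformly_finite_def by blast
    let ?T = "\<lambda>G. \<forall>s. length s = m \<longrightarrow> (\<exists>p. length p = r \<and>
      (\<forall>x y. (\<forall>i<r. (x < p ! i \<longleftrightarrow> y < p ! i) \<and> (p ! i < x \<longleftrightarrow> p ! i < y)) \<longrightarrow> G x s = G y s))"
    have cut: "cut_eq (set p) x y \<longleftrightarrow> (\<forall>i<length p. (x < p ! i \<longleftrightarrow> y < p ! i) \<and> (p ! i < x \<longleftrightarrow> p ! i < y))"
      for p and x y
      unfolding cut_eq_def by (metis in_set_conv_nth nth_mem)
    have cut': "cut_eq (set p) x y \<longleftrightarrow> (\<forall>i<length p. (x < p ! i \<longleftrightarrow> y < p ! i) \<and> (p ! i < x \<longleftrightarrow> p ! i < y))"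
      for p and x y :: 'b
      unfolding cut_eq_def by (metis in_set_conv_nth nth_mem)
    have "?T F"
    proof (intro allI impI)
      fix s :: "'a list"
      assume s: "length s = m"
      let ?P = "{x. bd (\<lambda>x. F x s) x}"
      \<comment> \<open>The sentence speaks of exactly \<open>r\<close> points, so the list is
        padded; additional points only refine the cells.\<close>
      define p where "p = sorted_list_of_set ?P @ replicate (r - card ?P) undefined"
      have p: "length p = r"
        using r[OF s] by (simp add: p_def)
      have "F x s = F y s" if xy: "\<forall>i<r. (x < p ! i \<longleftrightarrow> y < p ! i) \<and> (p ! i < x \<longleftrightarrow> p ! i < y)" for x y
      proof -
        have "cut_eq (set p) x y"
          using xy unfolding cut p .
        moreover have "?P \<subseteq> set p"
          using fin[OF s] by (auto simp: p_def)
        ultimately have "cut_eq ?P x y"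
          by (auto simp: cut_eq_def)
        moreover have "tames ?P (\<lambda>x. F x s)"
          using tame[OF s] M.tames_by_bd by blast
        ultimately show ?thesis
          by (auto simp: tames_def)
      qed
      then show "\<exists>p. length p = r \<and> (\<forall>x y. (\<forall>i<r. (x < p ! i \<longleftrightarrow> y < p ! i) \<and> (p ! i < x \<longleftrightarrow> p ! i < y)) \<longrightarrow> F x s = F y s)"
        using p by blast
    qed
    moreover have "dpr L M N h {} (\<lambda>_. ?T F) (\<lambda>_. ?T F')"
      by (intro dpi F2) simp_all
    then have "?T F = ?T F'"
      by (rule elementary_sentence[OF el])
    ultimately have "?T F'"
      by (rule iffD1[rotated])
    then obtain p where p: "length p = r"
      "\<forall>x y. (\<forall>i<r. (x < p ! i \<longleftrightarrow> y < p ! i) \<and> (p ! i < x \<longleftrightarrow> p ! i < y)) \<longrightarrow> F' x c = F' y c"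
      using m_def by blast
    have "tames (set p) S"
      unfolding tames_def cut' p(1) S using p(2) by simp
    then show "\<exists>P. tames P S"
      by blast
  qed
qed

section \<open>Definable closure and rank\<close>

lemma small_insert:
  assumes "Cinfinite \<kappa>" and "|C| <o \<kappa>" and "finite F"
  shows "|C \<union> F| <o \<kappa>"
proof -
  have "Well_order \<kappa>" "infinite (Field \<kappa>)"
    using assms(1) by (auto simp: cinfinite_def card_order_on_def)
  then have "|F| <o \<kappa>"
    using finite_ordLess_infinite[OF card_of_Well_order] assms(3) by (metis Field_card_of)
  then show ?thesis
    using Un_Cinfinite_bound_strict assms(1,2) by blast
qed

context omin
begin

lemma dcl_iff: "b \<in> dcl L M C \<longleftrightarrow> dp C (\<lambda>e. e 0 = b)"
proof
  assume "b \<in> dcl L M C"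
  then obtain \<phi> c where c: "wf_fm L (1 + length c) \<phi>" "set c \<subseteq> C" "{[b]} = def_set M 1 \<phi> c"
    unfolding dcl_def definable_over_def by auto
  have "dp C (\<lambda>e. [e 0] \<in> def_set M 1 \<phi> c)"
    by (intro dpr_def_set_id[OF c(1,2)] dpi) simp_all
  then show "dp C (\<lambda>e. e 0 = b)"
    unfolding c(3)[symmetric] by simp
next
  assume "dp C (\<lambda>e. e 0 = b)"
  then have "dp C (\<lambda>e. hd (map e [0..<1]) = b)"
    by simp
  from dpr_definable[OF this] obtain \<phi> c where
    c: "wf_fm L (1 + length c) \<phi>" "set c \<subseteq> C" "{x. length x = 1 \<and> hd x = b} = def_set M 1 \<phi> c"
    by auto
  have "{x. length x = 1 \<and> hd x = b} = {[b]}"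
    by (auto simp: length_Suc_conv)
  then show "b \<in> dcl L M C"
    unfolding dcl_def definable_over_def mem_Collect_eq c(3) using c(1,2) by blast
qed

lemma dcl_mono: "C \<subseteq> C' \<Longrightarrow> dcl L M C \<subseteq> dcl L M C'"
  using dpr_mono by (auto simp: dcl_iff)

lemma dcl_self: "c \<in> C \<Longrightarrow> c \<in> dcl L M C"
  unfolding dcl_iff by (intro dpi) simp_all

text \<open>The order tells the points of a finite set apart: each is determined by its
  rank.\<close>

lemma finite_dcl:
  assumes "dp C (\<lambda>e. S (e 0))" and "finite {x. S x}" and "S b"
  shows "b \<in> dcl L M C"
proof -
  obtain i where i: "rk i S b"
    using rk_less_card[OF assms(2,3)] by blast
  have "dp C (\<lambda>e. rk i (\<lambda>x. S x) (e 0))"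
    using assms(1) by (intro dp_rk)
  moreover have "rk i (\<lambda>x. S x) x \<longleftrightarrow> x = b" for x
    using i rk_unique by blast
  ultimately show ?thesis
    unfolding dcl_iff by simp
qed

text \<open>The parameter \<open>d\<close> is turned into a new variable.\<close>

lemma dp_insert:
  assumes "dp (insert d C) P"
  shows "\<exists>Q. dp C (\<lambda>e. Q (e 0) (\<lambda>i. e (Suc i))) \<and> P = Q d"
proof -
  from assms obtain \<phi> vs where
    1: "wf_fm L (length vs) \<phi>" "slots_over (insert d C) (set vs)" "P = (\<lambda>e. sat M (map (slot id e) vs) \<phi>)"
    unfolding dpr_def by blast
  let ?ws = "map (\<lambda>v. case v of Inl k \<Rightarrow> Inl (Suc k) | Inr c \<Rightarrow> if c = d then Inl 0 else Inr c) vs"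
  define Q where "Q x e = sat M (map (slot id (case_nat x e)) ?ws) \<phi>" for x e
  have *: "map (slot id e) vs = map (slot id (case_nat d e)) ?ws" for e
    by (auto simp: slot_def split: sum.splits)
  have "P = Q d"
    by (rule ext) (simp only: 1(3) Q_def *)
  moreover have "slots_over C (set ?ws)"
    using 1(2) by (auto simp: slots_over_def split: sum.splits if_splits)
  then have "dp C (\<lambda>e. sat M (map (slot id e) ?ws) \<phi>)"
    unfolding dpr_def using 1(1) by (intro exI[of _ \<phi>] exI[of _ ?ws]) simp
  then have "dp C (\<lambda>e. Q (e 0) (\<lambda>i. e (Suc i)))"
  proof -
    have "case_nat (e 0) (\<lambda>i. e (Suc i)) = e" for e :: "nat \<Rightarrow> 'a"
      by (auto split: nat.splits)
    then show "dp C (\<lambda>e. sat M (map (slot id e) ?ws) \<phi>) \<Longrightarrow> ?thesis"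
      by (simp only: Q_def)
  qed
  ultimately show ?thesis
    by blast
qed

lemma dcl_insert_trans:
  assumes "b \<in> dcl L M (insert d C)" and "d \<in> dcl L M C"
  shows "b \<in> dcl L M C"
proof -
  from assms(1) obtain Q where Q: "dp C (\<lambda>e. Q (e 0) (\<lambda>i. e (Suc i)))" "(\<lambda>e. e 0 = b) = Q d"
    using dp_insert unfolding dcl_iff by blast
  have "dp C (\<lambda>e. e 0 = d)"
    using assms(2) by (simp add: dcl_iff)
  then have "dp C (\<lambda>e. \<exists>x. x = d \<and> Q x e)"
    using Q(1) by (intro dpr_ex dpr_conj)
  moreover have "(\<exists>x. x = d \<and> Q x e) \<longleftrightarrow> e 0 = b" for e
    using fun_cong[OF Q(2), of e] by simp
  ultimately show ?thesis
    unfolding dcl_iff by simp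
qed

lemma dcl_trans:
  assumes "finite D" and "D \<subseteq> dcl L M C" and "b \<in> dcl L M (C \<union> D)"
  shows "b \<in> dcl L M C"
  using assms
proof (induction D)
  case (insert d D)
  have "d \<in> dcl L M (C \<union> D)"
    using insert.prems(1) dcl_mono[of C "C \<union> D"] by auto
  then have "b \<in> dcl L M (C \<union> D)"
    using insert.prems(2) dcl_insert_trans[of b d "C \<union> D"] by simp
  then show ?case
    using insert by simp
qed simp

text \<open>Let \<open>a\<close> be the value at \<open>b\<close> of a function definable over
  \<open>C\<close>. If its fibre over \<open>a\<close> is finite, then \<open>b\<close> is in the
  closure of \<open>a\<close> and \<open>C\<close>. If not, infinitely many fibres are infinite, and
  \<open>exchange_coordinates\<close> contradicts single-valuedness.\<close>

lemma dcl_exchange: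
  assumes "a \<in> dcl L M (insert b C)" and "a \<notin> dcl L M C"
  shows "b \<in> dcl L M (insert a C)"
proof -
  from assms(1) obtain Q where Q: "dp C (\<lambda>e. Q (e 0) (\<lambda>i. e (Suc i)))" "(\<lambda>e. e 0 = a) = Q b"
    using dp_insert unfolding dcl_iff by blast
  have "dp C (\<lambda>e. Q (e (Suc 0)) (\<lambda>_. e 0))"
    using dpr_ren[OF Q(1), of "case_nat (Suc 0) (\<lambda>_. 0)"] by simp
  then have rQ: "rss L M M id C (\<lambda>x y. Q y (\<lambda>_. x)) (\<lambda>x y. Q y (\<lambda>_. x))"
    by (rule rssI)
  note Q' = rssD[OF rQ]
  \<comment> \<open>\<open>Q\<close> is known to have a unique solution only at \<open>b\<close>;
    uniqueness is built in to obtain a function everywhere.\<close>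
  define f where "f x y \<longleftrightarrow> Q y (\<lambda>_. x) \<and> (\<forall>x'. Q y (\<lambda>_. x') \<longrightarrow> x' = x)" for x y
  have f0: "dp C (\<lambda>e. f (e 0) (e (Suc 0)))"
    unfolding f_def by (intro dpi Q')
  have "Q b (\<lambda>_. x) \<longleftrightarrow> x = a" for x
    using fun_cong[OF Q(2), of "\<lambda>_. x"] by simp
  then have fab: "f a b"
    by (simp add: f_def)
  have dsf: "ds (f x)" for x
    by (rule rssD[OF rssI[OF dpr_mono[OF f0 subset_UNIV]]]) (intro dpi; simp)+
  show ?thesis
  proof (cases "finite {y. f a y}")
    case True
    note f' = rssD[OF rssI[OF dpr_mono[OF f0, of "insert a C"]]]
    have "dp (insert a C) (\<lambda>e. f a (e 0))"
      by (intro f' tmr_const tmr_var) auto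
    then show ?thesis
      using True fab by (rule finite_dcl)
  next
    case False
    note f' = rssD[OF rssI[OF f0]]
    have "dp C (\<lambda>e. contains_interval (f (e 0)))"
      by (intro dpi f')
    moreover have "contains_interval (f a)"
      using False infinite_iff[OF dsf] by blast
    \<comment> \<open>A finite set definable over \<open>C\<close> would put its element
      \<open>a\<close> into the closure of \<open>C\<close>.\<close>
    ultimately have "infinite {x. contains_interval (f x)}"
      using finite_dcl[of C "\<lambda>x. contains_interval (f x)" a] assms(2) by blast
    then have "infinite {x. infinite {y. f x y}}"
      using infinite_iff[OF dsf] by simp
    then obtain y where "infinite {x. f x y}"
      using exchange_coordinates[of f] rssI[OF dpr_mono[OF f0 subset_UNIV]] by blast
    moreover have "finite {x. f x y}"
      by (rule finite_subset[of _ "{SOME x. f x y}"]) (auto simp: f_def intro: someI2)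
    ultimately show ?thesis
      by blast
  qed
qed

section \<open>The dimension of tuples and generic points\<close>

lemma dim_tuple_witness: "\<exists>B\<subseteq>set y. card B = dim_tuple L M C y \<and> set y \<subseteq> dcl L M (C \<union> B)"
proof -
  have "set y \<subseteq> dcl L M (C \<union> set y)"
    using dcl_self by blast
  then have "\<exists>d. \<exists>B\<subseteq>set y. card B = d \<and> set y \<subseteq> dcl L M (C \<union> B)"
    by (intro exI[of _ "card (set y)"] exI[of _ "set y"]) simp
  then show ?thesis
    unfolding dim_tuple_def by (rule LeastI_ex)
qed

lemma dim_tuple_le: "B \<subseteq> set y \<Longrightarrow> set y \<subseteq> dcl L M (C \<union> B) \<Longrightarrow> dim_tuple L M C y \<le> card B"
  unfolding dim_tuple_def by (rule Least_le) blast

lemma dim_tuple_length: "dim_tuple L M C y \<le> length y"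
proof -
  have "set y \<subseteq> dcl L M (C \<union> set y)"
    using dcl_self by blast
  then have "dim_tuple L M C y \<le> card (set y)"
    by (intro dim_tuple_le) simp_all
  then show ?thesis
    using card_length[of y] by simp
qed

lemma dim_tuple_antimono:
  assumes "C \<subseteq> C'"
  shows "dim_tuple L M C' y \<le> dim_tuple L M C y"
proof -
  obtain B where B: "B \<subseteq> set y" "card B = dim_tuple L M C y" "set y \<subseteq> dcl L M (C \<union> B)"
    using dim_tuple_witness[of y C] by blast
  have "set y \<subseteq> dcl L M (C' \<union> B)"
    using B(3) dcl_mono[of "C \<union> B" "C' \<union> B"] assms by blast
  then show ?thesis
    using dim_tuple_le B by metis
qed

text \<open>Steinitz exchange: in a spanning subtuple of least size, one member can be replaced by
  \<open>b\<close>.\<close>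

lemma dim_tuple_insert:
  assumes "b \<notin> dcl L M C" and "b \<in> dcl L M (C \<union> set y)"
  shows "Suc (dim_tuple L M (insert b C) y) \<le> dim_tuple L M C y"
proof -
  obtain B where B: "B \<subseteq> set y" "card B = dim_tuple L M C y" "set y \<subseteq> dcl L M (C \<union> B)"
    using dim_tuple_witness[of y C] by blast
  have fB: "finite B"
    using B(1) finite_subset by blast
  have "b \<in> dcl L M (C \<union> B \<union> set y)"
    using assms(2) dcl_mono[of "C \<union> set y" "C \<union> B \<union> set y"] by blast
  then have "b \<in> dcl L M (C \<union> B)"
    using dcl_trans[of "set y" "C \<union> B" b] B(3) by simp
  \<comment> \<open>Adding the elements of \<open>B\<close> one by one, \<beta> is the one whose
    addition brings \<open>b\<close> into the closure.\<close>
  with fB have "\<exists>B0 \<beta>. \<beta> \<in> B \<and> B0 \<subseteq> B \<and> \<beta> \<notin> B0 \<and> b \<notin> dcl L M (C \<union> B0) \<and> b \<in> dcl L M (insert \<beta> (C \<union> B0))"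
  proof (induction B)
    case empty
    then show ?case
      using assms(1) by simp
  next
    case (insert \<beta> B)
    show ?case
    proof (cases "b \<in> dcl L M (C \<union> B)")
      case True
      then show ?thesis
        using insert.IH by blast
    next
      case False
      then show ?thesis
        using insert.hyps(2) insert.prems by (intro exI[of _ B] exI[of _ \<beta>]) auto
    qed
  qed
  then obtain B0 \<beta> where \<beta>: "\<beta> \<in> B" "B0 \<subseteq> B" "\<beta> \<notin> B0" "b \<notin> dcl L M (C \<union> B0)" "b \<in> dcl L M (insert \<beta> (C \<union> B0))"
    by blast
  have "\<beta> \<in> dcl L M (insert b (C \<union> B0))"
    using dcl_exchange \<beta>(4,5) by blast
  moreover have "insert b (C \<union> B0) \<subseteq> insert b C \<union> (B - {\<beta>})"
    using \<beta> by blast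
  ultimately have 1: "\<beta> \<in> dcl L M (insert b C \<union> (B - {\<beta>}))"
    using dcl_mono by blast
  have "set y \<subseteq> dcl L M (insert b C \<union> (B - {\<beta>}))"
  proof
    fix z
    assume "z \<in> set y"
    then have "z \<in> dcl L M (C \<union> B)"
      using B(3) by blast
    moreover have "C \<union> B \<subseteq> insert \<beta> (insert b C \<union> (B - {\<beta>}))"
      by blast
    ultimately have "z \<in> dcl L M (insert \<beta> (insert b C \<union> (B - {\<beta>})))"
      using dcl_mono by blast
    then show "z \<in> dcl L M (insert b C \<union> (B - {\<beta>}))"
      using 1 by (rule dcl_insert_trans)
  qed
  then have "dim_tuple L M (insert b C) y \<le> card (B - {\<beta>})"
    using B(1) by (intro dim_tuple_le) auto
  also have "Suc (card (B - {\<beta>})) = card B"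
    using fB \<beta>(1) by (rule card_Suc_Diff1)
  finally show ?thesis
    using B(2) by simp
qed

text \<open>The conditions avoid a possibly large closure, but they use only the small parameter set
  \<open>?B\<close>. Finitely many of them are satisfiable because an interval is infinite.\<close>

lemma generic_point:
  assumes sat: "saturated L M \<kappa>" and \<kappa>: "Cinfinite \<kappa>" and C: "|C| <o \<kappa>" and uv: "u < (v::'a)"
  shows "\<exists>x. u < x \<and> x < v \<and> x \<notin> dcl L M C"
proof -
  let ?B = "C \<union> {u, v}"
  define D where "D c = {x. length x = 1 \<and> (u < hd x \<and> hd x < v \<and> hd x \<noteq> c)}" for c
  have "|?B| <o \<kappa>"
    by (rule small_insert[OF \<kappa> C]) simp
  \<comment> \<open>The index \<open>u\<close> keeps the family of conditions nonempty even if the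
    closure of \<open>C\<close> is empty.\<close>
  moreover have "definable_over L M ?B 1 (D c)" if c: "c \<in> insert u (dcl L M C)" for c
  proof -
    have "c \<in> dcl L M ?B"
      using c dcl_self[of u ?B] dcl_mono[of C ?B] by auto
    then have "dp ?B (\<lambda>e. e 0 = c)"
      by (simp add: dcl_iff)
    then have "dp ?B (\<lambda>e. u < e 0 \<and> e 0 < v \<and> e 0 \<noteq> c)"
      by (intro dpr_conj dpr_less dpr_not tmr_var tmr_const) simp_all
    then have "dp ?B (\<lambda>e. (\<lambda>x. u < hd x \<and> hd x < v \<and> hd x \<noteq> c) (map e [0..<1]))"
      by simp
    from dpr_definable[OF this] show ?thesis
      unfolding D_def definable_over_def by auto
  qed
  moreover have "\<Inter>q \<noteq> {}" if q: "q \<subseteq> D ` insert u (dcl L M C)" "finite q" for q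
  proof -
    obtain F where F: "finite F" "q = D ` F"
      using finite_subset_image[OF q(2,1)] by blast
    have "infinite ({x. u < x \<and> x < v} - F)"
      using infinite_interval[OF uv] F(1) by simp
    then have "{x. u < x \<and> x < v} - F \<noteq> {}"
      by (rule infinite_imp_nonempty)
    then obtain x where "u < x" "x < v" "x \<notin> F"
      by blast
    then have "[x] \<in> \<Inter>q"
      unfolding F(2) D_def by auto
    then show ?thesis
      by blast
  qed
  ultimately have "\<Inter>(D ` insert u (dcl L M C)) \<noteq> {}"
    using sat[unfolded saturated_def, rule_format, of ?B "D ` insert u (dcl L M C)"] by fast
  then obtain x where "\<forall>c\<in>insert u (dcl L M C). x \<in> D c"
    by blast
  then have "u < hd x \<and> hd x < v \<and> hd x \<notin> dcl L M C"
    unfolding D_def by auto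
  then show ?thesis
    by blast
qed

text \<open>Each coordinate is generic over the parameters and the earlier coordinates, and so
  contributes one. All tuples \<open>y\<close> containing \<open>x\<close> are covered because the
  box will lie in a projection.\<close>

lemma generic_in_box:
  assumes sat: "saturated L M \<kappa>" and \<kappa>: "Cinfinite \<kappa>"
  shows "|C| <o \<kappa> \<Longrightarrow> length a = length b \<Longrightarrow> open_box a b \<noteq> {} \<Longrightarrow>
    \<exists>x\<in>open_box a b. \<forall>y. set x \<subseteq> set y \<longrightarrow> length a \<le> dim_tuple L M C y"
proof (induction a b arbitrary: C rule: list_induct2')
  case 1
  then show ?case
    by auto
next
  case (4 a as b bs)
  have box: "x # xs \<in> open_box (a # as) (b # bs) \<longleftrightarrow> a < x \<and> x < b \<and> xs \<in> open_box as bs" for x xs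
    unfolding open_box_def by (auto simp: All_less_Suc2)
  obtain z zs where "z # zs \<in> open_box (a # as) (b # bs)"
    using 4(4) unfolding open_box_def by (auto simp: length_Suc_conv)
  then have "a < b" "open_box as bs \<noteq> {}"
    unfolding box by auto
  obtain x where x: "a < x" "x < b" "x \<notin> dcl L M C"
    using generic_point[OF sat \<kappa> 4(2) \<open>a < b\<close>] by blast
  have "|insert x C| <o \<kappa>"
    using small_insert[OF \<kappa> 4(2), of "{x}"] by simp
  then obtain xs where xs: "xs \<in> open_box as bs" "\<forall>y. set xs \<subseteq> set y \<longrightarrow> length as \<le> dim_tuple L M (insert x C) y"
    using 4 \<open>open_box as bs \<noteq> {}\<close> by fastforce
  have "length (a # as) \<le> dim_tuple L M C y" if "set (x # xs) \<subseteq> set y" for y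
  proof -
    have "x \<in> dcl L M (C \<union> set y)"
      using that by (intro dcl_self) auto
    then have "Suc (dim_tuple L M (insert x C) y) \<le> dim_tuple L M C y"
      using x(3) by (intro dim_tuple_insert)
    moreover have "length as \<le> dim_tuple L M (insert x C) y"
      using xs(2) that by simp
    ultimately show ?thesis
      by simp
  qed
  then show ?case
    using x xs(1) box by blast
qed simp_all

lemma dim_set_witness:
  assumes "g \<noteq> {}"
  shows "\<exists>I a b. I \<subseteq> {..<n} \<and> card I = dim_set n g \<and> length a = card I \<and> length b = card I \<and>
    open_box a b \<noteq> {} \<and> open_box a b \<subseteq> (\<lambda>x. nths x I) ` g"
proof -
  let ?D = "{card I | I. I \<subseteq> {..<n} \<and> (\<exists>a b. length a = card I \<and> length b = card I \<and>
    open_box a b \<noteq> {} \<and> open_box a b \<subseteq> (\<lambda>x. nths x I) ` g)}"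
  have "?D \<subseteq> card ` Pow {..<n}"
    by blast
  then have "finite ?D"
    using finite_subset by fastforce
  moreover have "card ({}::nat set) \<in> ?D"
    using assms by (intro CollectI exI[of _ "{}"]) (auto simp: open_box_def)
  then have "?D \<noteq> {}"
    by blast
  ultimately have "dim_set n g \<in> ?D"
    unfolding dim_set_def by (rule Max_in)
  then show ?thesis
    by (smt (verit, best) mem_Collect_eq)
qed

lemma dim_set_le: "g \<noteq> {} \<Longrightarrow> dim_set n g \<le> n"
  using dim_set_witness[of g n] by (metis card_lessThan card_mono finite_lessThan)

text \<open>A generic point of a box in a projection of \<open>g\<close> is lifted to
  \<open>g\<close>.\<close>

lemma generic_in_set:
  assumes sat: "saturated L M \<kappa>" and \<kappa>: "Cinfinite \<kappa>" and C: "|C| <o \<kappa>" and g: "g \<noteq> {}"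
  shows "\<exists>y\<in>g. dim_set n g \<le> dim_tuple L M C y"
proof -
  obtain I a b where I: "card I = dim_set n g" "length a = card I" "length b = card I"
    "open_box a b \<noteq> {}" "open_box a b \<subseteq> (\<lambda>x. nths x I) ` g"
    using dim_set_witness[OF g] by blast
  obtain x where x: "x \<in> open_box a b" "\<forall>y. set x \<subseteq> set y \<longrightarrow> length a \<le> dim_tuple L M C y"
    using generic_in_box[OF sat \<kappa> C _ I(4)] I(2,3) by auto
  obtain y where y: "y \<in> g" "x = nths y I"
    using x(1) I(5) by blast
  then have "length a \<le> dim_tuple L M C y"
    using x(2) set_nths_subset by metis
  then show ?thesis
    using y(1) I(1,2) by auto
qed

text \<open>Both dimensions lie between 0 and \<open>n\<close>, so the maxima range over finite sets
  of integers and bound their members.\<close>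

lemma dim_quotient_bound:
  assumes Y: "\<And>y. y \<in> Y \<Longrightarrow> length y = n" and E: "equiv Y E" and y: "y \<in> Y"
  shows "int (dim_tuple L M A y) - int (dim_set n (E `` {y})) \<le> dim_quotient L M A n Y E"
proof -
  have sub: "g \<subseteq> Y" "g \<noteq> {}" if "g \<in> Y // E" for g
    by (rule in_quotient_imp_subset[OF E that], rule in_quotient_imp_non_empty[OF E that])
  have fin: "finite {int (dim_tuple L M A y) - int (dim_set n g) | y. y \<in> g}" if "g \<in> Y // E" for g
  proof (rule finite_subset)
    show "{int (dim_tuple L M A y) - int (dim_set n g) | y. y \<in> g} \<subseteq> (\<lambda>k. int k - int (dim_set n g)) ` {..n}"
      using Y sub(1)[OF that] dim_tuple_length by fastforce
  qed simp
  have "dim_class L M A n g \<in> {- int n..int n}" if g: "g \<in> Y // E" for g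
  proof -
    have "dim_class L M A n g \<in> {int (dim_tuple L M A y) - int (dim_set n g) | y. y \<in> g}"
      unfolding dim_class_def using fin[OF g] sub(2)[OF g] by (intro Max_in) auto
    then obtain y where "y \<in> g" "dim_class L M A n g = int (dim_tuple L M A y) - int (dim_set n g)"
      by blast
    then show ?thesis
      using dim_set_le[OF sub(2)[OF g], of n] dim_tuple_length[of A y] Y sub(1)[OF g] by fastforce
  qed
  then have "{dim_class L M A n g | g. g \<in> Y // E} \<subseteq> {- int n..int n}"
    by blast
  then have fin': "finite {dim_class L M A n g | g. g \<in> Y // E}"
    using finite_subset by blast
  have g: "E `` {y} \<in> Y // E"
    using y by (rule quotientI)
  have "int (dim_tuple L M A y) - int (dim_set n (E `` {y})) \<le> dim_class L M A n (E `` {y})"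
    unfolding dim_class_def using fin[OF g] equiv_class_self[OF E y] by (intro Max_ge) auto
  also have "\<dots> \<le> dim_quotient L M A n Y E"
    unfolding dim_quotient_def using fin' g by (intro Max_ge) auto
  finally show ?thesis .
qed

end

section \<open>One-dimensional quotients\<close>

text \<open>The finite parameter set is recorded because points of \<open>N\<close> will have to be
  generic over it.\<close>

lemma rl_extend:
  fixes N :: "('f, 'r, 'b::linorder) struct"
  assumes "rl L M M id UNIV q F F"
  shows "\<exists>F' C. finite C \<and> rl L M N h UNIV q F F' \<and> (\<forall>C'. C \<subseteq> C' \<longrightarrow> rl L N N id C' q F' F')"
proof -
  have "dpr L M M id UNIV (\<lambda>e. F (map e [0..<q])) (\<lambda>e. F (map e [0..<q]))"
    by (intro rlD[OF assms] tupr_map) simp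
  from dpr_definable[OF this] obtain \<phi> c where
    c: "wf_fm L (q + length c) \<phi>" "{x. length x = q \<and> F x} = def_set M q \<phi> c"
    by auto
  have F: "F x \<longleftrightarrow> x \<in> def_set M q \<phi> c" if "length x = q" for x
    using c(2) that by blast
  let ?F' = "\<lambda>x. x \<in> def_set N q \<phi> (map h c)"
  have "rl L M N h UNIV q F ?F'"
    by (intro rlI) (simp add: F, intro dpr_def_set[OF c(1)] dpi, simp_all)
  moreover have "rl L N N id C' q ?F' ?F'" if "set (map h c) \<subseteq> C'" for C'
    using c(1) that by (intro rlI dpr_def_set_id dpi) simp_all
  ultimately show ?thesis
    by (intro exI[of _ ?F'] exI[of _ "set (map h c)"]) blast
qed

lemma rsl_extend:
  fixes N :: "('f, 'r, 'b::linorder) struct"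
  assumes "rsl L M M id UNIV q F F"
  shows "\<exists>F' C. finite C \<and> rsl L M N h UNIV q F F' \<and> (\<forall>C'. C \<subseteq> C' \<longrightarrow> rsl L N N id C' q F' F')"
proof -
  have "rl L M M id UNIV (Suc q) (\<lambda>s. F (hd s) (tl s)) (\<lambda>s. F (hd s) (tl s))"
    by (intro rlI) (simp add: upt_conv_Cons del: upt_Suc, intro rslD[OF assms] dpi, simp)
  from rl_extend[OF this, where h = h and N = N] obtain F' C where
    F': "finite C" "rl L M N h UNIV (Suc q) (\<lambda>s. F (hd s) (tl s)) F'" "\<forall>C'. C \<subseteq> C' \<longrightarrow> rl L N N id C' (Suc q) F' F'"
    by blast
  have "rsl L M N h UNIV q F (\<lambda>x s. F' (x # s))"
    using rlD[OF F'(2) tupr_Cons[OF tmr_var tupr_map[of "[0..<q]" q] refl]] by (intro rslI) simp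
  moreover have "rsl L N N id C' q (\<lambda>x s. F' (x # s)) (\<lambda>x s. F' (x # s))" if "C \<subseteq> C'" for C'
    using that F'(3) by (intro rslI rlD[of _ _ _ _ _ "Suc q" F' F'] dpi) auto
  ultimately show ?thesis
    using F'(1) by blast
qed

lemma rsll_extend:
  fixes N :: "('f, 'r, 'b::linorder) struct"
  assumes "rsll L M M id UNIV i q F F"
  shows "\<exists>F' C. finite C \<and> rsll L M N h UNIV i q F F' \<and> (\<forall>C'. C \<subseteq> C' \<longrightarrow> rsll L N N id C' i q F' F')"
proof -
  have "rsl L M M id UNIV (i + q) (\<lambda>x s. F x (take i s) (drop i s)) (\<lambda>x s. F x (take i s) (drop i s))"
    by (intro rslI) (simp add: take_map drop_map del: upt_Suc, intro rsllD[OF assms] dpi, simp_all)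
  from rsl_extend[OF this, where h = h and N = N] obtain F' C where
    F': "finite C" "rsl L M N h UNIV (i + q) (\<lambda>x s. F x (take i s) (drop i s)) F'"
      "\<forall>C'. C \<subseteq> C' \<longrightarrow> rsl L N N id C' (i + q) F' F'"
    by blast
  have "rsll L M N h UNIV i q F (\<lambda>x s t. F' x (s @ t))"
    using rslD[OF F'(2) tmr_var tupr_append[OF tupr_map[of "[0..<i]" i] tupr_map[of "[0..<q]" q] refl]]
    by (intro rsllI) simp
  moreover have "rsll L N N id C' i q (\<lambda>x s t. F' x (s @ t)) (\<lambda>x s t. F' x (s @ t))" if "C \<subseteq> C'" for C'
    using that F'(3) by (intro rsllI rslD[of _ _ _ _ _ "i + q" F' F'] dpi) auto
  ultimately show ?thesis
    using F'(1) by blast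
qed

text \<open>That two formulas define the same set in \<open>M\<close> is a sentence, hence they
  agree in \<open>N\<close>.\<close>

lemma extension_def_set:
  assumes el: "elementary_embedding L M N h" and wf: "wf_fm L (n + length c) \<phi>"
  shows "extension L M N h n (def_set M n \<phi> c) = def_set N n \<phi> (map h c)"
proof -
  have "def_set N n \<phi> (map h c) = def_set N n \<psi> (map h d)"
    if d: "wf_fm L (n + length d) \<psi>" "def_set M n \<phi> c = def_set M n \<psi> d" for \<psi> d
  proof -
    have "dpr L M N h UNIV
        (\<lambda>_. \<forall>x. length x = n \<longrightarrow> (x \<in> def_set M n \<phi> c) = (x \<in> def_set M n \<psi> d))
        (\<lambda>_. \<forall>x. length x = n \<longrightarrow> (x \<in> def_set N n \<phi> (map h c)) = (x \<in> def_set N n \<psi> (map h d)))"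
      using wf d(1) by (intro dpi dpr_def_set) simp_all
    from elementary_sentence[OF el this]
    have "\<forall>x. length x = n \<longrightarrow> (x \<in> def_set N n \<phi> (map h c)) = (x \<in> def_set N n \<psi> (map h d))"
      using d(2) by simp
    then show ?thesis
      by (auto simp: def_set_def)
  qed
  then show ?thesis
    unfolding extension_def using wf by blast
qed

lemma rl_extension:
  assumes el: "elementary_embedding L M N h" and D: "definable L M n D"
  shows "rl L M N h UNIV n (\<lambda>x. x \<in> D) (\<lambda>x. x \<in> extension L M N h n D)"
proof -
  from D obtain \<phi> c where c: "wf_fm L (n + length c) \<phi>" "D = def_set M n \<phi> c"
    unfolding definable_over_def by blast
  show ?thesis
    unfolding c(2) extension_def_set[OF el c(1)]
    by (intro rlI dpr_def_set[OF c(1)] dpi) simp_all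
qed

text \<open>A generic \<open>b\<close>, a \<open>b'\<close> generic over \<open>b\<close>, \<open>a\<close>, and a generic \<open>y\<close> in a class with \<open>G b y\<close> and \<open>H b' a y\<close> would
  give a class of dimension at least 2. The parameters \<open>a\<close>, which may depend on \<open>b\<close>, do no harm as
  they are added only after \<open>b\<close>.\<close>

lemma no_two_dimensional_image:
  fixes M :: "('f, 'r, 'a::linorder) struct" and N :: "('f, 'r, 'b::linorder) struct"
  assumes M: "omin L M" and Y: "definable L M n Y" and E: "equiv Y E" "definable L M (n + n) (rel_set E)"
    and dim: "quotient_has_dim L M N h \<kappa> A n Y E 1"
    and G: "rsl L M M id UNIV n G G" and H: "rsll L M M id UNIV i n H H"
    and finG: "\<And>y. length y = n \<Longrightarrow> finite {b. G b y}"
    and finH: "\<And>a y. length a = i \<Longrightarrow> length y = n \<Longrightarrow> finite {b. H b a y}"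
    and invG: "\<And>y y' b. (y, y') \<in> E \<Longrightarrow> G b y \<Longrightarrow> G b y'"
    and invH: "\<And>y y' a b. (y, y') \<in> E \<Longrightarrow> length a = i \<Longrightarrow> H b a y \<Longrightarrow> H b a y'"
  shows "finite {b. \<exists>a. length a = i \<and> infinite {b'. \<exists>y. length y = n \<and> y \<in> Y \<and> G b y \<and> H b' a y}}"
proof (rule ccontr)
  assume inf: "\<not> ?thesis"
  interpret M: omin L M
    by fact
  let ?YN = "extension L M N h n Y"
  let ?EN = "set_rel n (extension L M N h (n + n) (rel_set E))"
  from dim have el: "elementary_embedding L M N h" and \<kappa>: "Cinfinite \<kappa>" and sat: "saturated L N \<kappa>"
    and A: "|A| <o \<kappa>" and quot: "quotient_over L N A n ?YN ?EN" and dimN: "dim_quotient L N A n ?YN ?EN = 1"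
    unfolding quotient_has_dim_def Let_def by auto
  interpret N: omin L N
    using M el by (rule omin_elementary)
  have YN: "length y = n" if "y \<in> ?YN" for y
    using quot that unfolding quotient_over_def definable_over_def def_set_def by auto
  have EN: "equiv ?YN ?EN"
    using quot by (simp add: quotient_over_def)
  have lenY: "length y = n" if "y \<in> Y" for y
    using Y that unfolding definable_over_def def_set_def by auto
  have lenE: "length y = n \<and> length y' = n" if "(y, y') \<in> E" for y y'
    using E(1) that lenY unfolding equiv_def by blast
  note rY = rlD[OF rl_extension[OF el Y]]
  have E_app: "y @ y' \<in> rel_set E \<longleftrightarrow> (y, y') \<in> E" if y: "length y = n" for y y'
  proof
    assume "y @ y' \<in> rel_set E"
    then obtain x z where "y @ y' = x @ z" "(x, z) \<in> E"
      by (auto simp: rel_set_def)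
    then show "(y, y') \<in> E"
      using lenE[of x z] y by simp
  qed (auto simp: rel_set_def)
  have EN_app: "y @ y' \<in> extension L M N h (n + n) (rel_set E) \<longleftrightarrow> (y, y') \<in> ?EN"
    if "length y = n" "length y' = n" for y y'
    using that unfolding set_rel_def by simp
  have rE: "dpr L M N h UNIV (\<lambda>e. \<tau> e @ \<upsilon> e \<in> rel_set E) (\<lambda>e. \<tau>' e @ \<upsilon>' e \<in> extension L M N h (n + n) (rel_set E))"
    if "tupr h UNIV n \<tau> \<tau>'" "tupr h UNIV n \<upsilon> \<upsilon>'" for \<tau> \<tau>' \<upsilon> \<upsilon>'
    using rlD[OF rl_extension[OF el E(2)] tupr_append[OF that refl]] .
  obtain G' CG where CG: "finite CG" "rsl L M N h UNIV n G G'" "\<forall>C. CG \<subseteq> C \<longrightarrow> rsl L N N id C n G' G'"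
    using rsl_extend[OF G, where h = h and N = N] by blast
  obtain H' CH where CH: "finite CH" "rsll L M N h UNIV i n H H'" "\<forall>C. CH \<subseteq> C \<longrightarrow> rsll L N N id C i n H' H'"
    using rsll_extend[OF H, where h = h and N = N] by blast
  note rG = rslD[OF CG(2)] and rH = rsllD[OF CH(2)]
  note G1 = rslD[OF G] and H1 = rsllD[OF H]
  have dsG: "M.ds (\<lambda>b. G b y)" if "length y = n" for y
    using that by (intro G1 dpi) simp_all
  have dsH: "M.ds (\<lambda>b. H b a y)" if "length a = i" "length y = n" for a y
    using that by (intro H1 dpi) simp_all
  \<comment> \<open>Finiteness is transferred as the absence of an interval, and likewise for
    \<open>H\<close> below.\<close>
  have "(\<forall>y. length y = n \<longrightarrow> \<not> contains_interval (\<lambda>b. G b y)) = (\<forall>y. length y = n \<longrightarrow> \<not> contains_interval (\<lambda>b. G' b y))"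
    by (rule elementary_sentence[OF el, where C = UNIV]) (intro dpi rG; simp)
  then have G'fin: "finite {b. G' b y}" if "length y = n" for y
    using that finG M.infinite_iff[OF dsG] N.infinite_iff[of "\<lambda>b. G' b y"] rslD[OF CG(3)[rule_format, of UNIV], of "\<lambda>e. e 0" "\<lambda>e. e 0" "\<lambda>_. y" "\<lambda>_. y"]
    by (simp add: tmr_var tupr_const)
  have "(\<forall>a. length a = i \<longrightarrow> (\<forall>y. length y = n \<longrightarrow> \<not> contains_interval (\<lambda>b. H b a y))) =
      (\<forall>a. length a = i \<longrightarrow> (\<forall>y. length y = n \<longrightarrow> \<not> contains_interval (\<lambda>b. H' b a y)))"
    by (rule elementary_sentence[OF el, where C = UNIV]) (intro dpi rH; simp)
  then have H'fin: "finite {b. H' b a y}" if "length a = i" "length y = n" for a y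
    using that finH M.infinite_iff[OF dsH] N.infinite_iff[of "\<lambda>b. H' b a y"]
      rsllD[OF CH(3)[rule_format, of UNIV], of "\<lambda>e. e 0" "\<lambda>e. e 0" "\<lambda>_. a" "\<lambda>_. a" "\<lambda>_. y" "\<lambda>_. y"]
    by (simp add: tmr_var tupr_const)
  have "(\<forall>y. length y = n \<longrightarrow> (\<forall>y'. length y' = n \<longrightarrow> y @ y' \<in> rel_set E \<longrightarrow> (\<forall>b. G b y \<longrightarrow> G b y'))) =
      (\<forall>y. length y = n \<longrightarrow> (\<forall>y'. length y' = n \<longrightarrow> y @ y' \<in> extension L M N h (n + n) (rel_set E) \<longrightarrow> (\<forall>b. G' b y \<longrightarrow> G' b y')))"
    by (rule elementary_sentence[OF el, where C = UNIV]) (intro dpi rE rG; simp)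
  moreover have "\<forall>y. length y = n \<longrightarrow> (\<forall>y'. length y' = n \<longrightarrow> y @ y' \<in> rel_set E \<longrightarrow> (\<forall>b. G b y \<longrightarrow> G b y'))"
    using invG E_app by blast
  ultimately have "\<forall>y. length y = n \<longrightarrow> (\<forall>y'. length y' = n \<longrightarrow> y @ y' \<in> extension L M N h (n + n) (rel_set E) \<longrightarrow> (\<forall>b. G' b y \<longrightarrow> G' b y'))"
    by (rule iffD1)
  then have G'inv: "G' b y'" if "(y, y') \<in> ?EN" "G' b y" for y y' b
    using that unfolding set_rel_def by blast
  have "(\<forall>a. length a = i \<longrightarrow> (\<forall>y. length y = n \<longrightarrow> (\<forall>y'. length y' = n \<longrightarrow> y @ y' \<in> rel_set E \<longrightarrow> (\<forall>b. H b a y \<longrightarrow> H b a y')))) =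
      (\<forall>a. length a = i \<longrightarrow> (\<forall>y. length y = n \<longrightarrow> (\<forall>y'. length y' = n \<longrightarrow> y @ y' \<in> extension L M N h (n + n) (rel_set E) \<longrightarrow> (\<forall>b. H' b a y \<longrightarrow> H' b a y'))))"
    by (rule elementary_sentence[OF el, where C = UNIV]) (intro dpi rE rH; simp)
  moreover have "\<forall>a. length a = i \<longrightarrow> (\<forall>y. length y = n \<longrightarrow> (\<forall>y'. length y' = n \<longrightarrow> y @ y' \<in> rel_set E \<longrightarrow> (\<forall>b. H b a y \<longrightarrow> H b a y')))"
    using invH E_app by blast
  ultimately have "\<forall>a. length a = i \<longrightarrow> (\<forall>y. length y = n \<longrightarrow> (\<forall>y'. length y' = n \<longrightarrow> y @ y' \<in> extension L M N h (n + n) (rel_set E) \<longrightarrow> (\<forall>b. H' b a y \<longrightarrow> H' b a y')))"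
    by (rule iffD1)
  then have H'inv: "H' b a y'" if "(y, y') \<in> ?EN" "length a = i" "H' b a y" for y y' a b
    using that unfolding set_rel_def by blast
  obtain \<phi> c where c: "wf_fm L (n + length c) \<phi>" "Y = def_set M n \<phi> c"
    using Y unfolding definable_over_def by blast
  have YM: "rl L M M id UNIV n (\<lambda>y. y \<in> Y) (\<lambda>y. y \<in> Y)"
    unfolding c(2) by (intro rlI dpr_def_set_id[OF c(1)] dpi) simp_all
  note Y1 = rlD[OF YM]
  have "infinite {b'. \<exists>y. length y = n \<and> y \<in> Y \<and> G b y \<and> H b' a y} =
      contains_interval (\<lambda>b'. \<exists>y. length y = n \<and> y \<in> Y \<and> G b y \<and> H b' a y)" if "length a = i" for a b
    by (rule M.infinite_iff) (use that in \<open>intro dpi Y1 G1 H1; simp\<close>)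
  then have "{b. \<exists>a. length a = i \<and> infinite {b'. \<exists>y. length y = n \<and> y \<in> Y \<and> G b y \<and> H b' a y}} =
      {b. \<exists>a. length a = i \<and> contains_interval (\<lambda>b'. \<exists>y. length y = n \<and> y \<in> Y \<and> G b y \<and> H b' a y)}"
    by blast
  then have inf': "infinite {b. \<exists>a. length a = i \<and> contains_interval (\<lambda>b'. \<exists>y. length y = n \<and> y \<in> Y \<and> G b y \<and> H b' a y)}"
    using inf by simp
  have "M.ds (\<lambda>b. \<exists>a. length a = i \<and> contains_interval (\<lambda>b'. \<exists>y. length y = n \<and> y \<in> Y \<and> G b y \<and> H b' a y))"
    by (intro dpi Y1 G1 H1) simp_all
  from iffD1[OF M.infinite_iff[OF this] inf']
  have "contains_interval (\<lambda>b. \<exists>a. length a = i \<and> contains_interval (\<lambda>b'. \<exists>y. length y = n \<and> y \<in> Y \<and> G b y \<and> H b' a y))" .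
  moreover have "contains_interval (\<lambda>b. \<exists>a. length a = i \<and> contains_interval (\<lambda>b'. \<exists>y. length y = n \<and> y \<in> Y \<and> G b y \<and> H b' a y)) =
      contains_interval (\<lambda>b. \<exists>a. length a = i \<and> contains_interval (\<lambda>b'. \<exists>y. length y = n \<and> y \<in> ?YN \<and> G' b y \<and> H' b' a y))"
    by (rule elementary_sentence[OF el, where C = UNIV]) (intro dpi rY rG rH; simp)
  ultimately obtain u v where uv: "u < v" and
    ex: "\<And>b. u < b \<Longrightarrow> b < v \<Longrightarrow> \<exists>a. length a = i \<and> contains_interval (\<lambda>b'. \<exists>y. length y = n \<and> y \<in> ?YN \<and> G' b y \<and> H' b' a y)"
    unfolding contains_interval_def[of "\<lambda>b. \<exists>a. _ a b"] by blast
  let ?A = "A \<union> (CG \<union> CH)"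
  have A': "|?A| <o \<kappa>"
    using CG(1) CH(1) by (intro small_insert[OF \<kappa> A]) simp
  obtain b where b: "u < b" "b < v" "b \<notin> dcl L N ?A"
    using N.generic_point[OF sat \<kappa> A' uv] by blast
  obtain a u' v' where a: "length a = i" "u' < v'" and
    ex': "\<And>b'. u' < b' \<Longrightarrow> b' < v' \<Longrightarrow> \<exists>y. length y = n \<and> y \<in> ?YN \<and> G' b y \<and> H' b' a y"
    using ex[OF b(1,2)] unfolding contains_interval_def by blast
  let ?B = "?A \<union> insert b (set a)"
  have B: "|?B| <o \<kappa>"
    by (intro small_insert[OF \<kappa> A']) simp
  obtain b' where b': "u' < b'" "b' < v'" "b' \<notin> dcl L N ?B"
    using N.generic_point[OF sat \<kappa> B a(2)] by blast
  obtain y0 where y0: "y0 \<in> ?YN" "G' b y0" "H' b' a y0"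
    using ex'[OF b'(1,2)] by blast
  let ?g = "?EN `` {y0}"
  have "?g \<noteq> {}"
    using equiv_class_self[OF EN y0(1)] by blast
  moreover have "|?B \<union> {b'}| <o \<kappa>"
    by (intro small_insert[OF \<kappa> B]) simp
  ultimately obtain y where y: "(y0, y) \<in> ?EN" "dim_set n ?g \<le> dim_tuple L N (?B \<union> {b'}) y"
    using N.generic_in_set[OF sat \<kappa>] by blast
  have yY: "y \<in> ?YN" and yg: "?EN `` {y} = ?g"
    using EN y(1) equiv_class_eq[OF EN y(1)] unfolding equiv_def by blast+
  have Gy: "G' b y" and Hy: "H' b' a y"
    using G'inv H'inv y(1) y0 a(1) by blast+
  have bdcl: "b \<in> dcl L N (?A \<union> set y)"
  proof (rule N.finite_dcl[where S = "\<lambda>b. G' b y"])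
    show "N.dp (?A \<union> set y) (\<lambda>e. G' (e 0) y)"
      using YN[OF yY] by (intro rslD[OF CG(3)[rule_format]] dpi) auto
  qed (use G'fin YN[OF yY] Gy in auto)
  have b'dcl: "b' \<in> dcl L N (?B \<union> set y)"
  proof (rule N.finite_dcl[where S = "\<lambda>b. H' b a y"])
    show "N.dp (?B \<union> set y) (\<lambda>e. H' (e 0) a y)"
      using YN[OF yY] a(1) by (intro rsllD[OF CH(3)[rule_format]] dpi) auto
  qed (use H'fin a(1) YN[OF yY] Hy in auto)
  \<comment> \<open>Adding \<open>b\<close> and later \<open>b'\<close> to the parameters lowers the
    dimension of \<open>y\<close> by one each time, and adding \<open>a\<close> in between cannot
    raise it. So over \<open>A\<close> it exceeds that of the class by two.\<close>
  have "Suc (Suc (dim_set n ?g)) \<le> Suc (Suc (dim_tuple L N (?B \<union> {b'}) y))"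
    using y(2) by simp
  also have "\<dots> \<le> Suc (dim_tuple L N ?B y)"
    using N.dim_tuple_insert[OF b'(3) b'dcl] by simp
  also have "\<dots> \<le> Suc (dim_tuple L N (insert b ?A) y)"
    by (simp, rule N.dim_tuple_antimono) auto
  also have "\<dots> \<le> dim_tuple L N ?A y"
    by (rule N.dim_tuple_insert[OF b(3) bdcl])
  also have "\<dots> \<le> dim_tuple L N A y"
    by (rule N.dim_tuple_antimono) auto
  finally show False
    using N.dim_quotient_bound[OF YN EN yY, of A] dimN yg by simp
qed

context omin
begin

text \<open>The left end of a piece is minus infinity or a point of \<open>B\<close>; there a tame
  set is eventually constant.\<close>

lemma piece_left_germ:
  assumes "tames P T" and "piece j B x0"
  shows "\<exists>t. piece j B t \<and> ((\<forall>x. piece j B x \<and> x \<le> t \<longrightarrow> T x) \<or> (\<forall>x. piece j B x \<and> x \<le> t \<longrightarrow> \<not> T x))"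
proof (cases j)
  case 0
  obtain v where v: "(\<forall>x. x < v \<longrightarrow> T x) \<or> (\<forall>x. x < v \<longrightarrow> \<not> T x)"
    using bot_germ[OF assms(1)] by blast
  obtain t where "t < min v x0"
    using no_bot by blast
  then show ?thesis
    using v assms(2) 0 by (intro exI[of _ t]) auto
next
  case (Suc k)
  then obtain p where p: "rk k B p" "p < x0" "\<forall>q. p < q \<and> q \<le> x0 \<longrightarrow> \<not> B q"
    using assms(2) by auto
  obtain v where v: "p < v" "(\<forall>x. p < x \<and> x < v \<longrightarrow> T x) \<or> (\<forall>x. p < x \<and> x < v \<longrightarrow> \<not> T x)"
    using right_germ[OF assms(1)] by blast
  obtain t where t: "p < t" "t < min v x0"
    using dense_order[of p "min v x0"] p(2) v(1) by auto
  have "piece j B t"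
    unfolding Suc piece.simps using p t by auto
  moreover have "p < x" if "piece j B x" for x
    using that p(1) rk_unique[of k B] unfolding Suc piece.simps by metis
  ultimately show ?thesis
    using v(2) t(2) by (intro exI[of _ t]) auto
qed

lemma piece_left_germs:
  assumes "\<And>T. T \<in> set Ts \<Longrightarrow> \<exists>P. tames P T" and "piece j B x0"
  shows "\<exists>t. piece j B t \<and> (\<forall>T\<in>set Ts. (\<forall>x. piece j B x \<and> x \<le> t \<longrightarrow> T x) \<or> (\<forall>x. piece j B x \<and> x \<le> t \<longrightarrow> \<not> T x))"
  using assms(1)
proof (induction Ts)
  case Nil
  then show ?case
    using assms(2) by auto
next
  case (Cons T Ts)
  obtain t where t: "piece j B t" "\<forall>T\<in>set Ts. (\<forall>x. piece j B x \<and> x \<le> t \<longrightarrow> T x) \<or> (\<forall>x. piece j B x \<and> x \<le> t \<longrightarrow> \<not> T x)"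
    using Cons by auto
  obtain P where "tames P T"
    using Cons.prems by auto
  from piece_left_germ[OF this assms(2)] obtain t' where
    t': "piece j B t'" "(\<forall>x. piece j B x \<and> x \<le> t' \<longrightarrow> T x) \<or> (\<forall>x. piece j B x \<and> x \<le> t' \<longrightarrow> \<not> T x)"
    by blast
  have "piece j B (min t t')"
    using t(1) t'(1) by (simp add: min_def)
  moreover have "(\<forall>x. piece j B x \<and> x \<le> min t t' \<longrightarrow> T x) \<or> (\<forall>x. piece j B x \<and> x \<le> min t t' \<longrightarrow> \<not> T x)"
    using t'(2) by auto
  moreover have "(\<forall>x. piece j B x \<and> x \<le> min t t' \<longrightarrow> T' x) \<or> (\<forall>x. piece j B x \<and> x \<le> min t t' \<longrightarrow> \<not> T' x)"
    if "T' \<in> set Ts" for T'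
    using t(2)[rule_format, OF that] by auto
  ultimately show ?case
    by (intro exI[of _ "min t t'"]) auto
qed

end

text \<open>\<open>R\<close> is a definable equivalence relation on its domain \<open>{y. R y y}\<close> whose quotient has
  dimension at most 1; the last assumption expresses this without dimensions.\<close>

locale one_dim_quotient = omin L M
  for L :: "('f, 'r) lang" and M :: "('f, 'r, 'a::linorder) struct" +
  fixes n :: nat and R :: "'a list \<Rightarrow> 'a list \<Rightarrow> bool"
  assumes R: "dll n n R"
    and R_length: "\<And>y y'. R y y' \<Longrightarrow> length y = n"
    and R_sym: "\<And>y y'. R y y' \<Longrightarrow> R y' y"
    and R_trans: "\<And>y y' y''. R y y' \<Longrightarrow> R y' y'' \<Longrightarrow> R y y''"
    and one_dim: "\<And>G H i. dsl n G \<Longrightarrow> dsll i n H \<Longrightarrow>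
      (\<And>y. length y = n \<Longrightarrow> finite {b. G b y}) \<Longrightarrow>
      (\<And>a y. length a = i \<Longrightarrow> length y = n \<Longrightarrow> finite {b. H b a y}) \<Longrightarrow>
      (\<And>y y' b. R y y' \<Longrightarrow> G b y \<Longrightarrow> G b y') \<Longrightarrow>
      (\<And>y y' a b. R y y' \<Longrightarrow> length a = i \<Longrightarrow> H b a y \<Longrightarrow> H b a y') \<Longrightarrow>
      finite {b. \<exists>a. length a = i \<and> infinite {b'. \<exists>y. length y = n \<and> R y y \<and> G b y \<and> H b' a y}}"
begin

section \<open>Slices of classes and their boundary points\<close>

lemma R_refl: "R y y' \<Longrightarrow> R y y"
  using R_sym R_trans by blast

definition meets :: "nat \<Rightarrow> 'a list \<Rightarrow> 'a list \<Rightarrow> bool" where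
  "meets i a y \<longleftrightarrow> (\<exists>w. length w = n - i \<and> R y (a @ w))"

text \<open>This is the set S(y) for the prefix \<open>a\<close>; it depends on \<open>y\<close>
  only through its class.\<close>

definition slice :: "nat \<Rightarrow> 'a list \<Rightarrow> 'a list \<Rightarrow> 'a \<Rightarrow> bool" where
  "slice i a y x \<longleftrightarrow> meets (Suc i) (a @ [x]) y"

definition Bd :: "nat \<Rightarrow> 'a \<Rightarrow> 'a list \<Rightarrow> 'a list \<Rightarrow> bool" where
  "Bd i b a y \<longleftrightarrow> bd (slice i a y) b"

lemma meets_slice:
  assumes "i < n" and "meets i a y"
  shows "\<exists>x. slice i a y x"
proof -
  obtain w where w: "length w = n - i" "R y (a @ w)"
    using assms(2) by (auto simp: meets_def)
  then obtain x w' where "w = x # w'"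
    using assms(1) by (cases w) auto
  then show ?thesis
    using w unfolding slice_def meets_def by (intro exI[of _ x] exI[of _ w']) auto
qed

lemma slice_cong: "R y y' \<Longrightarrow> slice i a y = slice i a y'"
  unfolding slice_def meets_def using R_sym R_trans by blast

lemma dsll_slice: "i < n \<Longrightarrow> dsll i n (\<lambda>x a y. slice i a y x)"
  unfolding slice_def meets_def by (intro rsllI dpi rllD[OF R]) (simp_all, arith)

lemma dsll_Bd: "i < n \<Longrightarrow> dsll i n (Bd i)"
  unfolding Bd_def by (intro rsllI dpr_bd dpi rsllD[OF dsll_slice]) simp_all

lemma tame_slice:
  assumes "i < n" and "length a = i" and "length y = n"
  shows "\<exists>P. tames P (slice i a y)"
  by (rule tame) (use assms in \<open>intro rsllD[OF dsll_slice] dpi; simp\<close>)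

lemma finite_Bd: "i < n \<Longrightarrow> length a = i \<Longrightarrow> length y = n \<Longrightarrow> finite {b. Bd i b a y}"
  unfolding Bd_def using tame_slice finite_bd by blast

lemma Bd_cong: "R y y' \<Longrightarrow> Bd i b a y = Bd i b a y'"
  unfolding Bd_def using slice_cong by simp

text \<open>If all the sets of boundary points are finite, each class is determined by finitely many bits:
  a class meets one of the finitely many boundary points or contains the left end of one of the
  pieces between them, and there the recursively obtained bits apply.\<close>

lemma finite_quotient_separators:
  assumes Z: "dsl n Z" and ZR: "\<And>p y. Z p y \<Longrightarrow> R y y"
    and fin: "\<And>p j a. j < n \<Longrightarrow> length a = j \<Longrightarrow> finite {b. \<exists>y. length y = n \<and> Z p y \<and> Bd j b a y}"
  shows "i \<le> n \<Longrightarrow> \<exists>Ds. (\<forall>D\<in>set Ds. dsll i n D \<and> (\<forall>p a y y'. length a = i \<longrightarrow> R y y' \<longrightarrow> D p a y = D p a y')) \<and>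
    (\<forall>p a y y'. length a = i \<longrightarrow> Z p y \<longrightarrow> Z p y' \<longrightarrow> meets i a y \<longrightarrow> meets i a y' \<longrightarrow>
      (\<forall>D\<in>set Ds. D p a y = D p a y') \<longrightarrow> R y y')"
proof (induction "n - i" arbitrary: i)
  case 0
  have "R y y'" if "meets i a y" "meets i a y'" for a y y'
  proof -
    have "R y a" "R y' a"
      using that 0 by (simp_all add: meets_def)
    then show ?thesis
      using R_sym R_trans by blast
  qed
  then show ?case
    by (intro exI[of _ "[]"]) auto
next
  case (Suc m)
  then have i: "i < n"
    by simp
  have "m = n - Suc i" "Suc i \<le> n"
    using Suc.hyps(2) i by simp_all
  from Suc.hyps(1)[OF this] obtain Ds where Ds:
    "\<forall>D\<in>set Ds. dsll (Suc i) n D \<and> (\<forall>p a y y'. length a = Suc i \<longrightarrow> R y y' \<longrightarrow> D p a y = D p a y')"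
    "\<forall>p a y y'. length a = Suc i \<longrightarrow> Z p y \<longrightarrow> Z p y' \<longrightarrow> meets (Suc i) a y \<longrightarrow> meets (Suc i) a y' \<longrightarrow>
      (\<forall>D\<in>set Ds. D p a y = D p a y') \<longrightarrow> R y y'"
    by (elim exE conjE) (rule that)
  have D: "\<And>D. D \<in> set Ds \<Longrightarrow> dsll (Suc i) n D"
      "\<And>D p a y y'. D \<in> set Ds \<Longrightarrow> length a = Suc i \<Longrightarrow> R y y' \<Longrightarrow> D p a y = D p a y'"
    using Ds(1)[THEN bspec] by simp_all
  have sep: "\<And>p a y y'. length a = Suc i \<Longrightarrow> Z p y \<Longrightarrow> Z p y' \<Longrightarrow> meets (Suc i) a y \<Longrightarrow> meets (Suc i) a y' \<Longrightarrow>
      (\<forall>D\<in>set Ds. D p a y = D p a y') \<Longrightarrow> R y y'"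
    using Ds(2)[rule_format] by simp
  note slice' = rsllD[OF dsll_slice[OF i]] and Bd' = rsllD[OF dsll_Bd[OF i]] and Z' = rslD[OF Z]
  define P where "P p a b \<longleftrightarrow> (\<exists>y. length y = n \<and> Z p y \<and> Bd i b a y)" for p a b
  have finP: "finite {b. P p a b}" if "length a = i" for p a
    unfolding P_def using fin[OF i that] .
  have rP: "dp UNIV (\<lambda>e. P (e k) (\<tau> e) (e k'))" if "tupr id UNIV i \<tau> \<tau>" for \<tau> k k'
  proof -
    have "rsll L M M id UNIV (Suc 0) i (\<lambda>b p a. P (hd p) a b) (\<lambda>b p a. P (hd p) a b)"
      unfolding P_def by (intro rsllI) (simp, intro dpi Bd' Z', simp_all)
    from rsllD[OF this tmr_var[of _ _ k'] tupr_Cons[OF tmr_var[of _ _ k] tupr_Nil[OF refl] refl] that]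
    show ?thesis
      by simp
  qed
  have "dsl (Suc i) (\<lambda>b s. P (hd s) (tl s) b)"
    by (intro rslI) (simp add: upt_conv_Cons del: upt_Suc, intro rP dpi, simp)
  then obtain r where r: "\<And>s. length s = Suc i \<Longrightarrow> card {b. P (hd s) (tl s) b} \<le> r"
    using uniform_finiteness[of "Suc i"] finP unfolding uniformly_finite_def by fastforce
  have cardP: "card {b. P p a b} \<le> r" if "length a = i" for p a
    using r[of "p # a"] that by simp
  \<comment> \<open>With this trivial bit, \<open>D1\<close> and \<open>D2\<close> record whether
    the slice itself contains the boundary point or the left end of the piece.\<close>
  let ?T = "\<lambda>_ _ _. True"
  define D1 where "D1 j D p a y \<longleftrightarrow> (\<exists>x. rk j (\<lambda>b. P p a b) x \<and> slice i a y x \<and> D p (a @ [x]) y)" for j D p a y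
  \<comment> \<open>No point of a piece can be chosen definably, but the value of a bit near the
    left end of the piece is canonical.\<close>
  define D2 where "D2 j D p a y \<longleftrightarrow> (\<exists>t. piece j (\<lambda>b. P p a b) t \<and>
      (\<forall>x. piece j (\<lambda>b. P p a b) x \<and> x \<le> t \<longrightarrow> slice i a y x \<and> D p (a @ [x]) y))" for j D p a y
  define Ds' where "Ds' = concat (map (\<lambda>j. map (D1 j) (?T # Ds) @ map (D2 j) (?T # Ds)) [0..<Suc r])"
  have in_Ds': "D1 j D \<in> set Ds'" "D2 j D \<in> set Ds'" if "j \<le> r" "D \<in> set (?T # Ds)" for j D
    using that unfolding Ds'_def by (auto simp del: upt_Suc)
  have DT: "dsll (Suc i) n D" if "D \<in> set (?T # Ds)" for D
  proof (cases "D \<in> set Ds")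
    case True
    then show ?thesis
      by (rule D(1))
  next
    case False
    then show ?thesis
      using that by (auto intro: rsllI dpr_const)
  qed
  have dD1: "dsll i n (D1 j D)" and dD2: "dsll i n (D2 j D)" if D': "D \<in> set (?T # Ds)" for j D
  proof -
    note D'' = rsllD[OF DT[OF D']]
    show "dsll i n (D1 j D)"
      by (rule rsllI, unfold D1_def, intro dpi rP slice' D'') (simp_all, simp_all)
    show "dsll i n (D2 j D)"
      by (rule rsllI, unfold D2_def, intro dpi rP slice' D'') (simp_all, simp_all)
  qed
  have inv: "D1 j D p a y = D1 j D p a y'" "D2 j D p a y = D2 j D p a y'"
    if D': "D \<in> set (?T # Ds)" and *: "length a = i" "R y y'" for j D p a y y'
  proof -
    have "D p (a @ [x]) y = D p (a @ [x]) y'" for x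
      using D(2)[of D "a @ [x]" y y' p] D' * by auto
    then show "D1 j D p a y = D1 j D p a y'" "D2 j D p a y = D2 j D p a y'"
      unfolding D1_def D2_def using slice_cong[OF *(2)] by simp_all
  qed
  have good: "dsll i n D \<and> (\<forall>p a y y'. length a = i \<longrightarrow> R y y' \<longrightarrow> D p a y = D p a y')" if D': "D \<in> set Ds'" for D
  proof -
    obtain j D0 where "D0 \<in> set (?T # Ds)" "D = D1 j D0 \<or> D = D2 j D0"
      using D' unfolding Ds'_def by (auto simp del: upt_Suc)
    then show ?thesis
      using dD1 dD2 inv by blast
  qed
  have "R y y'" if a: "length a = i" and y: "Z p y" "Z p y'" "meets i a y" "meets i a y'"
    and eq: "\<forall>D\<in>set Ds'. D p a y = D p a y'" for p a y y'
  proof -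
    note ly = R_length[OF ZR[OF y(1)]] R_length[OF ZR[OF y(2)]]
    have D1_eq: "D1 j D p a y = D1 j D p a y'" and D2_eq: "D2 j D p a y = D2 j D p a y'"
      if "j \<le> r" "D \<in> set (?T # Ds)" for j D
      using eq in_Ds'[OF that] by blast+
    have concl: "R y y'" if x: "slice i a y x" "slice i a y' x" "\<forall>D\<in>set Ds. D p (a @ [x]) y = D p (a @ [x]) y'" for x
      using x a y by (intro sep[of "a @ [x]" p]) (auto simp: slice_def)
    obtain x where x: "slice i a y x"
      using meets_slice[OF i y(3)] by blast
    show ?thesis
    proof (cases "P p a x")
      case True
      obtain j where j: "j < card {b. P p a b}" "rk j (P p a) x"
        using rk_less_card[OF finP[OF a] True] by blast
      then have jr: "j \<le> r"
        using cardP[OF a, of p] by simp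
      have D1_iff: "D1 j D p a z \<longleftrightarrow> slice i a z x \<and> D p (a @ [x]) z" for D z
        unfolding D1_def using j(2) rk_unique[of j "P p a"] by blast
      have "slice i a y' x"
        using D1_eq[OF jr, of ?T] x unfolding D1_iff by simp
      moreover have "\<forall>D\<in>set Ds. D p (a @ [x]) y = D p (a @ [x]) y'"
        using D1_eq[OF jr] x \<open>slice i a y' x\<close> unfolding D1_iff by simp
      ultimately show ?thesis
        using concl x by blast
    next
      case False
      obtain j where jr: "j \<le> r" and jx: "piece j (P p a) x"
        using piece_cover[OF finP[OF a] False cardP[OF a]] by blast
      \<comment> \<open>All boundary points of slices of classes in \<open>Z p\<close> belong to
        \<open>P p a\<close>, so no slice changes inside a piece.\<close>
      have const: "slice i a z s = slice i a z t"
        if z: "Z p z" and st: "piece j (P p a) s" "piece j (P p a) t" "s \<le> t" for z s t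
      proof -
        have lz: "length z = n"
          using R_length[OF ZR[OF z]] .
        have "P p a b" if "bd (slice i a z) b" for b
          unfolding P_def Bd_def using lz z that by blast
        then show ?thesis
          using tame_slice[OF i a lz] constant_between[of _ "slice i a z" s t] piece_avoids[OF st(1,2)] st(3) by blast
      qed
      have const': "slice i a z t" if "Z p z" "piece j (P p a) s" "piece j (P p a) t" "slice i a z s" for z s t
        using const[OF that(1), of s t] const[OF that(1), of t s] that by (cases "s \<le> t") auto
      have all: "slice i a y t" if "piece j (P p a) t" for t
        using const'[OF y(1) jx that x] .
      have "D2 j ?T p a y"
        unfolding D2_def using jx all by blast
      then have "D2 j ?T p a y'"
        using D2_eq[OF jr] by simp
      then have all': "slice i a y' t" if "piece j (P p a) t" for t
        unfolding D2_def using const'[OF y(2) _ that] by blast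
      \<comment> \<open>Unlike the slices, the bits may change inside the piece. These finitely many
        sets are all constant near its left end, and one point \<open>t\<close> there serves for
        both \<open>y\<close> and \<open>y'\<close>.\<close>
      define Ts where "Ts = map (\<lambda>D x. D p (a @ [x]) y) Ds @ map (\<lambda>D x. D p (a @ [x]) y') Ds"
      have tame_Ts: "\<exists>P. tames P T" if T: "T \<in> set Ts" for T
      proof -
        obtain D z where D': "D \<in> set Ds" "length z = n" "T = (\<lambda>x. D p (a @ [x]) z)"
          using T ly unfolding Ts_def by auto
        note D'' = rsllD[OF D(1)[OF D'(1)]]
        have "ds (\<lambda>x. D p (a @ [x]) z)"
          by (intro dpi D'') (use a D'(2) in \<open>simp_all, simp_all?\<close>)
        then show ?thesis
          unfolding D'(3) by (rule tame)
      qed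
      have "\<exists>t. piece j (P p a) t \<and> (\<forall>T\<in>set Ts. (\<forall>x. piece j (P p a) x \<and> x \<le> t \<longrightarrow> T x) \<or>
          (\<forall>x. piece j (P p a) x \<and> x \<le> t \<longrightarrow> \<not> T x))"
        by (rule piece_left_germs[OF _ jx]) (rule tame_Ts)
      then obtain t where t: "piece j (P p a) t" and
        germ': "\<forall>T\<in>set Ts. (\<forall>x. piece j (P p a) x \<and> x \<le> t \<longrightarrow> T x) \<or> (\<forall>x. piece j (P p a) x \<and> x \<le> t \<longrightarrow> \<not> T x)"
        by (elim exE conjE) (rule that)
      note germ = germ'[THEN bspec]
      have D2_iff: "D2 j D p a z \<longleftrightarrow> D p (a @ [t]) z"
        if T: "(\<lambda>x. D p (a @ [x]) z) \<in> set Ts" and sl: "\<And>t. piece j (P p a) t \<Longrightarrow> slice i a z t" for D z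
      proof
        assume "D2 j D p a z"
        then obtain t' where t': "piece j (P p a) t'" "\<forall>x. piece j (P p a) x \<and> x \<le> t' \<longrightarrow> D p (a @ [x]) z"
          unfolding D2_def by blast
        have "piece j (P p a) (min t t')"
          using t t'(1) by (simp add: min_def)
        then have "D p (a @ [min t t']) z"
          using t'(2) by simp
        then show "D p (a @ [t]) z"
          using germ[OF T] t \<open>piece j (P p a) (min t t')\<close> by (meson min.cobounded1 order_refl)
      next
        assume "D p (a @ [t]) z"
        then have "\<forall>x. piece j (P p a) x \<and> x \<le> t \<longrightarrow> D p (a @ [x]) z"
          using germ[OF T] t by blast
        then show "D2 j D p a z"
          unfolding D2_def using t sl by blast
      qed
      have "\<forall>D\<in>set Ds. D p (a @ [t]) y = D p (a @ [t]) y'"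
      proof
        fix D
        assume D': "D \<in> set Ds"
        then have T: "(\<lambda>x. D p (a @ [x]) y) \<in> set Ts" "(\<lambda>x. D p (a @ [x]) y') \<in> set Ts"
          unfolding Ts_def by auto
        show "D p (a @ [t]) y = D p (a @ [t]) y'"
          using D2_iff[of D y] D2_iff[of D y'] T all all' D2_eq[OF jr, of D] D' by simp
      qed
      then show ?thesis
        using concl all[OF t] all'[OF t] by blast
    qed
  qed
  then show ?case
    using good by (intro exI[of _ Ds']) blast
qed

section \<open>Separating classes by finitely many invariant functions\<close>

definition invariant_function :: "('a list \<Rightarrow> 'a) \<Rightarrow> bool" where
  "invariant_function g \<longleftrightarrow> dsl n (\<lambda>b y. g y = b) \<and> (\<forall>y y'. R y y' \<longrightarrow> g y = g y')"

definition separable :: "('a list \<Rightarrow> bool) \<Rightarrow> bool" where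
  "separable Z \<longleftrightarrow> (\<exists>gs. (\<forall>g\<in>set gs. invariant_function g) \<and>
     (\<forall>y y'. Z y \<longrightarrow> Z y' \<longrightarrow> (\<forall>g\<in>set gs. g y = g y') \<longrightarrow> R y y'))"

lemma ex_two: "\<exists>c0 c1 :: 'a. c0 \<noteq> c1"
  using no_top by (metis less_irrefl)

lemma invariant_indicator:
  assumes Z: "dl n Z" and inv: "\<And>y y'. R y y' \<Longrightarrow> Z y = Z y'"
  shows "invariant_function (\<lambda>y. if Z y then c1 else c0)"
proof -
  have *: "((if Z y then c1 else c0) = b) \<longleftrightarrow> (Z y \<and> b = c1 \<or> \<not> Z y \<and> b = c0)" for y and b :: 'a
    by auto
  have "dsl n (\<lambda>b y. (if Z y then c1 else c0) = b)"
    unfolding * by (intro rslI dpi rlD[OF Z]) simp_all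
  then show ?thesis
    unfolding invariant_function_def using inv by simp
qed

text \<open>One more function, the indicator of \<open>Z1\<close>, decides which list separates a
  given pair; its two values are parameters.\<close>

lemma separable_Un:
  assumes "separable Z1" and "separable Z2" and Z1: "dl n Z1" "\<And>y y'. R y y' \<Longrightarrow> Z1 y = Z1 y'"
  shows "separable (\<lambda>y. Z1 y \<or> Z2 y)"
proof -
  obtain gs1 where 1: "\<forall>g\<in>set gs1. invariant_function g"
    "\<And>y y'. Z1 y \<Longrightarrow> Z1 y' \<Longrightarrow> (\<forall>g\<in>set gs1. g y = g y') \<Longrightarrow> R y y'"
    using assms(1) unfolding separable_def by blast
  obtain gs2 where 2: "\<forall>g\<in>set gs2. invariant_function g"
    "\<And>y y'. Z2 y \<Longrightarrow> Z2 y' \<Longrightarrow> (\<forall>g\<in>set gs2. g y = g y') \<Longrightarrow> R y y'"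
    using assms(2) unfolding separable_def by blast
  obtain c0 c1 :: 'a where c: "c0 \<noteq> c1"
    using ex_two by blast
  let ?g = "\<lambda>y. if Z1 y then c1 else c0"
  have "invariant_function ?g"
    using Z1 by (rule invariant_indicator)
  then have "\<forall>g\<in>set (?g # gs1 @ gs2). invariant_function g"
    using 1(1) 2(1) by auto
  moreover have "R y y'" if y: "Z1 y \<or> Z2 y" "Z1 y' \<or> Z2 y'" and g: "\<forall>g\<in>set (?g # gs1 @ gs2). g y = g y'" for y y'
  proof -
    have "?g y = ?g y'"
      using g by simp
    then have "Z1 y = Z1 y'"
      using c by (auto split: if_splits)
    then show ?thesis
      using y g 1(2) 2(2) by auto
  qed
  ultimately show ?thesis
    unfolding separable_def by blast
qed

lemma separable_UN:
  assumes "finite S" and "\<And>s. s \<in> S \<Longrightarrow> separable (Z s)" and "\<And>s. s \<in> S \<Longrightarrow> dl n (Z s)"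
    and "\<And>s y y'. s \<in> S \<Longrightarrow> R y y' \<Longrightarrow> Z s y = Z s y'"
  shows "separable (\<lambda>y. \<exists>s\<in>S. Z s y)"
  using assms
proof (induction S)
  case empty
  then show ?case
    by (auto simp: separable_def intro!: exI[of _ "[]"])
next
  case (insert s S)
  have "separable (\<lambda>y. Z s y \<or> (\<exists>s\<in>S. Z s y))"
  proof (rule separable_Un)
    show "separable (Z s)" "dl n (Z s)" "\<And>y y'. R y y' \<Longrightarrow> Z s y = Z s y'"
      using insert.prems by blast+
    show "separable (\<lambda>y. \<exists>s\<in>S. Z s y)"
      using insert.prems by (intro insert.IH) blast+
  qed
  then show ?case
    by simp
qed

lemma separable_mono: "separable Z \<Longrightarrow> (\<And>y. Z' y \<Longrightarrow> Z y) \<Longrightarrow> separable Z'"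
  unfolding separable_def by meson

lemma ds_finite: "finite S \<Longrightarrow> rs L M M id UNIV (\<lambda>x. x \<in> S) (\<lambda>x. x \<in> S)"
proof (induction S rule: finite_induct)
  case empty
  then show ?case
    by (intro rsI) (simp, intro dpi)
next
  case (insert s S)
  note S' = rsD[OF insert.IH]
  show ?case
    unfolding insert_iff by (intro rsI dpi S') simp_all
qed

text \<open>A finite set cuts the line into finitely many cells; the representatives become
  additional parameters.\<close>

lemma ex_cut_representatives: "finite Q \<Longrightarrow> \<exists>S. finite S \<and> (\<forall>x::'a. \<exists>s\<in>S. cut_eq Q x s)"
proof -
  assume Q: "finite Q"
  define t where "t x = ({p\<in>Q. x < p}, {p\<in>Q. p < x})" for x :: 'a
  have "range t \<subseteq> Pow Q \<times> Pow Q"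
    unfolding t_def by auto
  then have "finite (range t)"
    using Q finite_subset by blast
  then have "finite (inv t ` range t)"
    by simp
  moreover have "cut_eq Q x (inv t (t x))" for x
  proof -
    have "t (inv t (t x)) = t x"
      by (simp add: f_inv_into_f)
    then show ?thesis
      unfolding t_def cut_eq_def by auto
  qed
  ultimately show ?thesis
    by blast
qed

text \<open>Induction on the number of coordinates not yet fixed. When the prefix has full length,
  it is itself an element of every class considered, so there is at most one class.\<close>

lemma separable_prefix:
  "i \<le> n \<Longrightarrow> length a0 = i \<Longrightarrow> dl n Z0 \<Longrightarrow> (\<And>y. Z0 y \<Longrightarrow> R y y) \<Longrightarrow>
   (\<And>y y'. R y y' \<Longrightarrow> Z0 y = Z0 y') \<Longrightarrow> (\<And>y. Z0 y \<Longrightarrow> meets i a0 y) \<Longrightarrow> separable Z0"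
proof (induction "n - i" arbitrary: i a0 Z0)
  case 0
  then have "R y y'" if "Z0 y" "Z0 y'" for y y'
  proof -
    have "meets i a0 y" "meets i a0 y'"
      using 0 that by blast+
    then have "R y a0" "R y' a0"
      using 0(1) by (simp_all add: meets_def)
    then show ?thesis
      using R_sym R_trans by blast
  qed
  then show ?case
    unfolding separable_def by (intro exI[of _ "[]"]) auto
next
  case (Suc m)
  note a0 = Suc.prems(2) and Z0R = Suc.prems(4) and Z0_cong = Suc.prems(5) and Z0_meets = Suc.prems(6)
  from Suc have i: "i < n"
    by simp
  note Z0' = rlD[OF Suc.prems(3)] and Bd' = rsllD[OF dsll_Bd] and slice' = rsllD[OF dsll_slice]
  define P where "P b y \<longleftrightarrow> Bd i b a0 y" for b y
  have "dsl n P"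
    unfolding P_def using i a0 by (intro rslI Bd' dpi) simp_all
  note dP = this and P' = rslD[OF this]
  have P_cong: "P b y = P b y'" if "R y y'" for b y y'
    unfolding P_def using Bd_cong[OF that] .
  have finP: "finite {b. P b y}" if "length y = n" for y
    unfolding P_def using finite_Bd[OF i a0 that] .
  \<comment> \<open>Here \<open>p\<close> is exceptional if the classes with \<open>p\<close> on the
    boundary of their slice yield, for some prefix, infinitely many boundary points. For each
    \<open>j\<close> the set of these \<open>p\<close> is finite by \<open>one_dim\<close> with
    \<open>G = P\<close> and \<open>H = Bd j\<close>.\<close>
  define Q where "Q = (\<Union>j<n. {p. \<exists>a. length a = j \<and> infinite {b. \<exists>y. length y = n \<and> R y y \<and> P p y \<and> Bd j b a y}})"
  have "finite {p. \<exists>a. length a = j \<and> infinite {b. \<exists>y. length y = n \<and> R y y \<and> P p y \<and> Bd j b a y}}" if "j < n" for j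
    using dP dsll_Bd[OF that] finP finite_Bd[OF that] by (rule one_dim) (use P_cong Bd_cong in blast)+
  then have finQ: "finite Q"
    unfolding Q_def by blast
  note Q' = rsD[OF ds_finite[OF finQ]]
  define Z1 where "Z1 y \<longleftrightarrow> Z0 y \<and> (\<exists>p. P p y \<and> p \<notin> Q)" for y
  define Z2 where "Z2 y \<longleftrightarrow> Z0 y \<and> (\<forall>p. P p y \<longrightarrow> p \<in> Q)" for y
  have dZ1: "dl n Z1" and dZ2: "dl n Z2"
    unfolding Z1_def Z2_def by (intro rlI dpi Z0' P' Q'; simp)+
  have Z1_cong: "Z1 y = Z1 y'" and Z2_cong: "Z2 y = Z2 y'" if "R y y'" for y y'
    unfolding Z1_def Z2_def using P_cong[OF that] Z0_cong[OF that] by simp_all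

  have "separable Z1"
  proof -
    obtain c0 c1 :: 'a where c: "c0 \<noteq> c1"
      using ex_two by blast
    define Z where "Z p y \<longleftrightarrow> Z0 y \<and> P p y \<and> p \<notin> Q" for p y
    have dZ: "dsl n Z"
      unfolding Z_def by (intro rslI dpi Z0' P' Q') simp_all
    have ZR: "R y y" if "Z p y" for p y
      using that Z0R by (simp add: Z_def)
    have finZ: "finite {b. \<exists>y. length y = n \<and> Z p y \<and> Bd j b a y}" if j: "j < n" "length a = j" for p j a
    proof (cases "p \<in> Q")
      case True
      then show ?thesis
        by (simp add: Z_def)
    next
      case False
      then have "finite {b. \<exists>y. length y = n \<and> R y y \<and> P p y \<and> Bd j b a y}"
        using j unfolding Q_def by blast
      then show ?thesis
        by (rule rev_finite_subset) (use Z0R in \<open>auto simp: Z_def\<close>)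
    qed
    have "\<exists>Ds. (\<forall>D\<in>set Ds. dsll 0 n D \<and> (\<forall>p a y y'. length a = 0 \<longrightarrow> R y y' \<longrightarrow> D p a y = D p a y')) \<and>
        (\<forall>p a y y'. length a = 0 \<longrightarrow> Z p y \<longrightarrow> Z p y' \<longrightarrow> meets 0 a y \<longrightarrow> meets 0 a y' \<longrightarrow>
          (\<forall>D\<in>set Ds. D p a y = D p a y') \<longrightarrow> R y y')"
    proof (rule finite_quotient_separators[OF dZ])
      show "R y y" if "Z p y" for p y
        using that by (rule ZR)
      show "finite {b. \<exists>y. length y = n \<and> Z p y \<and> Bd j b a y}" if "j < n" "length a = j" for p j a
        using that by (rule finZ)
    qed simp
    then obtain Ds where Ds:
      "\<forall>D\<in>set Ds. dsll 0 n D \<and> (\<forall>p a y y'. length a = 0 \<longrightarrow> R y y' \<longrightarrow> D p a y = D p a y')"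
      "\<forall>p a y y'. length a = 0 \<longrightarrow> Z p y \<longrightarrow> Z p y' \<longrightarrow> meets 0 a y \<longrightarrow> meets 0 a y' \<longrightarrow>
        (\<forall>D\<in>set Ds. D p a y = D p a y') \<longrightarrow> R y y'"
      by (elim exE conjE) (rule that)
    have D: "\<And>D. D \<in> set Ds \<Longrightarrow> dsll 0 n D"
        "\<And>D p y y'. D \<in> set Ds \<Longrightarrow> R y y' \<Longrightarrow> D p [] y = D p [] y'"
      using Ds(1)[THEN bspec] by simp_all
    have sep: "\<And>p y y'. Z p y \<Longrightarrow> Z p y' \<Longrightarrow> meets 0 [] y \<Longrightarrow> meets 0 [] y' \<Longrightarrow>
        (\<forall>D\<in>set Ds. D p [] y = D p [] y') \<Longrightarrow> R y y'"
      using Ds(2)[rule_format] by simp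
    \<comment> \<open>The finite boundary has a least point outside \<open>Q\<close>, and this point
      depends only on the class.\<close>
    define low where "low y p \<longleftrightarrow> P p y \<and> p \<notin> Q \<and> (\<forall>q. q < p \<longrightarrow> \<not> (P q y \<and> q \<notin> Q))" for y p
    have low_unique: "p = q" if "low y p" "low y q" for y p q
      using that unfolding low_def by (metis linorder_neqE)
    have low_ex: "\<exists>p. low y p" if y: "Z1 y" for y
    proof -
      let ?S = "{p. P p y \<and> p \<notin> Q}"
      have "length y = n"
        using y Z0R R_length unfolding Z1_def by blast
      then have f: "finite ?S"
        using finP[of y] by simp
      have "?S \<noteq> {}"
        using y by (auto simp: Z1_def)
      then have "Min ?S \<in> ?S"
        using f by (intro Min_in)
      then have "low y (Min ?S)"
        unfolding low_def using Min_le[OF f] by (auto simp: not_less[symmetric])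
      then show ?thesis
        by blast
    qed
    define g0 where "g0 y = (if \<exists>p. low y p then THE p. low y p else c0)" for y
    have g0_low: "g0 y = p" if "low y p" for y p
      unfolding g0_def using that low_unique by auto
    have g0_iff: "g0 y = b \<longleftrightarrow> low y b \<or> (\<forall>p. \<not> low y p) \<and> b = c0" for y b
    proof (cases "\<exists>p. low y p")
      case True
      then obtain p where "low y p"
        by blast
      then show ?thesis
        using g0_low low_unique by blast
    next
      case False
      then show ?thesis
        unfolding g0_def by auto
    qed
    have g0: "dsl n (\<lambda>b y. g0 y = b)"
      unfolding g0_iff low_def by (intro rslI dpi P' Q') simp_all
    note g0' = rslD[OF g0]
    have low_cong: "low y = low y'" if "R y y'" for y y'
      unfolding low_def using P_cong[OF that] by simp
    have g0_cong: "g0 y = g0 y'" if "R y y'" for y y'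
      by (simp only: g0_def low_cong[OF that])
    have "invariant_function g0"
      unfolding invariant_function_def using g0 g0_cong by blast
    moreover have "invariant_function (\<lambda>y. if D (g0 y) [] y then c1 else c0)" if D': "D \<in> set Ds" for D
    proof (rule invariant_indicator)
      \<comment> \<open>The bits are uniform in \<open>p\<close>, so the invariant
        \<open>g0 y\<close> can be substituted for \<open>p\<close>.\<close>
      have *: "D (g0 y) [] y \<longleftrightarrow> (\<exists>p. g0 y = p \<and> D p [] y)" for y
        by simp
      note D'' = rsllD[OF D(1)[OF D']]
      show "dl n (\<lambda>y. D (g0 y) [] y)"
        unfolding * by (intro rlI dpr_ex dpr_conj g0' D'' tmr_var tupr_map tupr_Nil) simp_all
      show "D (g0 y) [] y = D (g0 y') [] y'" if "R y y'" for y y'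
        using D(2)[OF D' that] g0_cong[OF that] by simp
    qed
    ultimately have "\<forall>g\<in>set (g0 # map (\<lambda>D y. if D (g0 y) [] y then c1 else c0) Ds). invariant_function g"
      by auto
    moreover have "R y y'" if y: "Z1 y" "Z1 y'"
      and g: "\<forall>g\<in>set (g0 # map (\<lambda>D y. if D (g0 y) [] y then c1 else c0) Ds). g y = g y'" for y y'
    proof -
      obtain p where p: "low y p"
        using low_ex[OF y(1)] by blast
      obtain p' where p': "low y' p'"
        using low_ex[OF y(2)] by blast
      have "g0 y = g0 y'"
        using g by simp
      then have pp: "p' = p"
        using g0_low p p' by metis
      have Zp: "Z p y" "Z p y'"
        using y p p' pp unfolding Z_def Z1_def low_def by blast+
      have m: "meets 0 [] z" if "Z p z" for z
        unfolding meets_def using ZR[OF that] R_length by (intro exI[of _ z]) auto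
      have "\<forall>D\<in>set Ds. D p [] y = D p [] y'"
        using g c g0_low[OF p] g0_low[OF p'] pp by (auto split: if_splits)
      then show ?thesis
        using sep Zp m by blast
    qed
    ultimately show ?thesis
      unfolding separable_def by blast
  qed

  moreover have "separable Z2"
  proof -
    \<comment> \<open>The slice of a class in \<open>Z2\<close> is a nonempty union of cells of
      \<open>Q\<close>, so it contains a representative \<open>s\<close>. Classes whose slice
      contains \<open>s\<close> are treated with the longer prefix \<open>a0 @ [s]\<close>.\<close>
    obtain S where S: "finite S" "\<And>x. \<exists>s\<in>S. cut_eq Q x s"
      using ex_cut_representatives[OF finQ] by blast
    have "separable (\<lambda>y. \<exists>s\<in>S. Z2 y \<and> slice i a0 y s)"
    proof (rule separable_UN[OF S(1)])
      fix s
      show 1: "dl n (\<lambda>y. Z2 y \<and> slice i a0 y s)"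
        using i a0 by (intro rlI dpi slice' rlD[OF dZ2]) simp_all
      show 2: "(Z2 y \<and> slice i a0 y s) = (Z2 y' \<and> slice i a0 y' s)" if "R y y'" for y y'
        using Z2_cong[OF that] slice_cong[OF that] by simp
      show "separable (\<lambda>y. Z2 y \<and> slice i a0 y s)"
        using Suc.hyps(2) i a0 1 Z0R 2
        by (intro Suc.hyps(1)[of "Suc i" "a0 @ [s]"]) (auto simp: slice_def Z2_def)
    qed
    then show ?thesis
    proof (rule separable_mono)
      fix y
      assume y: "Z2 y"
      then have "length y = n" "meets i a0 y"
        using Z0R R_length Z0_meets unfolding Z2_def by blast+
      then obtain x where x: "slice i a0 y x"
        using meets_slice[OF i] by blast
      obtain s where s: "s \<in> S" "cut_eq Q x s"
        using S(2) by blast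
      have "{b. bd (slice i a0 y) b} \<subseteq> Q"
        using y unfolding Z2_def P_def Bd_def by blast
      then have "cut_eq {b. bd (slice i a0 y) b} x s"
        using s(2) by (auto simp: cut_eq_def)
      moreover have "tames {b. bd (slice i a0 y) b} (slice i a0 y)"
        using tame_slice[OF i a0 \<open>length y = n\<close>] tames_by_bd by blast
      ultimately have "slice i a0 y s"
        using x by (simp add: tames_def)
      then show "\<exists>s\<in>S. Z2 y \<and> slice i a0 y s"
        using s(1) y by blast
    qed
  qed
  ultimately have "separable (\<lambda>y. Z1 y \<or> Z2 y)"
    using dZ1 Z1_cong by (intro separable_Un)
  then show ?case
    by (rule separable_mono) (auto simp: Z1_def Z2_def)
qed

lemma separable_domain: "separable (\<lambda>y. R y y)"
proof (rule separable_prefix[of 0 "[]"])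
  show "dl n (\<lambda>y. R y y)"
    by (intro rlI rllD[OF R] dpi) simp_all
  show "R y y = R y' y'" if "R y y'" for y y'
    using that R_refl R_sym by blast
  show "meets 0 [] y" if "R y y" for y
    unfolding meets_def using that R_length by (intro exI[of _ y]) auto
qed simp_all

end

text \<open>The endpoints of the finitely many intervals, together with the isolated points, tame
  the set.\<close>

lemma omin_o_minimal:
  fixes M :: "('f, 'r, 'a::unbounded_dense_linorder) struct"
  assumes "o_minimal L M"
  shows "omin L M"
proof
  fix S :: "'a \<Rightarrow> bool"
  assume "dpr L M M id UNIV (\<lambda>e. S (e 0)) (\<lambda>e. S (e 0))"
  then have "dpr L M M id UNIV (\<lambda>e. S (hd (map e [0..<1]))) (\<lambda>e. S (hd (map e [0..<1])))"
    by simp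
  from dpr_definable[OF this] obtain \<phi> c where
    c: "wf_fm L (1 + length c) \<phi>" "{x. length x = 1 \<and> S (hd x)} = def_set M 1 \<phi> c"
    by auto
  have "{[x] | x. x \<in> {x. S x}} = {x. length x = 1 \<and> S (hd x)}"
    by (auto simp: length_Suc_conv)
  then have "definable L M 1 {[x] | x. x \<in> {x. S x}}"
    using c unfolding definable_over_def by auto
  from assms[unfolded o_minimal_def, rule_format, OF this]
  obtain \<I> where I: "finite \<I>" "\<And>I. I \<in> \<I> \<Longrightarrow> is_interval I \<or> (\<exists>a. I = {a})" "{x. S x} = \<Union>\<I>"
    by blast
  have "\<exists>P. tames P (\<lambda>x. x \<in> I)" if "I \<in> \<I>" for I
  proof -
    have "tames {} (\<lambda>x. x \<in> I)" if "I = UNIV"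
      using that by (simp add: tames_def)
    moreover have "tames {a} (\<lambda>x. x \<in> I)" if "I = {a<..} \<or> I = {..<a} \<or> I = {a}" for a
      using that by (auto simp: tames_def cut_eq_def)
    moreover have "tames {a, b} (\<lambda>x. x \<in> I)" if "I = {a<..<b}" for a b
      using that by (auto simp: tames_def cut_eq_def)
    ultimately show ?thesis
      using I(2)[OF that] unfolding is_interval_def by blast
  qed
  then obtain p where p: "\<And>I. I \<in> \<I> \<Longrightarrow> tames (p I) (\<lambda>x. x \<in> I)"
    by metis
  have "S x = S y" if xy: "cut_eq (\<Union>(p ` \<I>)) x y" for x y
  proof -
    have "x \<in> I \<longleftrightarrow> y \<in> I" if "I \<in> \<I>" for I
    proof -
      have "cut_eq (p I) x y"
        using xy that by (auto simp: cut_eq_def)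
      then show ?thesis
        using p[OF that] by (simp add: tames_def)
    qed
    then show ?thesis
      using I(3) by blast
  qed
  moreover have "finite (\<Union>(p ` \<I>))"
    using I(1) p by (auto simp: tames_def)
  ultimately have "tames (\<Union>(p ` \<I>)) S"
    by (auto simp: tames_def)
  then show "\<exists>P. tames P S"
    by blast
qed (use dense lt_ex gt_ex in blast)+

theorem theorem7p7:
  fixes L :: "('f, 'r) lang"
    and M :: "('f, 'r, 'a::unbounded_dense_linorder) struct"
    and N :: "('f, 'r, 'b::linorder) struct"
    and h :: "'a \<Rightarrow> 'b"
    and \<kappa> :: "'k rel"
    and A :: "'b set"
    and Y :: "'a list set"
    and E :: "('a list \<times> 'a list) set"
    and X :: "'a list set \<Rightarrow> 'a list set"
    and n k :: nat
  assumes "o_minimal L M"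
    and "quotient_over L M UNIV n Y E"
    and "quotient_has_dim L M N h \<kappa> A n Y E 1"
    and "definable_family L M n Y E k X"
  shows "\<exists>m f. definable_quotient_map L M n Y E m f \<and> F_injective (Y // E) X f"
proof -
  interpret omin L M
    using assms(1) by (rule omin_o_minimal)
  have Y: "definable L M n Y" and E: "equiv Y E" "definable L M (n + n) (rel_set E)"
    using assms(2) by (auto simp: quotient_over_def)
  have lenY: "length y = n" if "y \<in> Y" for y
    using Y that unfolding definable_over_def def_set_def by auto
  let ?F = "{y @ x | y x. y \<in> Y \<and> x \<in> X (E `` {y})}"
  have F: "definable L M (n + k) ?F" and Xk: "\<And>t x. t \<in> Y // E \<Longrightarrow> x \<in> X t \<Longrightarrow> length x = k"
    using assms(4) unfolding definable_family_def by auto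
  have rl_definable: "dl q (\<lambda>x. x \<in> D)" if D: "definable L M q D" for q D
  proof -
    obtain \<phi> c where c: "wf_fm L (q + length c) \<phi>" "D = def_set M q \<phi> c"
      using D unfolding definable_over_def by blast
    show ?thesis
      unfolding c(2) by (intro rlI dpr_def_set_id[OF c(1)] dpi) simp_all
  qed
  note Y' = rlD[OF rl_definable[OF Y]] and F' = rlD[OF rl_definable[OF F]]
  have F_iff: "y @ x \<in> ?F \<longleftrightarrow> x \<in> X (E `` {y})" if "y \<in> Y" for y x
    using that lenY by auto
  \<comment> \<open>Since \<open>R\<close> contains \<open>E\<close>, predicates invariant under
    \<open>R\<close> are invariant under \<open>E\<close>. The dimension hypothesis on
    \<open>E\<close> therefore yields the condition \<open>one_dim\<close> for
    \<open>R\<close>.\<close>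
  define R where "R y y' \<longleftrightarrow> y \<in> Y \<and> y' \<in> Y \<and> X (E `` {y}) = X (E `` {y'})" for y y'
  have R_iff: "R y y' \<longleftrightarrow> y \<in> Y \<and> y' \<in> Y \<and> (\<forall>x. length x = k \<longrightarrow> (y @ x \<in> ?F) = (y' @ x \<in> ?F))" for y y'
  proof -
    have "X (E `` {y}) = X (E `` {y'}) \<longleftrightarrow> (\<forall>x. length x = k \<longrightarrow> (y @ x \<in> ?F) = (y' @ x \<in> ?F))"
      if "y \<in> Y" "y' \<in> Y"
      unfolding F_iff[OF that(1)] F_iff[OF that(2)]
      using Xk[OF quotientI[OF that(1)]] Xk[OF quotientI[OF that(2)]] by blast
    then show ?thesis
      unfolding R_def by blast
  qed
  have E_R: "R y y'" if "(y, y') \<in> E" for y y'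
    using that E(1) equiv_class_eq[OF E(1) that] unfolding R_def equiv_def by auto
  interpret one_dim_quotient L M n R
  proof
    show "dll n n R"
      unfolding R_iff by (intro rllI dpi Y' F') simp_all
    show "length y = n" if "R y y'" for y y'
      using that lenY by (simp add: R_def)
    show "R y' y" if "R y y'" for y y'
      using that by (simp add: R_def)
    show "R y y''" if "R y y'" "R y' y''" for y y' y''
      using that by (simp add: R_def)
    fix G H i
    assume GH: "dsl n G" "dsll i n H" "\<And>y. length y = n \<Longrightarrow> finite {b. G b y}"
      "\<And>a y. length a = i \<Longrightarrow> length y = n \<Longrightarrow> finite {b. H b a y}"
      "\<And>y y' b. R y y' \<Longrightarrow> G b y \<Longrightarrow> G b y'"
      "\<And>y y' a b. R y y' \<Longrightarrow> length a = i \<Longrightarrow> H b a y \<Longrightarrow> H b a y'"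
    have "R y y \<longleftrightarrow> y \<in> Y" for y
      by (simp add: R_def)
    moreover have "finite {b. \<exists>a. length a = i \<and> infinite {b'. \<exists>y. length y = n \<and> y \<in> Y \<and> G b y \<and> H b' a y}}"
      using GH(5,6)[OF E_R]
      by (intro no_two_dimensional_image[OF omin_axioms Y E assms(3) GH(1,2)] GH(3,4)) blast+
    ultimately show "finite {b. \<exists>a. length a = i \<and> infinite {b'. \<exists>y. length y = n \<and> R y y \<and> G b y \<and> H b' a y}}"
      by (simp only:)
  qed
  obtain gs where gs: "\<And>g. g \<in> set gs \<Longrightarrow> invariant_function g"
    "\<And>y y'. y \<in> Y \<Longrightarrow> y' \<in> Y \<Longrightarrow> (\<forall>g\<in>set gs. g y = g y') \<Longrightarrow> R y y'"
    using separable_domain unfolding separable_def R_def by blast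
  define m where "m = length gs"
  \<comment> \<open>The chosen representative does not matter, as the functions in \<open>gs\<close>
    are constant on classes; definability comes from the functions, not from the choice.\<close>
  define f where "f t = map (\<lambda>g. g (SOME y. y \<in> t)) gs" for t
  have f: "f (E `` {y}) = map (\<lambda>g. g y) gs" if y: "y \<in> Y" for y
  proof -
    define y' where "y' = (SOME y'. y' \<in> E `` {y})"
    have "y' \<in> E `` {y}"
      unfolding y'_def using equiv_class_self[OF E(1) y] by (rule someI)
    then have "R y y'"
      by (intro E_R) simp
    then have "g y' = g y" if "g \<in> set gs" for g
      using gs(1)[OF that] unfolding invariant_function_def by metis
    then show ?thesis
      unfolding f_def y'_def[symmetric] by simp
  qed
  have "definable L M (n + m) {y @ z | y z. y \<in> Y \<and> f (E `` {y}) = z}"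
  proof -
    have "dp UNIV (\<lambda>e. map e [0..<n] \<in> Y \<and> (\<forall>i<m. (gs ! i) (map e [0..<n]) = e (n + i)))"
    proof (intro dpr_conj dpr_ball_less Y' tupr_map)
      fix i
      assume "i < m"
      then have "dsl n (\<lambda>b y. (gs ! i) y = b)"
        using gs(1)[of "gs ! i"] by (simp add: m_def invariant_function_def)
      then show "dp UNIV (\<lambda>e. (gs ! i) (map e [0..<n]) = e (n + i))"
        by (rule rslD) (intro dpi; simp)+
    qed simp
    then have "dp UNIV (\<lambda>e. (\<lambda>u. take n u \<in> Y \<and> (\<forall>i<m. (gs ! i) (take n u) = u ! (n + i))) (map e [0..<n + m]))"
      by (simp add: take_map del: upt_Suc)
    from dpr_definable[OF this] have "definable L M (n + m)
        {u. length u = n + m \<and> take n u \<in> Y \<and> (\<forall>i<m. (gs ! i) (take n u) = u ! (n + i))}"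
      unfolding definable_over_def by auto
    also have "{u. length u = n + m \<and> take n u \<in> Y \<and> (\<forall>i<m. (gs ! i) (take n u) = u ! (n + i))} =
        {y @ z | y z. y \<in> Y \<and> f (E `` {y}) = z}" (is "?U = ?V")
    proof (intro set_eqI iffI)
      fix u
      assume u: "u \<in> ?U"
      then have "drop n u = map (\<lambda>g. g (take n u)) gs"
        by (intro nth_equalityI) (auto simp: m_def)
      then show "u \<in> ?V"
        using u f[of "take n u"] append_take_drop_id[of n u, symmetric]
        by (intro CollectI exI[of _ "take n u"] exI[of _ "drop n u"] conjI) simp_all
    next
      fix u
      assume "u \<in> ?V"
      then obtain y where "y \<in> Y" "u = y @ map (\<lambda>g. g y) gs"
        using f by auto
      then show "u \<in> ?U"
        using lenY[of y] by (simp add: m_def nth_append)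
    qed
    finally show ?thesis .
  qed
  then have "definable_quotient_map L M n Y E m f"
    unfolding definable_quotient_map_def by (simp add: f_def m_def)
  moreover have "F_injective (Y // E) X f"
    unfolding F_injective_def F_map_def
  proof (intro conjI ballI impI)
    fix t s
    assume "t \<in> Y // E" "s \<in> Y // E"
    then obtain y y' where y: "y \<in> Y" "t = E `` {y}" "y' \<in> Y" "s = E `` {y'}"
      by (auto elim!: quotientE)
    have fts: "f t = f s \<longleftrightarrow> (\<forall>g\<in>set gs. g y = g y')"
      using f y by simp
    show "f t = f s" if "X t = X s"
      unfolding fts using that y gs(1) by (auto simp: R_def invariant_function_def)
    show "X t = X s" if "f t = f s"
      using gs(2)[OF y(1,3)] that y unfolding fts R_def by simp
  qed
  ultimately show ?thesis
    by blast
qed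

end
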